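(* Let $n\ge m\ge 1$. Let $G$ be a finite nonabelian $2$-group with a central subgroup $N\cong\mathbb{Z}_{2^n}\times\mathbb{Z}_{2^m}$ such that $G/N$ is an elementary abelian $2$-group, and with $G'=\langle c\rangle\cong\mathbb{Z}_2$. Suppose that the center of $G$ is $$\zeta G=\langle z_1\rangle\times\langle z_2\rangle\times\cdots\times\langle z_r\rangle\cong\mathbb{Z}_{2^{n+1}}\times\mathbb{Z}_{2^m}\times\underbrace{\mathbb{Z}_2\times\cdots\times\mathbb{Z}_2}_{r-2},\qquad N=\langle z_1^2\rangle\times\langle z_2\rangle$$ (with $|z_1|=2^{n+1}$, $|z_2|=2^m$), and that $c\in\langle z_1\rangle$. Then $G$ is isomorphic to one of the following groups, for an integer $k$ in the indicated range, where $\mathbb{Z}_2^{(r-2)}$ is the direct product of $r-2$ copies of $\mathbb{Z}_2$: (i) $\bigl(M_2(m+1,1,1)\mathbin{\mathsf Y}D_8^{\mathsf Y(k-1)}\mathbin{\mathsf Y}\mathbb{Z}_{2^{n+1}}\bigr)\times\mathbb{Z}_2^{(r-2)}$, $k\ge1$; (ii) $\bigl(M_2(m+1,1,1)\mathbin{\mathsf Y}Q_8\mathbin{\mathsf Y}D_8^{\mathsf Y(k-2)}\mathbin{\mathsf Y}\mathbb{Z}_{2^{n+1}}\bigr)\times\mathbb{Z}_2^{(r-2)}$, $k\ge2$; (iii) $\bigl(D_8^{\mathsf Y k}\mathbin{\mathsf Y}\mathbb{Z}_{2^{n+1}}\bigr)\times\mathbb{Z}_{2^m}\times\mathbb{Z}_2^{(r-2)}$,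 $k\ge1$; (iv) $\bigl(Q_8\mathbin{\mathsf Y}D_8^{\mathsf Y(k-1)}\mathbin{\mathsf Y}\mathbb{Z}_{2^{n+1}}\bigr)\times\mathbb{Z}_{2^m}\times\mathbb{Z}_2^{(r-2)}$, $k\ge1$.
   Context: $D_8$, $Q_8$ are the dihedral and quaternion groups of order $8$. $M_2(w,1,1)=\langle a,b,d\mid a^{2^w}=b^{2}=d^2=1,\ [a,b]=d,\ [d,a]=[d,b]=1\rangle$ for $w\ge1$. $H\mathbin{\mathsf Y}K$ denotes the central product (a group $HK$ with $[H,K]=1$). In all the central products listed, the derived subgroups (of order $2$) of the nonabelian factors and the unique subgroup of order $2$ of the cyclic central factor are all identified with one common subgroup $\langle c\rangle$ of order $2$, and factors intersect exactly in $\langle c\rangle$. $D_8^{\mathsf Y j}$ is the central product of $j$ copies of $D_8$ (omitted if $j=0$). *)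

theory Defs
  imports "HOL-Algebra.Algebra"
begin

section \<open>Groups given by generators and relations\<close>

text \<open>A letter \<open>(s, True)\<close> stands for the generator \<open>s\<close> and \<open>(s, False)\<close> for its formal inverse.\<close>

type_synonym 'g word = "('g \<times> bool) list"

definition words :: "'g set \<Rightarrow> 'g word set" where
  "words S = lists (S \<times> UNIV)"

definition word_inv :: "'g word \<Rightarrow> 'g word" where
  "word_inv w = rev (map (\<lambda>(s, e). (s, \<not> e)) w)"

definition word_pow :: "'g word \<Rightarrow> nat \<Rightarrow> 'g word" where
  "word_pow w n = concat (replicate n w)"

definition word_comm :: "'g word \<Rightarrow> 'g word \<Rightarrow> 'g word" where
  "word_comm u v = word_inv u @ word_inv v @ u @ v"

text \<open>A relation \<open>p = q\<close> is a pair \<open>(p, q)\<close>. The following is the congruence on words over \<open>S\<close>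
  generated by free cancellation and the relations in \<open>R\<close>.\<close>

inductive word_eq :: "'g set \<Rightarrow> ('g word \<times> 'g word) set \<Rightarrow> 'g word \<Rightarrow> 'g word \<Rightarrow> bool"
  for S R where
  refl: "u \<in> words S \<Longrightarrow> word_eq S R u u"
| sym: "word_eq S R u v \<Longrightarrow> word_eq S R v u"
| trans: "word_eq S R u v \<Longrightarrow> word_eq S R v w \<Longrightarrow> word_eq S R u w"
| cancel: "u \<in> words S \<Longrightarrow> v \<in> words S \<Longrightarrow> s \<in> S \<Longrightarrow>
    word_eq S R (u @ [(s, e), (s, \<not> e)] @ v) (u @ v)"
| relation: "u \<in> words S \<Longrightarrow> v \<in> words S \<Longrightarrow> (p, q) \<in> R \<Longrightarrow> p \<in> words S \<Longrightarrow> q \<in> words S \<Longrightarrow>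
    word_eq S R (u @ p @ v) (u @ q @ v)"

definition presented_group :: "'g set \<Rightarrow> ('g word \<times> 'g word) set \<Rightarrow> 'g word set monoid" where
  "presented_group S R =
     \<lparr>carrier = words S // {(u, v). word_eq S R u v},
      monoid.mult = (\<lambda>A B. \<Union>u\<in>A. \<Union>v\<in>B. {w. word_eq S R (u @ v) w}),
      one = {w. word_eq S R [] w}\<rparr>"

subsection \<open>Basic properties\<close>

definition word_class :: "'g set \<Rightarrow> ('g word \<times> 'g word) set \<Rightarrow> 'g word \<Rightarrow> 'g word set" where
  "word_class S R u = {w. word_eq S R u w}"

lemma words_append [simp]: "u @ v \<in> words S \<longleftrightarrow> u \<in> words S \<and> v \<in> words S"
  by (auto simp: words_def)

lemma words_Nil [simp]: "[] \<in> words S"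
  by (simp add: words_def)

lemma words_Cons [simp]: "(s, e) # w \<in> words S \<longleftrightarrow> s \<in> S \<and> w \<in> words S"
  by (auto simp: words_def)

lemma words_word_inv [simp]: "word_inv w \<in> words S \<longleftrightarrow> w \<in> words S"
  by (auto simp: words_def word_inv_def in_lists_conv_set)

lemma word_eq_in_words: "word_eq S R u v \<Longrightarrow> u \<in> words S \<and> v \<in> words S"
  by (induction rule: word_eq.induct) auto

lemma word_eq_context:
  assumes "word_eq S R u v" "x \<in> words S" "y \<in> words S"
  shows "word_eq S R (x @ u @ y) (x @ v @ y)"
  using assms
proof (induction rule: word_eq.induct)
  case (cancel u v s e)
  then show ?case using word_eq.cancel[of "x @ u" S "v @ y" s R e] by simp
next
  case (relation u v p q)
  then show ?case using word_eq.relation[of "x @ u" S "v @ y" p q R] by simp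
qed (auto intro: word_eq.intros)

lemma word_eq_append:
  assumes "word_eq S R u u'" "word_eq S R v v'"
  shows "word_eq S R (u @ v) (u' @ v')"
proof -
  have "word_eq S R (u @ v) (u' @ v)"
    using word_eq_context[OF assms(1), of "[]" v] word_eq_in_words[OF assms(2)] by simp
  moreover have "word_eq S R (u' @ v) (u' @ v')"
    using word_eq_context[OF assms(2), of u' "[]"] word_eq_in_words[OF assms(1)] by simp
  ultimately show ?thesis by (rule word_eq.trans)
qed

lemma word_eq_inv_left: "w \<in> words S \<Longrightarrow> word_eq S R (word_inv w @ w) []"
proof (induction w)
  case Nil
  then show ?case by (simp add: word_inv_def word_eq.refl)
next
  case (Cons a w)
  obtain s e where a: "a = (s, e)" by force
  have "word_eq S R (word_inv w @ [(s, \<not> e), (s, \<not> \<not> e)] @ w) (word_inv w @ w)"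
    using Cons.prems by (intro word_eq.cancel) (auto simp: a)
  moreover have "word_inv (a # w) @ a # w = word_inv w @ [(s, \<not> e), (s, \<not> \<not> e)] @ w"
    by (simp add: word_inv_def a)
  ultimately show ?case using Cons by (auto simp: a intro: word_eq.trans)
qed

lemma word_class_eq_iff:
  assumes "u \<in> words S"
  shows "word_class S R u = word_class S R v \<longleftrightarrow> word_eq S R u v"
  using assms unfolding word_class_def
  by (auto intro: word_eq.refl word_eq.sym word_eq.trans)

lemma carrier_presented_group: "carrier (presented_group S R) = word_class S R ` words S"
  by (auto simp: presented_group_def word_class_def quotient_def)

lemma one_presented_group: "\<one>\<^bsub>presented_group S R\<^esub> = word_class S R []"
  by (simp add: presented_group_def word_class_def)

lemma mult_presented_group:
  assumes "u \<in> words S" "v \<in> words S"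
  shows "word_class S R u \<otimes>\<^bsub>presented_group S R\<^esub> word_class S R v = word_class S R (u @ v)"
proof -
  have "(\<Union>x\<in>word_class S R u. \<Union>y\<in>word_class S R v. {w. word_eq S R (x @ y) w})
      = word_class S R (u @ v)"
    using assms unfolding word_class_def
    by (auto intro: word_eq.refl word_eq.trans word_eq_append word_eq.sym)
  then show ?thesis by (simp add: presented_group_def)
qed

lemma group_presented_group [simp]: "group (presented_group S R)"
proof (rule groupI)
  fix x assume "x \<in> carrier (presented_group S R)"
  then obtain u where u: "u \<in> words S" "x = word_class S R u"
    by (auto simp: carrier_presented_group)
  show "\<exists>y\<in>carrier (presented_group S R). y \<otimes>\<^bsub>presented_group S R\<^esub> x = \<one>\<^bsub>presented_group S R\<^esub>"
    using u word_eq_inv_left[OF u(1)]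
    by (intro bexI[of _ "word_class S R (word_inv u)"])
       (auto simp: mult_presented_group one_presented_group carrier_presented_group word_class_eq_iff)
qed (auto simp: carrier_presented_group one_presented_group mult_presented_group)

text \<open>The universal property: an assignment of the generators into a group that respects the
  relations extends to a homomorphism.\<close>

primrec (in monoid) word_val :: "('g \<Rightarrow> 'a) \<Rightarrow> 'g word \<Rightarrow> 'a" where
  "word_val f [] = \<one>"
| "word_val f (a # w) = (if snd a then f (fst a) else inv (f (fst a))) \<otimes> word_val f w"

lemma (in group) word_val_closed:
  "f ` S \<subseteq> carrier G \<Longrightarrow> w \<in> words S \<Longrightarrow> word_val f w \<in> carrier G"
  by (induction w) (auto simp: words_def)

lemma (in group) word_val_append:
  assumes "f ` S \<subseteq> carrier G" "u \<in> words S" "v \<in> words S"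
  shows "word_val f (u @ v) = word_val f u \<otimes> word_val f v"
  using assms(2)
proof (induction u)
  case (Cons a u)
  then have "fst a \<in> S" "u \<in> words S" by (auto simp: words_def)
  with Cons assms show ?case
    by (auto simp: m_assoc word_val_closed[OF assms(1)] image_subset_iff)
qed (simp add: word_val_closed[OF assms(1,3)])

lemma (in group) word_val_cong:
  assumes f: "f ` S \<subseteq> carrier G"
    and R: "\<And>p q. (p, q) \<in> R \<Longrightarrow> word_val f p = word_val f q"
    and "word_eq S R u v"
  shows "word_val f u = word_val f v"
  using assms(3)
proof (induction rule: word_eq.induct)
  case (cancel u v s e)
  then have "f s \<in> carrier G" using f by auto
  with cancel show ?case
    by (cases e) (auto simp: word_val_append[OF f] word_val_closed[OF f] m_assoc[symmetric])
next
  case (relation u v p q)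
  then show ?case by (simp add: word_val_append[OF f] R[OF relation(3)])
qed auto

lemma (in group) presented_group_hom:
  assumes f: "f ` S \<subseteq> carrier G"
    and R: "\<And>p q. (p, q) \<in> R \<Longrightarrow> word_val f p = word_val f q"
  shows "\<exists>h \<in> hom (presented_group S R) G. \<forall>w\<in>words S. h (word_class S R w) = word_val f w"
proof -
  define h where "h A = word_val f (SOME w. w \<in> A)" for A
  have h: "h (word_class S R w) = word_val f w" if "w \<in> words S" for w
  proof -
    have "w \<in> word_class S R w" using that by (simp add: word_class_def word_eq.refl)
    then have "(SOME v. v \<in> word_class S R w) \<in> word_class S R w" by (metis someI)
    then show ?thesis
      using word_val_cong[OF f R] unfolding h_def word_class_def by auto
  qed
  have "h \<in> hom (presented_group S R) G"
    by (rule homI) (auto simp: carrier_presented_group mult_presented_group h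
        word_val_append[OF f] word_val_closed[OF f])
  with h show ?thesis by blast
qed

section \<open>The groups occurring as factors\<close>

datatype gen = GenA | GenB | GenD

abbreviation "wa \<equiv> [(GenA, True)]"
abbreviation "wb \<equiv> [(GenB, True)]"
abbreviation "wd \<equiv> [(GenD, True)]"

definition M2 :: "nat \<Rightarrow> gen word set monoid" where
  "M2 w = presented_group {GenA, GenB, GenD}
     {(word_pow wa (2 ^ w), []), (word_pow wb 2, []), (word_pow wd 2, []),
      (word_comm wa wb, wd), (word_comm wd wa, []), (word_comm wd wb, [])}"

definition D8 :: "gen word set monoid" where
  "D8 = presented_group {GenA, GenB}
     {(word_pow wa 4, []), (word_pow wb 2, []), (word_inv wb @ wa @ wb, word_inv wa)}"

definition Q8 :: "gen word set monoid" where
  "Q8 = presented_group {GenA, GenB}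
     {(word_pow wa 4, []), (word_pow wb 2, word_pow wa 2), (word_inv wb @ wa @ wb, word_inv wa)}"

text \<open>A copy of \<^const>\<open>integer_mod_group\<close> on the same type as the groups above, so that it can be
  a member of the same list of factors.\<close>

definition Cyc :: "nat \<Rightarrow> gen word set monoid" where
  "Cyc N = presented_group {GenA} {(word_pow wa N, [])}"

lemma word_pow_0 [simp]: "word_pow w 0 = []"
  and word_pow_Suc [simp]: "word_pow w (Suc n) = w @ word_pow w n"
  by (simp_all add: word_pow_def)

lemma words_word_pow [simp]: "w \<in> words S \<Longrightarrow> word_pow w n \<in> words S"
  by (induction n) auto

lemma Cyc_normal_form:
  assumes "N > 0" "w \<in> words {GenA}"
  shows "\<exists>j<N. word_eq {GenA} {(word_pow wa N, [])} w (word_pow wa j)"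
  using assms(2)
proof (induction w)
  case Nil
  then show ?case using assms(1) by (auto intro!: exI[of _ 0] word_eq.refl)
next
  case (Cons l w)
  let ?eq = "word_eq {GenA} {(word_pow wa N, [])}"
  obtain e where l: "l = (GenA, e)" and w: "w \<in> words {GenA}"
    using Cons.prems by (cases l) auto
  obtain j where j: "j < N" "?eq w (word_pow wa j)" using Cons.IH[OF w] by blast
  have lj: "?eq (l # w) (l # word_pow wa j)"
    using word_eq_context[OF j(2), of "[l]" "[]"] by (simp add: l)
  have N: "?eq (word_pow wa N) []"
    using word_eq.relation[of "[]" "{GenA}" "[]" "word_pow wa N" "[]" "{(word_pow wa N, [])}"] by simp
  have cancel: "?eq ((GenA, False) # word_pow wa (Suc i)) (word_pow wa i)" for i
    using word_eq.cancel[of "[]" "{GenA}" "word_pow wa i" GenA _ False] by simp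
  show ?case
  proof (cases e)
    case True
    then have eq: "?eq (l # w) (word_pow wa (Suc j))" using lj by (simp add: l)
    show ?thesis
    proof (cases "Suc j = N")
      case True
      then have "?eq (l # w) (word_pow wa 0)" using word_eq.trans[OF eq] N by simp
      then show ?thesis using assms(1) by blast
    next
      case False
      with eq j(1) show ?thesis by (intro exI[of _ "Suc j"]) simp
    qed
  next
    case False
    show ?thesis
    proof (cases j)
      case 0
      obtain i where i: "N = Suc i" using assms(1) by (cases N) auto
      have "?eq (l # word_pow wa N) [l]"
        using word_eq_context[OF N, of "[l]" "[]"] by (simp add: l)
      moreover have "?eq (l # word_pow wa N) (word_pow wa i)"
        using cancel[of i] False by (simp add: i l)
      ultimately have "?eq (l # w) (word_pow wa i)"
        using lj 0 word_eq.trans[OF lj word_eq.trans[OF word_eq.sym]] by simp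
      then show ?thesis using i by auto
    next
      case (Suc i)
      then have "?eq (l # w) (word_pow wa i)"
        using cancel[of i] False lj by (auto simp: l intro: word_eq.trans)
      with Suc j(1) show ?thesis by (intro exI[of _ i]) simp
    qed
  qed
qed

lemma Cyc_iso_integer_mod_group:
  assumes "N > 0"
  shows "Cyc N \<cong> integer_mod_group N"
proof -
  interpret Z: group "integer_mod_group N" by simp
  let ?R = "{(word_pow wa N, [])} :: (gen word \<times> gen word) set"
  let ?f = "\<lambda>_::gen. 1 mod int N"
  have f: "?f ` {GenA} \<subseteq> carrier (integer_mod_group N)"
    using assms by (simp add: carrier_integer_mod_group)
  have val: "Z.word_val ?f (word_pow wa j) = int j mod int N" for j
    by (induction j) (auto simp: mod_simps add.commute)
  have R: "Z.word_val ?f p = Z.word_val ?f q" if "(p, q) \<in> ?R" for p q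
    using that val[of N] by auto
  obtain h where h: "h \<in> hom (Cyc N) (integer_mod_group N)"
      "\<And>w. w \<in> words {GenA} \<Longrightarrow> h (word_class {GenA} ?R w) = Z.word_val ?f w"
    using Z.presented_group_hom[OF f R] unfolding Cyc_def by blast
  have car: "carrier (Cyc N) = (\<lambda>j. word_class {GenA} ?R (word_pow wa j)) ` {..<N}"
  proof (intro equalityI subsetI)
    fix x assume "x \<in> carrier (Cyc N)"
    then obtain w where w: "w \<in> words {GenA}" "x = word_class {GenA} ?R w"
      by (auto simp: Cyc_def carrier_presented_group)
    obtain j where "j < N" "word_eq {GenA} ?R w (word_pow wa j)"
      using Cyc_normal_form[OF assms w(1)] by blast
    with w show "x \<in> (\<lambda>j. word_class {GenA} ?R (word_pow wa j)) ` {..<N}"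
      using word_class_eq_iff[OF w(1), of ?R "word_pow wa j"] by auto
  next
    fix x assume "x \<in> (\<lambda>j. word_class {GenA} ?R (word_pow wa j)) ` {..<N}"
    then show "x \<in> carrier (Cyc N)"
      by (auto simp: Cyc_def carrier_presented_group)
  qed
  have hj: "h (word_class {GenA} ?R (word_pow wa j)) = int j" if "j < N" for j
    using that by (simp add: h(2) val)
  have "bij_betw h (carrier (Cyc N)) (carrier (integer_mod_group N))"
  proof (rule bij_betw_imageI)
    show "inj_on h (carrier (Cyc N))"
    proof (rule inj_onI)
      fix x y assume "x \<in> carrier (Cyc N)" "y \<in> carrier (Cyc N)" and eq: "h x = h y"
      then obtain i j where ij: "i < N" "x = word_class {GenA} ?R (word_pow wa i)"
          "j < N" "y = word_class {GenA} ?R (word_pow wa j)"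
        unfolding car by blast
      with eq have "i = j" using hj[of i] hj[of j] by simp
      with ij show "x = y" by simp
    qed
    have "h ` carrier (Cyc N) = int ` {..<N}"
      unfolding car image_image by (rule image_cong[OF HOL.refl]) (simp add: hj)
    also have "\<dots> = carrier (integer_mod_group N)"
      using assms image_int_atLeastLessThan[of 0 N]
      by (simp add: carrier_integer_mod_group lessThan_atLeast0)
    finally show "h ` carrier (Cyc N) = carrier (integer_mod_group N)" .
  qed
  with h(1) show ?thesis by (auto simp: is_iso_def iso_def)
qed

section \<open>Central products\<close>

text \<open>A factor comes with the central subgroup of order 2 along which it is to be amalgamated.\<close>

definition nonabelian_factor :: "'a monoid \<Rightarrow> 'a monoid \<times> 'a set" where
  "nonabelian_factor H = (H, derived H (carrier H))"

definition cyclic_factor :: "'a monoid \<Rightarrow> 'a monoid \<times> 'a set" where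
  "cyclic_factor H = (H, THE A. subgroup A H \<and> card A = 2)"

text \<open>The central product of the factors \<open>(H\<^sub>i, A\<^sub>i)\<close>, where all \<open>A\<^sub>i\<close> are identified with one group
  \<open>\<langle>c\<rangle>\<close> of order 2. It is the direct product modulo the families in \<open>\<Prod> A\<^sub>i\<close> whose product in \<open>\<langle>c\<rangle>\<close>
  is trivial, that is, those with an even number of nontrivial entries. There is only one
  isomorphism \<open>A\<^sub>i \<rightarrow> \<langle>c\<rangle>\<close>, so there is no choice in the identification.\<close>

definition central_product :: "('a monoid \<times> 'a set) list \<Rightarrow> (nat \<Rightarrow> 'a) set monoid" where
  "central_product Fs =
     product_group {..<length Fs} (\<lambda>i. fst (Fs ! i)) Mod
       {f \<in> (\<Pi>\<^sub>E i\<in>{..<length Fs}. snd (Fs ! i)).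
          even (card {i \<in> {..<length Fs}. f i \<noteq> \<one>\<^bsub>fst (Fs ! i)\<^esub>})}"

section \<open>Further group-theoretic notions\<close>

definition center :: "('a, 'b) monoid_scheme \<Rightarrow> 'a set" where
  "center G = {x \<in> carrier G. \<forall>y\<in>carrier G. x \<otimes>\<^bsub>G\<^esub> y = y \<otimes>\<^bsub>G\<^esub> x}"

definition elementary_abelian_2 :: "('a, 'b) monoid_scheme \<Rightarrow> bool" where
  "elementary_abelian_2 G \<longleftrightarrow>
     comm_group G \<and> (\<forall>x\<in>carrier G. x [^]\<^bsub>G\<^esub> (2::nat) = \<one>\<^bsub>G\<^esub>)"

definition internal_direct_product ::
  "('a, 'b) monoid_scheme \<Rightarrow> 'a set list \<Rightarrow> 'a set \<Rightarrow> bool" where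
  "internal_direct_product G Hs A \<longleftrightarrow>
     (\<forall>i<length Hs. subgroup (Hs ! i) G) \<and>
     (\<forall>i<length Hs. \<forall>j<length Hs. i \<noteq> j \<longrightarrow>
        (\<forall>x\<in>Hs ! i. \<forall>y\<in>Hs ! j. x \<otimes>\<^bsub>G\<^esub> y = y \<otimes>\<^bsub>G\<^esub> x)) \<and>
     A = generate G (\<Union>i<length Hs. Hs ! i) \<and>
     (\<forall>i<length Hs. Hs ! i \<inter> generate G (\<Union>j\<in>{..<length Hs} - {i}. Hs ! j) = {\<one>\<^bsub>G\<^esub>})"

definition Z2_power :: "nat \<Rightarrow> (nat \<Rightarrow> int) monoid" where
  "Z2_power s = product_group {..<s} (\<lambda>_. integer_mod_group 2)"

end

theory Submission
  imports Defs
begin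

text \<open>Modulo its center, \<open>G\<close> is a nondegenerate symplectic space over the field with two elements, the form
  being the commutator with values in \<open>\<langle>c\<rangle>\<close>. Because \<open>c\<close> is a square in \<open>\<langle>z\<^sub>1\<rangle>\<close>, squaring modulo squares of
  central elements is a linear functional on this space with values \<open>\<one>\<close> and \<open>z\<^sub>2\<close>. If it vanishes, every
  element of a symplectic basis lifts to an involution and each hyperbolic pair generates a copy of \<open>D\<^sub>8\<close>,
  which gives case (iii). Otherwise a symplectic basis can be chosen on which the functional is nonzero at
  exactly one vector; its hyperbolic pair generates a copy of \<open>M\<^sub>2(m + 1, 1, 1)\<close> and case (i) results.
  Cases (ii) and (iv) are not needed, since \<open>Q\<^sub>8\<close> and \<open>D\<^sub>8\<close> have the same central product with a cyclic
  group of order at least 4.\<close>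

section \<open>Central products from commuting homomorphisms\<close>

text \<open>Squares lie in \<open>N\<close>, where \<open>z 1\<close> occurs with even exponents
  only, so modulo squares of central elements just the parity of the \<open>z 2\<close>-exponent
  survives; hence two values. Additivity is the delicate point: (a g)^2 is a^2 g^2 up to a factor
  \<open>c\<close>, harmless only because \<open>c\<close> has a central square root, which exists
  as \<open>n\<close> is at least 1. A vector outside the kernel lifts to some \<open>a\<close> with
  square \<open>z 2\<close>. The powers of \<open>z 2\<close> then lie inside the subgroup generated
  by its hyperbolic pair, which is why no separate factor of order 2^m appears in case (i). The
  factors are given by presentations, so neither their orders nor their elements are known in
  advance. The universal property maps each into \<open>G\<close>, and a normal form good enough to
  describe the elements with central image yields injectivity. Multiplication then maps the product
  of all factors to \<open>G\<close>; the families it kills have entries over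
  \<open>{\<one>, c}\<close> with an even number of \<open>c\<close>, which is exactly what
  \<open>central_product\<close> divides out. To split off the rest of the center, one must also
  control which central elements of \<open>G\<close> the image contains.\<close>

definition centralizer :: "('a, 'b) monoid_scheme \<Rightarrow> 'a set \<Rightarrow> 'a set" where
  "centralizer G A = {x \<in> carrier G. \<forall>y\<in>A. x \<otimes>\<^bsub>G\<^esub> y = y \<otimes>\<^bsub>G\<^esub> x}"

text \<open>\<open>G\<close> is nonabelian, so the order of the factors is part of the definition,
  even though values at different indices commute in the applications.\<close>

primrec (in monoid) ordered_prod :: "(nat \<Rightarrow> 'a) \<Rightarrow> nat \<Rightarrow> 'a" where
  "ordered_prod u 0 = \<one>"
| "ordered_prod u (Suc n) = ordered_prod u n \<otimes> u n"

section \<open>Centralizers and ordered products\<close>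

context group
begin

lemma commute_mult:
  assumes "x \<in> carrier G" "y \<in> carrier G" "g \<in> carrier G"
    and "x \<otimes> g = g \<otimes> x" "y \<otimes> g = g \<otimes> y"
  shows "(x \<otimes> y) \<otimes> g = g \<otimes> (x \<otimes> y)"
proof -
  have "(x \<otimes> y) \<otimes> g = x \<otimes> (y \<otimes> g)" using assms(1-3) by (rule m_assoc)
  also have "\<dots> = (x \<otimes> g) \<otimes> y" unfolding assms(5) using assms(1-3) by (simp add: m_assoc)
  also have "\<dots> = g \<otimes> (x \<otimes> y)" unfolding assms(4) using assms(1-3) by (simp add: m_assoc)
  finally show ?thesis .
qed

lemma commute_inv:
  assumes "x \<in> carrier G" "g \<in> carrier G" "x \<otimes> g = g \<otimes> x"
  shows "inv x \<otimes> g = g \<otimes> inv x"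
proof -
  have "inv x \<otimes> g = inv x \<otimes> (g \<otimes> x) \<otimes> inv x" using assms(1,2) by (simp add: m_assoc)
  also have "\<dots> = g \<otimes> inv x" unfolding assms(3)[symmetric] using assms(1,2) by (simp flip: m_assoc)
  finally show ?thesis .
qed

text \<open>Commutation claims are turned into membership in a centralizer, so that powers, products
  and cancellation are handled by general subgroup facts.\<close>

lemma subgroup_centralizer:
  assumes "A \<subseteq> carrier G"
  shows "subgroup (centralizer G A) G"
proof (rule subgroupI)
  show "centralizer G A \<noteq> {}"
    using assms by (auto simp: centralizer_def intro!: exI[of _ \<one>])
qed (use assms in \<open>auto simp: centralizer_def commute_mult commute_inv subset_iff\<close>)

lemma center_eq_centralizer: "center G = centralizer G (carrier G)"
  by (simp add: center_def centralizer_def)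

lemma generate_singleton: "a \<in> carrier G \<Longrightarrow> generate G {a} = range (\<lambda>k::int. a [^] k)"
  by (auto simp: generate_pow)

lemma subgroup_mult_left_iff:
  assumes H: "subgroup H G" and x: "x \<in> H" and y: "y \<in> carrier G"
  shows "x \<otimes> y \<in> H \<longleftrightarrow> y \<in> H"
proof
  assume "x \<otimes> y \<in> H"
  then have "inv x \<otimes> (x \<otimes> y) \<in> H"
    using H x by (blast intro: subgroup.m_closed subgroup.m_inv_closed)
  then show "y \<in> H" using y subgroup.mem_carrier[OF H x] by (simp flip: m_assoc)
qed (rule subgroup.m_closed[OF H x])

lemma subgroup_mult_right_iff:
  assumes H: "subgroup H G" and x: "x \<in> H" and y: "y \<in> carrier G"
  shows "y \<otimes> x \<in> H \<longleftrightarrow> y \<in> H"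
proof
  assume "y \<otimes> x \<in> H"
  then have "(y \<otimes> x) \<otimes> inv x \<in> H"
    using H x by (blast intro: subgroup.m_closed subgroup.m_inv_closed)
  then show "y \<in> H" using y subgroup.mem_carrier[OF H x] by (simp add: m_assoc)
qed (rule subgroup.m_closed[OF H _ x])

lemma subgroup_nat_pow: "subgroup H G \<Longrightarrow> a \<in> H \<Longrightarrow> a [^] (k::nat) \<in> H"
  by (induction k) (auto simp: subgroup.one_closed subgroup.m_closed)

lemma subgroup_int_pow:
  assumes "subgroup H G" "a \<in> H"
  shows "a [^] (k::int) \<in> H"
proof -
  have "a [^] k \<in> generate G {a}"
    using generate_pow[OF subgroup.mem_carrier[OF assms]] by blast
  then show ?thesis using generate_subgroup_incl[of "{a}" H] assms by blast
qed

lemma commute_int_pow: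
  assumes "x \<in> carrier G" "g \<in> carrier G" "x \<otimes> g = g \<otimes> x"
  shows "x [^] (i::int) \<otimes> g = g \<otimes> x [^] i"
proof -
  have "x [^] i \<in> centralizer G {g}"
    by (rule subgroup_int_pow[OF subgroup_centralizer]) (simp_all add: centralizer_def assms)
  then show ?thesis by (simp add: centralizer_def)
qed

lemma square_mult_commute:
  assumes "x \<in> carrier G" "y \<in> carrier G" "x \<otimes> y = y \<otimes> x"
  shows "(x \<otimes> y) \<otimes> (x \<otimes> y) = (x \<otimes> x) \<otimes> (y \<otimes> y)"
proof -
  have "(x \<otimes> y) \<otimes> (x \<otimes> y) = x \<otimes> (y \<otimes> x) \<otimes> y" using assms(1,2) by (simp add: m_assoc)
  also have "\<dots> = (x \<otimes> x) \<otimes> (y \<otimes> y)"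
    unfolding assms(3)[symmetric] using assms(1,2) by (simp add: m_assoc)
  finally show ?thesis .
qed

lemma ordered_prod_in_subgroup:
  assumes "subgroup H G" "\<And>i. i < n \<Longrightarrow> u i \<in> H"
  shows "ordered_prod u n \<in> H"
  using assms(2) by (induction n) (simp_all add: assms(1) subgroup.one_closed subgroup.m_closed)

lemma ordered_prod_closed:
  "(\<And>i. i < n \<Longrightarrow> u i \<in> carrier G) \<Longrightarrow> ordered_prod u n \<in> carrier G"
  by (rule ordered_prod_in_subgroup[OF subgroup_self])

lemma ordered_prod_cong:
  "(\<And>i. i < n \<Longrightarrow> u i = v i) \<Longrightarrow> ordered_prod u n = ordered_prod v n"
  by (induction n) simp_all

lemma ordered_prod_commute:
  assumes "g \<in> carrier G" "\<And>i. i < n \<Longrightarrow> u i \<in> carrier G"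
    and "\<And>i. i < n \<Longrightarrow> u i \<otimes> g = g \<otimes> u i"
  shows "ordered_prod u n \<otimes> g = g \<otimes> ordered_prod u n"
proof -
  have "ordered_prod u n \<in> centralizer G {g}"
    by (rule ordered_prod_in_subgroup[OF subgroup_centralizer])
       (simp_all add: centralizer_def assms(1,2), rule assms(3))
  then show ?thesis by (simp add: centralizer_def)
qed

text \<open>Regrouping only moves a \<open>u j\<close> past some \<open>v i\<close> with a different
  index; inside one index nothing has to commute, so nonabelian factors are allowed.\<close>

lemma ordered_prod_mult:
  assumes "\<And>i. i < n \<Longrightarrow> u i \<in> carrier G" "\<And>i. i < n \<Longrightarrow> v i \<in> carrier G"
    and "\<And>i j. i < n \<Longrightarrow> j < n \<Longrightarrow> i \<noteq> j \<Longrightarrow> v i \<otimes> u j = u j \<otimes> v i"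
  shows "ordered_prod (\<lambda>i. u i \<otimes> v i) n = ordered_prod u n \<otimes> ordered_prod v n"
  using assms
proof (induction n)
  case (Suc n)
  let ?U = "ordered_prod u n" and ?V = "ordered_prod v n"
  have car: "?U \<in> carrier G" "?V \<in> carrier G" "u n \<in> carrier G" "v n \<in> carrier G"
    using Suc.prems(1,2) by (auto intro!: ordered_prod_closed)
  have comm: "?V \<otimes> u n = u n \<otimes> ?V"
    by (rule ordered_prod_commute) (use Suc.prems(2) car in simp_all, rule Suc.prems(3), simp_all)
  have "ordered_prod (\<lambda>i. u i \<otimes> v i) n = ?U \<otimes> ?V"
    by (rule Suc.IH) (simp_all add: Suc.prems(1,2), rule Suc.prems(3), simp_all)
  then have "ordered_prod (\<lambda>i. u i \<otimes> v i) (Suc n) = ?U \<otimes> ?V \<otimes> (u n \<otimes> v n)"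
    by simp
  also have "\<dots> = ?U \<otimes> (?V \<otimes> u n) \<otimes> v n"
    using car by (simp add: m_assoc)
  also have "\<dots> = ?U \<otimes> u n \<otimes> (?V \<otimes> v n)"
    unfolding comm using car by (simp add: m_assoc)
  finally show ?case by simp
qed simp

lemma ordered_prod_single:
  assumes "i < n" "g \<in> carrier G"
  shows "ordered_prod (\<lambda>j. if j = i then g else \<one>) n = g"
proof -
  have one: "ordered_prod (\<lambda>j. if j = i then g else \<one>) k = \<one>" if "k \<le> i" for k
    using that by (induction k) auto
  show ?thesis
    using assms(1)
  proof (induction n)
    case (Suc n)
    then show ?case using one[of n] assms(2) by (cases "n = i") auto
  qed simp
qed

text \<open>The other factors can be cancelled from both sides because they lie in \<open>H\<close>.
  Applied to a trivial product, this confines one factor to any subgroup containing the rest;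
  applied with a centralizer, it transfers commutation from a product to a single factor.\<close>

lemma ordered_prod_factor_in_subgroup:
  assumes H: "subgroup H G" and "\<And>j. j < n \<Longrightarrow> u j \<in> carrier G"
    and "\<And>j. j < n \<Longrightarrow> j \<noteq> i \<Longrightarrow> u j \<in> H" and "ordered_prod u n \<in> H" and "i < n"
  shows "u i \<in> H"
  using assms(2-)
proof (induction n)
  case (Suc n)
  have car: "ordered_prod u n \<in> carrier G" "u n \<in> carrier G"
    using Suc.prems by (auto intro!: ordered_prod_closed)
  show ?case
  proof (cases "i = n")
    case True
    then have "ordered_prod u n \<in> H"
      using Suc.prems by (intro ordered_prod_in_subgroup[OF H]) auto
    with Suc.prems(3) car show ?thesis by (simp add: True subgroup_mult_left_iff[OF H])
  next
    case False
    then have "u n \<in> H" using Suc.prems by auto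
    then have "ordered_prod u n \<in> H" using Suc.prems(3) car subgroup_mult_right_iff[OF H] by simp
    with False Suc.prems Suc.IH show ?thesis by auto
  qed
qed simp

lemma subgroup_involution:
  assumes "c \<in> carrier G" "c \<otimes> c = \<one>"
  shows "subgroup {\<one>, c} G"
proof -
  have "inv c = c" using assms by (simp add: inv_equality)
  then show ?thesis using assms by (intro subgroupI) auto
qed

text \<open>This is the source of the parity condition in \<open>central_product\<close>: on entries
  from \<open>{\<one>, c}\<close>, multiplication only sees whether \<open>c\<close> occurs an even
  number of times.\<close>

lemma ordered_prod_involution:
  assumes c: "c \<in> carrier G" "c \<otimes> c = \<one>" and u: "\<And>i. i < n \<Longrightarrow> u i \<in> {\<one>, c}"
  shows "ordered_prod u n = (if even (card {i. i < n \<and> u i \<noteq> \<one>}) then \<one> else c)"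
  using u
proof (induction n)
  case (Suc n)
  have IH: "ordered_prod u n = (if even (card {i. i < n \<and> u i \<noteq> \<one>}) then \<one> else c)"
    by (rule Suc.IH) (rule Suc.prems, simp)
  show ?case
  proof (cases "u n = \<one>")
    case True
    then have "{i. i < Suc n \<and> u i \<noteq> \<one>} = {i. i < n \<and> u i \<noteq> \<one>}"
      by (auto simp: less_Suc_eq)
    then show ?thesis using True IH c by simp
  next
    case False
    then have "{i. i < Suc n \<and> u i \<noteq> \<one>} = insert n {i. i < n \<and> u i \<noteq> \<one>}"
      by (auto simp: less_Suc_eq)
    moreover have "u n = c" using Suc.prems[of n] False by blast
    ultimately show ?thesis using IH c by simp
  qed
qed simp

end

section \<open>The multiplication map on a product of commuting embedded groups\<close>

locale commuting_homs = group G for G (structure) +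
  fixes n :: nat and F :: "nat \<Rightarrow> 'f monoid" and h :: "nat \<Rightarrow> 'f \<Rightarrow> 'a"
  assumes group_F: "i < n \<Longrightarrow> group (F i)"
    and hom_h: "i < n \<Longrightarrow> h i \<in> hom (F i) G"
    and inj_h: "i < n \<Longrightarrow> inj_on (h i) (carrier (F i))"
    and commute_h: "\<lbrakk>i < n; j < n; i \<noteq> j; x \<in> carrier (F i); y \<in> carrier (F j)\<rbrakk>
      \<Longrightarrow> h i x \<otimes> h j y = h j y \<otimes> h i x"
begin

text \<open>Each \<open>h i\<close> is injective, but the images may overlap. The kernel of this map
  records the overlap, that is, the amalgamation.\<close>

definition prod_map :: "(nat \<Rightarrow> 'f) \<Rightarrow> 'a" where
  "prod_map f = ordered_prod (\<lambda>i. h i (f i)) n"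

abbreviation "PF \<equiv> product_group {..<n} F"

lemma group_hom_h: "i < n \<Longrightarrow> group_hom (F i) G (h i)"
  by (simp add: group_hom_def group_hom_axioms_def group_F hom_h is_group)

lemma h_closed: "i < n \<Longrightarrow> x \<in> carrier (F i) \<Longrightarrow> h i x \<in> carrier G"
  using hom_h by (auto simp: hom_def)

lemma h_eq_one_iff: "i < n \<Longrightarrow> x \<in> carrier (F i) \<Longrightarrow> h i x = \<one> \<longleftrightarrow> x = \<one>\<^bsub>F i\<^esub>"
proof -
  assume i: "i < n" and x: "x \<in> carrier (F i)"
  interpret group_hom "F i" G "h i" using i by (rule group_hom_h)
  show ?thesis
    using inj_onD[OF inj_h[OF i], of x "\<one>\<^bsub>F i\<^esub>"] x by fastforce
qed

lemma group_hom_prod_map: "group_hom PF G prod_map"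
proof -
  have "prod_map \<in> hom PF G"
  proof (rule homI)
    fix f assume f: "f \<in> carrier PF"
    then show "prod_map f \<in> carrier G"
      unfolding prod_map_def by (intro ordered_prod_closed) (auto simp: PiE_iff h_closed)
    fix g assume g: "g \<in> carrier PF"
    have fg: "f i \<in> carrier (F i)" "g i \<in> carrier (F i)" if "i < n" for i
      using f g that by (simp_all add: PiE_iff)
    have "prod_map (f \<otimes>\<^bsub>PF\<^esub> g) = ordered_prod (\<lambda>i. h i (f i) \<otimes> h i (g i)) n"
      unfolding prod_map_def
      by (rule ordered_prod_cong) (simp add: fg hom_mult[OF hom_h])
    also have "\<dots> = prod_map f \<otimes> prod_map g"
      unfolding prod_map_def
      by (rule ordered_prod_mult) (simp_all add: h_closed fg, rule commute_h, simp_all add: fg)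
    finally show "prod_map (f \<otimes>\<^bsub>PF\<^esub> g) = prod_map f \<otimes> prod_map g" .
  qed
  moreover have "group PF" by (rule product_group) (simp add: group_F)
  ultimately show ?thesis
    by (simp add: group_hom_def group_hom_axioms_def is_group)
qed

lemma subgroup_prod_image: "subgroup (prod_map ` carrier PF) G"
  by (rule group_hom.img_is_subgroup[OF group_hom_prod_map])

lemma factor_in_prod_image:
  assumes "i < n" "x \<in> carrier (F i)"
  shows "h i x \<in> prod_map ` carrier PF"
proof (rule image_eqI)
  let ?f = "\<lambda>j\<in>{..<n}. if j = i then x else \<one>\<^bsub>F j\<^esub>"
  show "?f \<in> carrier PF"
    using assms by (auto simp: group.is_monoid group_F monoid.one_closed)
  have "prod_map ?f = ordered_prod (\<lambda>j. if j = i then h i x else \<one>) n"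
    unfolding prod_map_def
    by (rule ordered_prod_cong) (auto simp: group_hom.hom_one[OF group_hom_h])
  then show "h i x = prod_map ?f"
    using assms by (simp add: ordered_prod_single h_closed)
qed

lemma prod_map_in_subgroup:
  assumes "subgroup H G" "f \<in> carrier PF" "\<And>i x. i < n \<Longrightarrow> x \<in> carrier (F i) \<Longrightarrow> h i x \<in> H"
  shows "prod_map f \<in> H"
  unfolding prod_map_def using assms(2,3) by (intro ordered_prod_in_subgroup[OF assms(1)]) auto

text \<open>The other factors commute with \<open>h i x\<close> anyway, so commutation of the
  product passes to its \<open>i\<close>-th factor. Hence the components of a central element are
  central in their own factors.\<close>

lemma factor_central:
  assumes f: "f \<in> carrier PF" and "i < n" "x \<in> carrier (F i)"
    and p: "prod_map f \<otimes> h i x = h i x \<otimes> prod_map f"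
  shows "h i (f i) \<otimes> h i x = h i x \<otimes> h i (f i)"
proof -
  have x: "h i x \<in> carrier G" using assms by (simp add: h_closed)
  have fj: "h j (f j) \<in> carrier G" if "j < n" for j
    using that f by (simp add: h_closed PiE_iff)
  have "h i (f i) \<in> centralizer G {h i x}"
  proof (rule ordered_prod_factor_in_subgroup[where u = "\<lambda>i. h i (f i)" and n = n])
    show "subgroup (centralizer G {h i x}) G" using x by (simp add: subgroup_centralizer)
    show "h j (f j) \<in> centralizer G {h i x}" if "j < n" "j \<noteq> i" for j
      using that assms fj by (auto simp: centralizer_def intro: commute_h)
    show "ordered_prod (\<lambda>i. h i (f i)) n \<in> centralizer G {h i x}"
      using p fj unfolding prod_map_def by (auto simp: centralizer_def intro: ordered_prod_closed)
  qed (use fj assms in auto)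
  then show ?thesis by (simp add: centralizer_def)
qed

text \<open>The assumption makes the kernel trivial, so nothing is amalgamated and the image is a
  direct product.\<close>

lemma product_iso_image:
  assumes "\<And>f i. f \<in> carrier PF \<Longrightarrow> prod_map f = \<one> \<Longrightarrow> i < n \<Longrightarrow> h i (f i) = \<one>"
  shows "G\<lparr>carrier := prod_map ` carrier PF\<rparr> \<cong> PF"
proof -
  interpret pm: group_hom PF G prod_map by (rule group_hom_prod_map)
  have "f = \<one>\<^bsub>PF\<^esub>" if f: "f \<in> carrier PF" "prod_map f = \<one>" for f
  proof -
    have "f i = \<one>\<^bsub>F i\<^esub>" if "i < n" for i
      using assms[OF f that] f(1) that by (simp add: h_eq_one_iff PiE_iff)
    then show ?thesis using f(1) by (intro ext) (auto simp: PiE_iff extensional_def restrict_def)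
  qed
  then have "inj_on prod_map (carrier PF)"
    using pm.inj_on_one_iff by blast
  then have "prod_map \<in> iso PF (G\<lparr>carrier := prod_map ` carrier PF\<rparr>)"
    using pm.homh by (auto simp: iso_def hom_def bij_betw_def)
  then show ?thesis by (rule pm.G.iso_sym[OF is_isoI])
qed

text \<open>First isomorphism theorem for \<open>prod_map\<close>. By \<open>indep\<close> the
  kernel has entries mapped into \<open>{\<one>, c}\<close> only, and on such families
  \<open>ordered_prod_involution\<close> turns triviality of the product into the parity condition
  of \<open>central_product\<close>.\<close>

lemma central_product_iso_image:
  assumes c: "c \<in> carrier G" "c \<otimes> c = \<one>"
"c \<noteq> \<one>"
    and Fs: "length Fs = n" "\<And>i. i < n \<Longrightarrow> Fs ! i = (F i, {x \<in> carrier (F i). h i x \<in> {\<one>, c}})"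
    and indep: "\<And>f i. f \<in> carrier PF \<Longrightarrow> prod_map f = \<one> \<Longrightarrow> i < n \<Longrightarrow> h i (f i) \<in> {\<one>, c}"
  shows "G\<lparr>carrier := prod_map ` carrier PF\<rparr> \<cong> central_product Fs"
proof -
  let ?H = "G\<lparr>carrier := prod_map ` carrier PF\<rparr>"
  interpret pm: group_hom PF G prod_map by (rule group_hom_prod_map)
  have "group ?H"
    by (rule subgroup.subgroup_is_group[OF subgroup_prod_image is_group])
  moreover have "prod_map \<in> hom PF ?H"
    using pm.homh by (auto simp: hom_def)
  ultimately interpret pH: group_hom PF ?H prod_map
    by (simp add: group_hom_def group_hom_axioms_def)
  let ?K = "{f \<in> (\<Pi>\<^sub>E i\<in>{..<length Fs}. snd (Fs ! i)).
      even (card {i \<in> {..<length Fs}. f i \<noteq> \<one>\<^bsub>fst (Fs ! i)\<^esub>})}"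
  have Pi: "(\<Pi>\<^sub>E i\<in>{..<length Fs}. snd (Fs ! i))
      = {f \<in> carrier PF. \<forall>i<n. h i (f i) \<in> {\<one>, c}}"
    by (rule Set.set_eqI) (auto simp: PiE_iff Fs)
  have card: "{i \<in> {..<length Fs}. f i \<noteq> \<one>\<^bsub>fst (Fs ! i)\<^esub>} = {i. i < n \<and> h i (f i) \<noteq> \<one>}"
    if "f \<in> carrier PF" for f
  proof (rule Collect_cong)
    fix i
    have "f i \<in> carrier (F i)" if "i < n" using \<open>f \<in> carrier PF\<close> that by (simp add: PiE_iff)
    then show "(i \<in> {..<length Fs} \<and> f i \<noteq> \<one>\<^bsub>fst (Fs ! i)\<^esub>) \<longleftrightarrow> (i < n \<and> h i (f i) \<noteq> \<one>)"
      using Fs by (auto simp: h_eq_one_iff)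
  qed
  have iff: "prod_map f = \<one> \<longleftrightarrow> even (card {i. i < n \<and> h i (f i) \<noteq> \<one>})"
    if "\<forall>i<n. h i (f i) \<in> {\<one>, c}" for f
  proof -
    have "prod_map f = (if even (card {i. i < n \<and> h i (f i) \<noteq> \<one>}) then \<one> else c)"
      unfolding prod_map_def using that by (intro ordered_prod_involution[OF c(1,2)]) blast
    then show ?thesis using c(3) by presburger
  qed
  have K: "?K = kernel PF ?H prod_map"
  proof (rule Set.set_eqI)
    fix f
    have K_iff: "f \<in> ?K \<longleftrightarrow> (f \<in> carrier PF \<and> (\<forall>i<n. h i (f i) \<in> {\<one>, c})) \<and>
        even (card {i \<in> {..<length Fs}. f i \<noteq> \<one>\<^bsub>fst (Fs ! i)\<^esub>})"
      unfolding Pi mem_Collect_eq by (rule HOL.refl)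
    show "f \<in> ?K \<longleftrightarrow> f \<in> kernel PF ?H prod_map"
    proof (cases "f \<in> carrier PF")
      case True
      have "f \<in> ?K \<longleftrightarrow> (\<forall>i<n. h i (f i) \<in> {\<one>, c}) \<and> prod_map f = \<one>"
        unfolding K_iff card[OF True] using iff[of f] True by blast
      also have "\<dots> \<longleftrightarrow> prod_map f = \<one>"
        using indep[OF True] by blast
      finally show ?thesis using True by (simp add: kernel_def)
    next
      case False
      then show ?thesis unfolding K_iff kernel_def by blast
    qed
  qed
  have "product_group {..<length Fs} (\<lambda>i. fst (Fs ! i)) = PF"
  proof -
    have F: "fst (Fs ! i) = F i" if "i < n" for i using that Fs by simp
    have "(\<Pi>\<^sub>E i\<in>{..<n}. carrier (fst (Fs ! i))) = (\<Pi>\<^sub>E i\<in>{..<n}. carrier (F i))"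
      by (rule PiE_cong) (simp add: F)
    then show ?thesis
      unfolding product_group_def Fs(1)
      by (intro monoid.equality) (simp_all add: F restrict_def fun_eq_iff)
  qed
  then have "central_product Fs = PF Mod kernel PF ?H prod_map"
    unfolding central_product_def K by simp
  then show ?thesis
    using pH.FactGroup_iso group.iso_sym[OF normal.factorgroup_is_group[OF pH.normal_kernel]] by simp
qed

end

section \<open>Products of two commuting subgroups\<close>

context group
begin

lemma subgroup_commuting_product:
  assumes A: "subgroup A G" and B: "subgroup B G"
    and comm: "\<And>a b. a \<in> A \<Longrightarrow> b \<in> B \<Longrightarrow> a \<otimes> b = b \<otimes> a"
  shows "subgroup (A <#> B) G"
proof (rule subgroupI)
  note AB = subgroup.mem_carrier[OF A] subgroup.mem_carrier[OF B]
  show "A <#> B \<subseteq> carrier G" using AB by (auto simp: set_mult_def)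
  show "A <#> B \<noteq> {}"
    using subgroup.one_closed[OF A] subgroup.one_closed[OF B] by (auto simp: set_mult_def)
  show "inv x \<in> A <#> B" if "x \<in> A <#> B" for x
  proof -
    obtain a b where x: "x = a \<otimes> b" "a \<in> A" "b \<in> B"
      using \<open>x \<in> A <#> B\<close> unfolding set_mult_def by blast
    have "inv x = inv a \<otimes> inv b"
      using x comm[OF x(2,3)] AB by (simp add: inv_mult_group)
    then show ?thesis
      using x subgroup.m_inv_closed[OF A] subgroup.m_inv_closed[OF B] by (auto simp: set_mult_def)
  qed
  show "x \<otimes> y \<in> A <#> B" if xy: "x \<in> A <#> B" "y \<in> A <#> B" for x y
  proof -
    obtain a b a' b' where x: "x = a \<otimes> b" "a \<in> A" "b \<in> B" "y = a' \<otimes> b'" "a' \<in> A" "b' \<in> B"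
      using xy unfolding set_mult_def by blast
    have "x \<otimes> y = a \<otimes> (b \<otimes> a') \<otimes> b'"
      using x AB by (simp add: m_assoc)
    also have "\<dots> = (a \<otimes> a') \<otimes> (b \<otimes> b')"
      unfolding comm[OF x(5,3), symmetric] using x AB by (simp add: m_assoc)
    finally show ?thesis
      using x subgroup.m_closed[OF A x(2,5)] subgroup.m_closed[OF B x(3,6)]
      unfolding set_mult_def by blast
  qed
qed

lemma commuting_product_iso_DirProd:
  assumes A: "subgroup A G" and B: "subgroup B G"
    and comm: "\<And>a b. a \<in> A \<Longrightarrow> b \<in> B \<Longrightarrow> a \<otimes> b = b \<otimes> a" and int: "A \<inter> B = {\<one>}"
  shows "G\<lparr>carrier := A <#> B\<rparr> \<cong> G\<lparr>carrier := A\<rparr> \<times>\<times> G\<lparr>carrier := B\<rparr>"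
proof -
  let ?f = "\<lambda>(a, b). a \<otimes> b"
  note AB = subgroup.mem_carrier[OF A] subgroup.mem_carrier[OF B]
  have "?f \<in> hom (G\<lparr>carrier := A\<rparr> \<times>\<times> G\<lparr>carrier := B\<rparr>) (G\<lparr>carrier := A <#> B\<rparr>)"
  proof (rule homI)
    fix x y assume "x \<in> carrier (G\<lparr>carrier := A\<rparr> \<times>\<times> G\<lparr>carrier := B\<rparr>)"
      "y \<in> carrier (G\<lparr>carrier := A\<rparr> \<times>\<times> G\<lparr>carrier := B\<rparr>)"
    then obtain a b a' b' where x: "x = (a, b)" "a \<in> A" "b \<in> B" "y = (a', b')" "a' \<in> A" "b' \<in> B"
      by auto
    have "(a \<otimes> a') \<otimes> (b \<otimes> b') = a \<otimes> (a' \<otimes> b) \<otimes> b'"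
      using x AB by (simp add: m_assoc)
    also have "\<dots> = (a \<otimes> b) \<otimes> (a' \<otimes> b')"
      unfolding comm[OF x(5,3)] using x AB by (simp add: m_assoc)
    finally show "?f (x \<otimes>\<^bsub>G\<lparr>carrier := A\<rparr> \<times>\<times> G\<lparr>carrier := B\<rparr>\<^esub> y) = ?f x \<otimes>\<^bsub>G\<lparr>carrier := A <#> B\<rparr>\<^esub> ?f y"
      using x by simp
  qed (auto simp: set_mult_def)
  moreover have "inj_on ?f (A \<times> B)"
  proof (rule inj_onI, clarify)
    fix a b a' b' assume x: "a \<in> A" "b \<in> B" "a' \<in> A" "b' \<in> B" "a \<otimes> b = a' \<otimes> b'"
    have "inv a' \<otimes> a = inv a' \<otimes> (a \<otimes> b) \<otimes> inv b"
      using x(1-4) AB by (simp add: m_assoc)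
    also have "\<dots> = b' \<otimes> inv b"
      unfolding x(5) using x(1-4) AB by (simp flip: m_assoc)
    finally have eq: "inv a' \<otimes> a = b' \<otimes> inv b" .
    moreover have "inv a' \<otimes> a \<in> A" "b' \<otimes> inv b \<in> B"
      using x(1-4) A B by (blast intro: subgroup.m_closed subgroup.m_inv_closed)+
    ultimately have one: "inv a' \<otimes> a = \<one>" "b' \<otimes> inv b = \<one>" using int by auto
    then show "a = a' \<and> b = b'"
      using x(1-4) AB by (simp add: inv_solve_left' inv_solve_right')
  qed
  moreover have "?f ` (A \<times> B) = A <#> B" by (auto simp: set_mult_def)
  ultimately have "G\<lparr>carrier := A\<rparr> \<times>\<times> G\<lparr>carrier := B\<rparr> \<cong> G\<lparr>carrier := A <#> B\<rparr>"
    unfolding is_iso_def iso_def bij_betw_def by auto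
  then show ?thesis
    by (rule group.iso_sym[OF DirProd_group, rotated 2])
      (simp_all add: subgroup.subgroup_is_group[OF A is_group] subgroup.subgroup_is_group[OF B is_group])
qed

section \<open>Homomorphisms out of presented groups\<close>

lemma word_val_word_pow:
  "f s \<in> carrier G \<Longrightarrow> word_val f (word_pow [(s, True)] k) = f s [^] k"
proof (induction k)
  case (Suc k)
  then show ?case using nat_pow_Suc2[of "f s" k] by simp
qed simp

text \<open>Beyond the homomorphism this exports what a normal form proof needs: the generators
  \<open>g s\<close>, the relations they satisfy, and induction over left multiplication by
  generators. Since generators have finite order, their inverses are positive powers, so the
  induction step deals with positive letters only.\<close>

lemma presented_group_univ:
  assumes f: "f ` S \<subseteq> carrier G"
    and R: "\<forall>(p, q)\<in>R. word_val f p = word_val f q" and RS: "R \<subseteq> words S \<times> words S"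
    and P: "P = presented_group S R"
  shows "\<exists>h g. h \<in> hom P G \<and> g ` S \<subseteq> carrier P \<and> (\<forall>s\<in>S. h (g s) = f s) \<and>
    (\<forall>(p, q)\<in>R. monoid.word_val P g p = monoid.word_val P g q) \<and>
    (\<forall>Q. Q \<one>\<^bsub>P\<^esub> \<longrightarrow> (\<forall>s\<in>S. \<forall>x\<in>carrier P. Q x \<longrightarrow> Q (g s \<otimes>\<^bsub>P\<^esub> x)) \<longrightarrow>
       (\<forall>s\<in>S. \<exists>k>0. g s [^]\<^bsub>P\<^esub> (k::nat) = \<one>\<^bsub>P\<^esub>) \<longrightarrow> (\<forall>x\<in>carrier P. Q x))"
proof -
  interpret P: group P by (simp add: P)
  obtain h where h: "h \<in> hom P G" "\<And>w. w \<in> words S \<Longrightarrow> h (word_class S R w) = word_val f w"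
    using presented_group_hom[OF f, of R] R unfolding P by blast
  define g where "g s = word_class S R [(s, True)]" for s
  have g: "g ` S \<subseteq> carrier P"
    by (auto simp: g_def P carrier_presented_group)
  have mult: "word_class S R (u @ v) = word_class S R u \<otimes>\<^bsub>P\<^esub> word_class S R v"
    if "u \<in> words S" "v \<in> words S" for u v
    using mult_presented_group[OF that] by (simp add: P)
  have False_inv: "word_class S R [(s, False)] = inv\<^bsub>P\<^esub> (g s)" if s: "s \<in> S" for s
  proof -
    have "word_class S R [(s, False)] \<otimes>\<^bsub>P\<^esub> g s = word_class S R ([(s, False)] @ [(s, True)])"
      unfolding g_def using s by (intro mult[symmetric]) auto
    also have "\<dots> = word_class S R []"
      using word_eq.cancel[of "[]" S "[]" s R False] s by (subst word_class_eq_iff) auto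
    finally have "word_class S R [(s, False)] \<otimes>\<^bsub>P\<^esub> g s = \<one>\<^bsub>P\<^esub>"
      by (simp add: P one_presented_group)
    moreover have "word_class S R [(s, False)] \<in> carrier P"
      using s by (auto simp: P carrier_presented_group)
    ultimately show ?thesis using g s P.inv_equality by auto
  qed
  have class_val: "word_class S R w = P.word_val g w" if "w \<in> words S" for w
    using that
  proof (induction w)
    case Nil
    have "word_class S R [] = \<one>\<^bsub>P\<^esub>" by (simp add: P one_presented_group)
    then show ?case by simp
  next
    case (Cons a w)
    obtain s e where a: "a = (s, e)" by force
    have s: "s \<in> S" "w \<in> words S" using Cons.prems by (auto simp: a)
    have "word_class S R (a # w) = word_class S R [a] \<otimes>\<^bsub>P\<^esub> word_class S R w"
      using mult[of "[a]" w] s by (simp add: a)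
    moreover have "word_class S R [a] = (if e then g s else inv\<^bsub>P\<^esub> (g s))"
      using False_inv[OF s(1)] by (simp add: a g_def)
    ultimately show ?case using Cons.IH[OF s(2)] by (simp add: a)
  qed
  have hg: "h (g s) = f s" if "s \<in> S" for s
    using h(2)[of "[(s, True)]"] that f by (auto simp: g_def)
  have rel: "P.word_val g p = P.word_val g q" if "(p, q) \<in> R" for p q
  proof -
    have pq: "p \<in> words S" "q \<in> words S" using RS that by auto
    have "word_eq S R p q"
      using word_eq.relation[of "[]" S "[]" p q R] pq that by simp
    then have "word_class S R p = word_class S R q"
      using word_class_eq_iff pq by blast
    then show ?thesis using class_val pq by simp
  qed
  have ind: "Q x" if x: "x \<in> carrier P" and one: "Q \<one>\<^bsub>P\<^esub>"
      and step: "\<forall>s\<in>S. \<forall>x\<in>carrier P. Q x \<longrightarrow> Q (g s \<otimes>\<^bsub>P\<^esub> x)"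
      and tor: "\<forall>s\<in>S. \<exists>k>0. g s [^]\<^bsub>P\<^esub> (k::nat) = \<one>\<^bsub>P\<^esub>" for Q x
  proof -
    have pow: "Q (g s [^]\<^bsub>P\<^esub> (k::nat) \<otimes>\<^bsub>P\<^esub> y)" if "s \<in> S" "y \<in> carrier P" "Q y" for s k y
    proof (induction k)
      case (Suc k)
      have gs: "g s \<in> carrier P" using g that(1) by auto
      then have "g s [^]\<^bsub>P\<^esub> Suc k \<otimes>\<^bsub>P\<^esub> y = g s \<otimes>\<^bsub>P\<^esub> (g s [^]\<^bsub>P\<^esub> k \<otimes>\<^bsub>P\<^esub> y)"
        unfolding P.nat_pow_Suc2[OF gs] using that(2) by (intro P.m_assoc) auto
      then show ?case using step[rule_format, OF that(1) _ Suc] gs \<open>y \<in> carrier P\<close> by simp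
    qed (use that in simp)
    have inv: "Q (inv\<^bsub>P\<^esub> (g s) \<otimes>\<^bsub>P\<^esub> y)" if s: "s \<in> S" and "y \<in> carrier P" "Q y" for s y
    proof -
      have gs: "g s \<in> carrier P" using g that(1) by auto
      obtain k :: nat where k: "k > 0" "g s [^]\<^bsub>P\<^esub> k = \<one>\<^bsub>P\<^esub>" using tor s by blast
      then obtain l where l: "k = Suc l" by (cases k) auto
      have "inv\<^bsub>P\<^esub> (g s) = g s [^]\<^bsub>P\<^esub> l"
        using k(2) gs unfolding l by (intro P.inv_equality) simp_all
      then show ?thesis using pow[OF that, of l] by simp
    qed
    have "P.word_val g w \<in> carrier P \<and> Q (P.word_val g w)" if "w \<in> words S" for w
      using that
    proof (induction w)
      case (Cons a w)
      obtain s e where a: "a = (s, e)" by force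
      have s: "s \<in> S" "w \<in> words S" "g s \<in> carrier P" using Cons.prems g by (auto simp: a)
      then show ?case using Cons.IH[OF s(2)] step[rule_format, OF s(1)] inv[OF s(1)] by (simp add: a)
    qed (simp add: one)
    then show "Q x"
      using x class_val unfolding P carrier_presented_group by (metis imageE)
  qed
  have "\<forall>(p, q)\<in>R. P.word_val g p = P.word_val g q" using rel by blast
  moreover have "\<forall>Q. Q \<one>\<^bsub>P\<^esub> \<longrightarrow> (\<forall>s\<in>S. \<forall>x\<in>carrier P. Q x \<longrightarrow> Q (g s \<otimes>\<^bsub>P\<^esub> x)) \<longrightarrow>
       (\<forall>s\<in>S. \<exists>k>0. g s [^]\<^bsub>P\<^esub> (k::nat) = \<one>\<^bsub>P\<^esub>) \<longrightarrow> (\<forall>x\<in>carrier P. Q x)"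
    by (intro allI impI ballI) (rule ind)
  moreover have "\<forall>s\<in>S. h (g s) = f s" using hg by blast
  ultimately show ?thesis using h(1) g by (intro exI conjI)
qed

end

section \<open>Calculus modulo a central involution\<close>

locale central_involution = group G for G (structure) +
  fixes c
  assumes c_closed [simp]: "c \<in> carrier G" and c_square [simp]: "c \<otimes> c = \<one>" and c_neq_one: "c \<noteq> \<one>"
    and c_central: "g \<in> carrier G \<Longrightarrow> g \<otimes> c = c \<otimes> g"
begin

lemma c_pow: "c [^] (k::nat) = (if even k then \<one> else c)"
  by (induction k) auto

lemma c_pow_eq_one_iff: "c [^] (k::nat) = \<one> \<longleftrightarrow> even k"
  using c_neq_one by (simp add: c_pow)

lemma c_cancel: "g \<in> carrier G \<Longrightarrow> c \<otimes> (c \<otimes> g) = g"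
  by (simp flip: m_assoc)

lemma c_left_commute: "g \<in> carrier G \<Longrightarrow> k \<in> carrier G \<Longrightarrow> g \<otimes> (c \<otimes> k) = c \<otimes> (g \<otimes> k)"
  using c_central[of g] by (simp flip: m_assoc)

lemma pow_anticommute:
  assumes "x \<in> carrier G" "y \<in> carrier G" "x \<otimes> y = c \<otimes> (y \<otimes> x)"
  shows "x [^] (k::nat) \<otimes> y = c [^] k \<otimes> (y \<otimes> x [^] k)"
proof (induction k)
  case (Suc k)
  have "x [^] Suc k \<otimes> y = x [^] k \<otimes> (x \<otimes> y)"
    using assms(1,2) by (simp add: m_assoc)
  also have "\<dots> = c \<otimes> ((x [^] k \<otimes> y) \<otimes> x)"
    unfolding assms(3) using assms(1,2) by (simp add: m_assoc c_left_commute)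
  also have "\<dots> = c [^] Suc k \<otimes> (y \<otimes> x [^] Suc k)"
    unfolding Suc nat_pow_Suc2[OF c_closed] using assms(1,2) by (simp add: m_assoc)
  finally show ?case .
qed (use assms in simp)

text \<open>Moving \<open>y\<close> past \<open>k\<close> copies of \<open>x\<close> costs
  \<open>c [^] k\<close>, of which only the parity survives. This decides which normal forms in the
  nonabelian factors have central image.\<close>

lemma pow_commute_iff_even:
  assumes "x \<in> carrier G" "y \<in> carrier G" "x \<otimes> y = c \<otimes> (y \<otimes> x)"
  shows "x [^] (k::nat) \<otimes> y = y \<otimes> x [^] k \<longleftrightarrow> even k"
  using pow_anticommute[OF assms, of k] assms(1,2) c_neq_one by (auto simp: c_pow)

lemma anticommute_sym:
  assumes "x \<in> carrier G" "y \<in> carrier G" "x \<otimes> y = c \<otimes> (y \<otimes> x)"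
  shows "y \<otimes> x = c \<otimes> (x \<otimes> y)"
  unfolding assms(3) using assms(1,2) by (simp add: c_cancel)

section \<open>The factors as subgroups\<close>

text \<open>The subgroup to be amalgamated is defined inside \<open>F\<close>, without reference to
  \<open>G\<close>. Its image lies in the derived subgroup of \<open>G\<close>, and the commutator
  of \<open>u\<close> and \<open>v\<close> has nontrivial image, which must then be
  \<open>c\<close>; injectivity pulls this back to \<open>F\<close>.\<close>

lemma nonabelian_factor_eq:
  assumes F: "group F" and h: "h \<in> hom F G" "inj_on h (carrier F)"
    and der: "derived G (carrier G) \<subseteq> {\<one>, c}"
    and uv: "u \<in> carrier F" "v \<in> carrier F" "h u \<otimes> h v \<noteq> h v \<otimes> h u"
  shows "nonabelian_factor F = (F, {x \<in> carrier F. h x \<in> {\<one>, c}})"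
proof -
  interpret h: group_hom F G h
    using F h by (simp add: group_hom_def group_hom_axioms_def is_group)
  have sub: "derived F (carrier F) \<subseteq> carrier F"
    by (rule h.G.derived_in_carrier) simp
  have img: "h ` derived F (carrier F) \<subseteq> {\<one>, c}"
  proof -
    have "h ` derived F (carrier F) = derived G (h ` carrier F)"
      using h.derived_img[of "carrier F"] by simp
    also have "\<dots> \<subseteq> derived G (carrier G)"
      by (rule mono_derived) auto
    finally show ?thesis using der by blast
  qed
  define w where "w = u \<otimes>\<^bsub>F\<^esub> v \<otimes>\<^bsub>F\<^esub> inv\<^bsub>F\<^esub> u \<otimes>\<^bsub>F\<^esub> inv\<^bsub>F\<^esub> v"
  have w: "w \<in> derived F (carrier F)"
    unfolding derived_def w_def using uv by (intro generate.incl) blast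
  have hw: "h w = h u \<otimes> h v \<otimes> inv (h u) \<otimes> inv (h v)"
    unfolding w_def using uv by simp
  have "h w \<noteq> \<one>"
  proof
    assume "h w = \<one>"
    then have "h u \<otimes> h v = h v \<otimes> h u"
      unfolding hw using uv by (simp add: inv_solve_right')
    then show False using uv(3) by simp
  qed
  then have hwc: "h w = c" using w img by blast
  have "x \<in> derived F (carrier F)" if x: "x \<in> carrier F" "h x \<in> {\<one>, c}" for x
  proof (cases "h x = c")
    case True
    then have "x = w" using inj_onD[OF h(2), of x w] hwc x w sub by auto
    then show ?thesis using w by simp
  next
    case False
    then have "x = \<one>\<^bsub>F\<^esub>" using inj_onD[OF h(2), of x "\<one>\<^bsub>F\<^esub>"] x by simp
    then show ?thesis unfolding derived_def by (simp add: generate.one)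
  qed
  then show ?thesis
    unfolding nonabelian_factor_def using sub img by blast
qed

text \<open>The definite description in \<open>cyclic_factor\<close> has to be shown well defined: a
  subgroup of order 2 consists of the identity and an involution, and \<open>uniq\<close> leaves
  only the preimage of \<open>c\<close> for the latter.\<close>

lemma cyclic_factor_eq:
  assumes F: "group F" and h: "h \<in> hom F G" "inj_on h (carrier F)" "c \<in> h ` carrier F"
    and uniq: "\<And>x. x \<in> carrier F \<Longrightarrow> h x \<otimes> h x = \<one> \<Longrightarrow> h x \<in> {\<one>, c}"
  shows "cyclic_factor F = (F, {x \<in> carrier F. h x \<in> {\<one>, c}})"
proof -
  interpret h: group_hom F G h
    using F h by (simp add: group_hom_def group_hom_axioms_def is_group)
  let ?S = "{x \<in> carrier F. h x \<in> {\<one>, c}}"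
  obtain w where w: "w \<in> carrier F" "h w = c" using h(3) by blast
  have S: "?S = {\<one>\<^bsub>F\<^esub>, w}"
  proof (intro equalityI subsetI)
    fix x assume x: "x \<in> ?S"
    then show "x \<in> {\<one>\<^bsub>F\<^esub>, w}"
      using inj_onD[OF h(2), of x "\<one>\<^bsub>F\<^esub>"] inj_onD[OF h(2), of x w] w by auto
  qed (use w in auto)
  have wn: "w \<noteq> \<one>\<^bsub>F\<^esub>" using w c_neq_one by auto
  have "h (w \<otimes>\<^bsub>F\<^esub> w) = h \<one>\<^bsub>F\<^esub>" using w by simp
  then have ww: "w \<otimes>\<^bsub>F\<^esub> w = \<one>\<^bsub>F\<^esub>"
    using inj_onD[OF h(2), of "w \<otimes>\<^bsub>F\<^esub> w" "\<one>\<^bsub>F\<^esub>"] w by simp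
  have "(THE A. subgroup A F \<and> card A = 2) = ?S"
  proof (rule the_equality)
    show "subgroup ?S F \<and> card ?S = 2"
      unfolding S using h.G.subgroup_involution[OF w(1) ww] wn by simp
    fix A assume A: "subgroup A F \<and> card A = 2"
    then have one: "\<one>\<^bsub>F\<^esub> \<in> A" by (simp add: subgroup.one_closed)
    then obtain a where a: "A = {\<one>\<^bsub>F\<^esub>, a}" "a \<noteq> \<one>\<^bsub>F\<^esub>"
      using A by (auto simp: card_2_iff)
    have aF: "a \<in> carrier F" using A a subgroup.mem_carrier[of A F a] by simp
    have "a \<otimes>\<^bsub>F\<^esub> a \<in> A" using A a subgroup.m_closed[of A F a a] by simp
    moreover have "a \<otimes>\<^bsub>F\<^esub> a \<noteq> a" using aF a(2) by simp
    ultimately have "a \<otimes>\<^bsub>F\<^esub> a = \<one>\<^bsub>F\<^esub>" using a(1) by blast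
    then have "h a \<otimes> h a = \<one>" using aF h.hom_mult[of a a] by simp
    then have "a \<in> ?S" using uniq[OF aF] aF by simp
    then show "A = ?S" using a unfolding S by blast
  qed
  then show ?thesis by (simp add: cyclic_factor_def)
qed

text \<open>\<open>p\<close> is the rotation of order 4 and \<open>q\<close> a reflection.
  Injectivity is obtained without counting elements: the image of a kernel element commutes with
  \<open>p\<close> and \<open>q\<close>, so \<open>key\<close> makes the element an even power of
  the rotation \<open>A\<close>, and its trivial image turns that into a power of
  \<open>A [^] 4\<close>.\<close>

lemma D8_embedding:
  assumes p: "p \<in> carrier G" "p \<otimes> p = c" and q: "q \<in> carrier G" "q \<otimes> q = \<one>"
    and pq: "p \<otimes> q = c \<otimes> (q \<otimes> p)"
  obtains h where "h \<in> hom D8 G" "inj_on h (carrier D8)" "p \<in> h ` carrier D8" "q \<in> h ` carrier D8"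
    "\<And>H. subgroup H G \<Longrightarrow> p \<in> H \<Longrightarrow> q \<in> H \<Longrightarrow> h ` carrier D8 \<subseteq> H"
    "\<And>u. u \<in> h ` carrier D8 \<Longrightarrow> u \<otimes> p = p \<otimes> u \<Longrightarrow> u \<otimes> q = q \<otimes> u \<Longrightarrow> u \<in> {\<one>, c}"
proof -
  let ?S = "{GenA, GenB}"
  let ?R = "{(word_pow wa 4, []), (word_pow wb 2, []), (word_inv wb @ wa @ wb, word_inv wa)}"
  let ?f = "\<lambda>s. if s = GenA then p else q"
  have f: "?f ` ?S \<subseteq> carrier G" using p q by auto
  have "p [^] (4::nat) = (p \<otimes> p) \<otimes> (p \<otimes> p)" using p(1) by (simp add: numeral_eq_Suc m_assoc)
  then have p4: "p [^] (4::nat) = \<one>" by (simp add: p(2))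
  have q2: "q [^] (2::nat) = \<one>" using q(1) by (simp add: numeral_eq_Suc q(2))
  have inv_q: "inv q = q" by (rule inv_equality) (simp_all add: q)
  have inv_p: "inv p = c \<otimes> p" by (rule inv_equality) (simp_all add: p m_assoc)
  have "q \<otimes> (p \<otimes> q) = c \<otimes> ((q \<otimes> q) \<otimes> p)"
    unfolding pq using p(1) q(1) by (simp add: c_left_commute m_assoc)
  then have qpq: "q \<otimes> (p \<otimes> q) = c \<otimes> p" using p(1) by (simp add: q(2))
  have R: "\<forall>(u, v)\<in>?R. word_val ?f u = word_val ?f v"
    using p(1) q(1) p4 q2 word_val_word_pow[of ?f GenA 4] word_val_word_pow[of ?f GenB 2]
    by (auto simp: word_inv_def inv_q inv_p qpq)
  have RS: "?R \<subseteq> words ?S \<times> words ?S" by simp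
  interpret D: group D8 by (simp add: D8_def)
  obtain h g where h: "h \<in> hom D8 G" and g: "g ` ?S \<subseteq> carrier D8" and hg: "\<forall>s\<in>?S. h (g s) = ?f s"
    and rel: "\<forall>(u, v)\<in>?R. D.word_val g u = D.word_val g v"
    and ind: "\<forall>Q. Q \<one>\<^bsub>D8\<^esub> \<longrightarrow> (\<forall>s\<in>?S. \<forall>x\<in>carrier D8. Q x \<longrightarrow> Q (g s \<otimes>\<^bsub>D8\<^esub> x)) \<longrightarrow>
       (\<forall>s\<in>?S. \<exists>k>0. g s [^]\<^bsub>D8\<^esub> (k::nat) = \<one>\<^bsub>D8\<^esub>) \<longrightarrow> (\<forall>x\<in>carrier D8. Q x)"
    using presented_group_univ[OF f R RS D8_def] by (elim exE conjE) (rule that)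
  interpret h: group_hom D8 G h
    using h by (simp add: group_hom_def group_hom_axioms_def is_group)
  define A B where "A = g GenA" and "B = g GenB"
  have AB: "A \<in> carrier D8" "B \<in> carrier D8" using g by (auto simp: A_def B_def)
  have hAB: "h A = p" "h B = q" using hg by (auto simp: A_def B_def)
  have A4: "A [^]\<^bsub>D8\<^esub> (4::nat) = \<one>\<^bsub>D8\<^esub>" and B2: "B [^]\<^bsub>D8\<^esub> (2::nat) = \<one>\<^bsub>D8\<^esub>"
    using rel AB
      D.word_val_word_pow[of g GenA 4] D.word_val_word_pow[of g GenB 2]
    by (auto simp: A_def B_def)
  have BB: "B \<otimes>\<^bsub>D8\<^esub> B = \<one>\<^bsub>D8\<^esub>" using B2 AB by (simp add: numeral_eq_Suc)
  have inv_B: "inv\<^bsub>D8\<^esub> B = B" using BB AB by (intro D.inv_equality)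
  have "B \<otimes>\<^bsub>D8\<^esub> (A \<otimes>\<^bsub>D8\<^esub> B) = inv\<^bsub>D8\<^esub> A"
    using rel AB inv_B
    by (simp add: word_inv_def A_def B_def)
  then have "B \<otimes>\<^bsub>D8\<^esub> (A \<otimes>\<^bsub>D8\<^esub> B) \<otimes>\<^bsub>D8\<^esub> B = inv\<^bsub>D8\<^esub> A \<otimes>\<^bsub>D8\<^esub> B" by simp
  then have BA1: "B \<otimes>\<^bsub>D8\<^esub> A = inv\<^bsub>D8\<^esub> A \<otimes>\<^bsub>D8\<^esub> B" using AB BB by (simp add: D.m_assoc)
  have inv_A: "inv\<^bsub>D8\<^esub> A = A [^]\<^bsub>D8\<^esub> (3::nat)"
    using A4 AB by (intro D.inv_equality) (simp_all add: numeral_eq_Suc)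
  \<comment> \<open>The exponent \<open>3 * i\<close> stands for the inverse of the
    \<open>i\<close>-th power, so that all exponents stay natural numbers.\<close>
  have BA: "B \<otimes>\<^bsub>D8\<^esub> A [^]\<^bsub>D8\<^esub> (i::nat) = A [^]\<^bsub>D8\<^esub> (3 * i) \<otimes>\<^bsub>D8\<^esub> B" for i
  proof (induction i)
    case (Suc i)
    have "B \<otimes>\<^bsub>D8\<^esub> A [^]\<^bsub>D8\<^esub> Suc i = (B \<otimes>\<^bsub>D8\<^esub> A [^]\<^bsub>D8\<^esub> i) \<otimes>\<^bsub>D8\<^esub> A"
      using AB by (simp add: D.m_assoc)
    also have "\<dots> = A [^]\<^bsub>D8\<^esub> (3 * i) \<otimes>\<^bsub>D8\<^esub> (A [^]\<^bsub>D8\<^esub> (3::nat) \<otimes>\<^bsub>D8\<^esub> B)"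
      unfolding Suc inv_A[symmetric] BA1[symmetric] using AB by (simp add: D.m_assoc)
    also have "\<dots> = A [^]\<^bsub>D8\<^esub> (3 * i + 3) \<otimes>\<^bsub>D8\<^esub> B"
      using AB by (simp add: D.m_assoc flip: D.nat_pow_mult)
    finally show ?case by (simp add: add.commute)
  qed (use AB in simp)
  have nf: "\<exists>i::nat. x = A [^]\<^bsub>D8\<^esub> i \<or> x = A [^]\<^bsub>D8\<^esub> i \<otimes>\<^bsub>D8\<^esub> B" if "x \<in> carrier D8" for x
  proof (rule ind[rule_format, OF _ _ _ that])
    show "\<exists>i::nat. \<one>\<^bsub>D8\<^esub> = A [^]\<^bsub>D8\<^esub> i \<or> \<one>\<^bsub>D8\<^esub> = A [^]\<^bsub>D8\<^esub> i \<otimes>\<^bsub>D8\<^esub> B"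
      by (intro exI[of _ 0]) simp
    show "\<exists>k>0. g s [^]\<^bsub>D8\<^esub> (k::nat) = \<one>\<^bsub>D8\<^esub>" if "s \<in> ?S" for s
      using that A4 B2 by (auto simp: A_def B_def intro: exI[of _ 4] exI[of _ 2])
    fix s x assume s: "s \<in> ?S"
      and "\<exists>i::nat. x = A [^]\<^bsub>D8\<^esub> i \<or> x = A [^]\<^bsub>D8\<^esub> i \<otimes>\<^bsub>D8\<^esub> B"
    then obtain i :: nat where i: "x = A [^]\<^bsub>D8\<^esub> i \<or> x = A [^]\<^bsub>D8\<^esub> i \<otimes>\<^bsub>D8\<^esub> B" by blast
    have a: "A \<otimes>\<^bsub>D8\<^esub> A [^]\<^bsub>D8\<^esub> i = A [^]\<^bsub>D8\<^esub> Suc i"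
      "A \<otimes>\<^bsub>D8\<^esub> (A [^]\<^bsub>D8\<^esub> i \<otimes>\<^bsub>D8\<^esub> B) = A [^]\<^bsub>D8\<^esub> Suc i \<otimes>\<^bsub>D8\<^esub> B"
      unfolding D.nat_pow_Suc2[OF AB(1)] using AB by (simp_all add: D.m_assoc)
    have b: "B \<otimes>\<^bsub>D8\<^esub> (A [^]\<^bsub>D8\<^esub> i \<otimes>\<^bsub>D8\<^esub> B) = A [^]\<^bsub>D8\<^esub> (3 * i)"
      using BA[of i] BB AB by (simp add: D.m_assoc flip: D.m_assoc[of B])
    consider "g s = A" | "g s = B" using s by (auto simp: A_def B_def)
    then show "\<exists>i::nat. g s \<otimes>\<^bsub>D8\<^esub> x = A [^]\<^bsub>D8\<^esub> i \<or> g s \<otimes>\<^bsub>D8\<^esub> x = A [^]\<^bsub>D8\<^esub> i \<otimes>\<^bsub>D8\<^esub> B"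
      by cases (use i a b BA in metis)+
  qed
  have pow_h: "h (A [^]\<^bsub>D8\<^esub> (i::nat)) = p [^] i" for i
    using AB by (simp add: h.hom_nat_pow hAB)
  \<comment> \<open>Commuting with \<open>p\<close> excludes the reflections, and commuting with
    \<open>q\<close> excludes the odd powers of the rotation.\<close>
  have key: "\<exists>k::nat. x = A [^]\<^bsub>D8\<^esub> (2 * k) \<and> h x = c [^] k"
    if x: "x \<in> carrier D8" "h x \<otimes> p = p \<otimes> h x" "h x \<otimes> q = q \<otimes> h x" for x
  proof -
    obtain i :: nat where i: "x = A [^]\<^bsub>D8\<^esub> i \<or> x = A [^]\<^bsub>D8\<^esub> i \<otimes>\<^bsub>D8\<^esub> B" using nf[OF x(1)] by blast
    have "x \<noteq> A [^]\<^bsub>D8\<^esub> i \<otimes>\<^bsub>D8\<^esub> B"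
    proof
      assume xi: "x = A [^]\<^bsub>D8\<^esub> i \<otimes>\<^bsub>D8\<^esub> B"
      then have hx: "h x = p [^] i \<otimes> q" using AB by (simp add: pow_h hAB)
      have pi: "p [^] i \<otimes> p = p \<otimes> p [^] i" using nat_pow_Suc2[OF p(1), of i] by simp
      have "p [^] i \<otimes> (q \<otimes> p) = h x \<otimes> p" unfolding hx using p(1) q(1) by (simp add: m_assoc)
      also have "\<dots> = (p \<otimes> p [^] i) \<otimes> q" unfolding x(2) unfolding hx using p(1) q(1) by (simp add: m_assoc)
      also have "\<dots> = p [^] i \<otimes> (p \<otimes> q)" unfolding pi[symmetric] using p(1) q(1) by (simp add: m_assoc)
      finally have "q \<otimes> p = p \<otimes> q" using p(1) q(1) by simp
      then have "p [^] (1::nat) \<otimes> q = q \<otimes> p [^] (1::nat)" using p(1) by simp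
      then show False using pow_commute_iff_even[OF p(1) q(1) pq, of 1] by simp
    qed
    then have xi: "x = A [^]\<^bsub>D8\<^esub> i" "h x = p [^] i" using i pow_h by auto
    then have "even i" using x(3) pow_commute_iff_even[OF p(1) q(1) pq] by simp
    then obtain k where k: "i = 2 * k" by blast
    have "p [^] (2 * k) = (p [^] (2::nat)) [^] k" using p(1) by (simp add: nat_pow_pow)
    also have "p [^] (2::nat) = c" using p(1) by (simp add: numeral_eq_Suc p(2))
    finally show ?thesis using xi k by auto
  qed
  show thesis
  proof (rule that[OF h])
    have "x = \<one>\<^bsub>D8\<^esub>" if x: "x \<in> carrier D8" "h x = \<one>" for x
    proof -
      obtain k :: nat where k: "x = A [^]\<^bsub>D8\<^esub> (2 * k)" "h x = c [^] k"
        using key[OF x(1)] x(2) p(1) q(1) by auto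
      then have "even k" using x c_pow_eq_one_iff by simp
      then obtain l where "k = 2 * l" by blast
      then have "x = (A [^]\<^bsub>D8\<^esub> (4::nat)) [^]\<^bsub>D8\<^esub> l" using k AB by (simp add: D.nat_pow_pow)
      then show ?thesis by (simp add: A4)
    qed
    then show "inj_on h (carrier D8)" using h.inj_on_one_iff by blast
    show "p \<in> h ` carrier D8" "q \<in> h ` carrier D8" using AB hAB by blast+
    show "u \<in> {\<one>, c}" if u: "u \<in> h ` carrier D8" "u \<otimes> p = p \<otimes> u" "u \<otimes> q = q \<otimes> u" for u
    proof -
      obtain x where x: "x \<in> carrier D8" "u = h x" using u(1) by blast
      then obtain k :: nat where "u = c [^] k" using key[of x] u(2,3) by blast
      then show ?thesis by (simp add: c_pow)
    qed
    fix H assume H: "subgroup H G" "p \<in> H" "q \<in> H"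
    have pow: "p [^] (i::nat) \<in> H" for i
      using subgroup_int_pow[OF H(1,2), of "int i"] by (simp add: int_pow_int)
    show "h ` carrier D8 \<subseteq> H"
    proof
      fix u assume "u \<in> h ` carrier D8"
      then obtain x where x: "u = h x" "x \<in> carrier D8" by blast
      obtain i :: nat where "x = A [^]\<^bsub>D8\<^esub> i \<or> x = A [^]\<^bsub>D8\<^esub> i \<otimes>\<^bsub>D8\<^esub> B" using nf[OF x(2)] by blast
      then have "u = p [^] i \<or> u = p [^] i \<otimes> q" using x AB by (auto simp: pow_h hAB)
      then show "u \<in> H" using pow[of i] H subgroup.m_closed[OF H(1)] by auto
    qed
  qed
qed

text \<open>The assumption \<open>sep\<close> says that no power of \<open>a \<otimes> a\<close>
  falls into \<open>{\<one>, c}\<close> before exponent \<open>2 ^ m\<close>. This keeps the powers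
  of \<open>a\<close> and of \<open>c\<close> apart, and so makes the normal form with exponents of
  \<open>A\<close>, \<open>B\<close>, \<open>D\<close> faithful in \<open>G\<close>.\<close>

lemma M2_embedding:
  assumes a: "a \<in> carrier G" "a [^] (2 ^ (m + 1) :: nat) = \<one>" and b: "b \<in> carrier G" "b \<otimes> b = \<one>"
    and ab: "a \<otimes> b = c \<otimes> (b \<otimes> a)"
    and sep: "\<And>k::nat. (a \<otimes> a) [^] k \<in> {\<one>, c} \<Longrightarrow> 2 ^ m dvd k"
  obtains h where "h \<in> hom (M2 (m + 1)) G" "inj_on h (carrier (M2 (m + 1)))"
    "a \<in> h ` carrier (M2 (m + 1))" "b \<in> h ` carrier (M2 (m + 1))"
    "\<And>H. subgroup H G \<Longrightarrow> a \<in> H \<Longrightarrow> b \<in> H \<Longrightarrow> c \<in> H \<Longrightarrow> h ` carrier (M2 (m + 1)) \<subseteq> H"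
    "\<And>u. u \<in> h ` carrier (M2 (m + 1)) \<Longrightarrow> u \<otimes> a = a \<otimes> u \<Longrightarrow> u \<otimes> b = b \<otimes> u \<Longrightarrow>
       \<exists>(k::nat) (l::nat). u = (a \<otimes> a) [^] k \<otimes> c [^] l"
proof -
  define M where "M = M2 (m + 1)"
  let ?S = "{GenA, GenB, GenD}"
  let ?R = "{(word_pow wa (2 ^ (m + 1)), []), (word_pow wb 2, []), (word_pow wd 2, []),
      (word_comm wa wb, wd), (word_comm wd wa, []), (word_comm wd wb, [])}"
  define f where "f s = (case s of GenA \<Rightarrow> a | GenB \<Rightarrow> b | GenD \<Rightarrow> c)" for s
  have f_simps: "f GenA = a" "f GenB = b" "f GenD = c" by (simp_all add: f_def)
  have f: "f ` ?S \<subseteq> carrier G" using a b by (simp add: f_simps)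
  have b2: "b [^] (2::nat) = \<one>" using b(1) by (simp add: numeral_eq_Suc b(2))
  have c2: "c [^] (2::nat) = \<one>" by (simp add: c_pow)
  have comm: "inv x \<otimes> (inv y \<otimes> (x \<otimes> y)) = \<one>" if "x \<in> carrier G" "y \<in> carrier G" "x \<otimes> y = y \<otimes> x" for x y
    unfolding that(3) using that(1,2) by (simp flip: m_assoc[of "inv y"])
  have "inv b \<otimes> (b \<otimes> a) = a" using a(1) b(1) by (simp flip: m_assoc)
  then have ab': "inv a \<otimes> (inv b \<otimes> (a \<otimes> b)) = c"
    unfolding ab using a(1) b(1) by (simp add: c_left_commute)
  have R: "\<forall>(u, v)\<in>?R. word_val f u = word_val f v"
    using word_val_word_pow[of f GenA "2 ^ (m + 1)"] word_val_word_pow[of f GenB 2]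
      word_val_word_pow[of f GenD 2] a b(1) b2 c2 ab' comm[of c a] comm[of c b] c_central[of a] c_central[of b]
    by (simp add: word_comm_def word_inv_def f_simps del: word_pow_Suc power_Suc)
  have RS: "?R \<subseteq> words ?S \<times> words ?S" by (simp add: word_comm_def)
  interpret D: group M by (simp add: M_def M2_def)
  obtain h g where h: "h \<in> hom M G" and g: "g ` ?S \<subseteq> carrier M" and hg: "\<forall>s\<in>?S. h (g s) = f s"
    and rel: "\<forall>(u, v)\<in>?R. D.word_val g u = D.word_val g v"
    and ind: "\<forall>Q. Q \<one>\<^bsub>M\<^esub> \<longrightarrow> (\<forall>s\<in>?S. \<forall>x\<in>carrier M. Q x \<longrightarrow> Q (g s \<otimes>\<^bsub>M\<^esub> x)) \<longrightarrow>
       (\<forall>s\<in>?S. \<exists>k>0. g s [^]\<^bsub>M\<^esub> (k::nat) = \<one>\<^bsub>M\<^esub>) \<longrightarrow> (\<forall>x\<in>carrier M. Q x)"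
    using presented_group_univ[OF f R RS M_def[unfolded M2_def]] by (elim exE conjE) (rule that)
  interpret h: group_hom M G h
    using h by (simp add: group_hom_def group_hom_axioms_def is_group)
  define A B D where "A = g GenA" and "B = g GenB" and "D = g GenD"
  have AB: "A \<in> carrier M" "B \<in> carrier M" "D \<in> carrier M" using g by (auto simp: A_def B_def D_def)
  have hAB: "h A = a" "h B = b" "h D = c" using hg by (auto simp: A_def B_def D_def f_simps)
  have AM: "A [^]\<^bsub>M\<^esub> (2 ^ (m + 1) :: nat) = \<one>\<^bsub>M\<^esub>" and B2: "B [^]\<^bsub>M\<^esub> (2::nat) = \<one>\<^bsub>M\<^esub>"
    and D2: "D [^]\<^bsub>M\<^esub> (2::nat) = \<one>\<^bsub>M\<^esub>"
    using rel AB D.word_val_word_pow[of g GenA "2 ^ (m + 1)"] D.word_val_word_pow[of g GenB 2]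
      D.word_val_word_pow[of g GenD 2]
    by (simp_all add: A_def B_def D_def del: word_pow_Suc power_Suc)
  have DD: "D \<otimes>\<^bsub>M\<^esub> D = \<one>\<^bsub>M\<^esub>" using D2 AB by (simp add: numeral_eq_Suc)
  have r: "inv\<^bsub>M\<^esub> A \<otimes>\<^bsub>M\<^esub> (inv\<^bsub>M\<^esub> B \<otimes>\<^bsub>M\<^esub> (A \<otimes>\<^bsub>M\<^esub> B)) = D"
    "inv\<^bsub>M\<^esub> D \<otimes>\<^bsub>M\<^esub> (inv\<^bsub>M\<^esub> A \<otimes>\<^bsub>M\<^esub> (D \<otimes>\<^bsub>M\<^esub> A)) = \<one>\<^bsub>M\<^esub>"
    "inv\<^bsub>M\<^esub> D \<otimes>\<^bsub>M\<^esub> (inv\<^bsub>M\<^esub> B \<otimes>\<^bsub>M\<^esub> (D \<otimes>\<^bsub>M\<^esub> B)) = \<one>\<^bsub>M\<^esub>"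
    using rel AB by (simp_all add: word_comm_def word_inv_def A_def B_def D_def del: word_pow_Suc power_Suc)
  have unfold_comm: "x \<otimes>\<^bsub>M\<^esub> y = y \<otimes>\<^bsub>M\<^esub> x \<otimes>\<^bsub>M\<^esub> z"
    if "inv\<^bsub>M\<^esub> x \<otimes>\<^bsub>M\<^esub> (inv\<^bsub>M\<^esub> y \<otimes>\<^bsub>M\<^esub> (x \<otimes>\<^bsub>M\<^esub> y)) = z" "x \<in> carrier M" "y \<in> carrier M" for x y z
    unfolding that(1)[symmetric] using that(2,3) by (simp add: D.m_assoc) (simp flip: D.m_assoc)
  have DA: "D \<otimes>\<^bsub>M\<^esub> A = A \<otimes>\<^bsub>M\<^esub> D" and DB: "D \<otimes>\<^bsub>M\<^esub> B = B \<otimes>\<^bsub>M\<^esub> D"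
    using unfold_comm[OF r(2)] unfold_comm[OF r(3)] AB by simp_all
  have "B \<otimes>\<^bsub>M\<^esub> A = (A \<otimes>\<^bsub>M\<^esub> B) \<otimes>\<^bsub>M\<^esub> D"
    unfolding unfold_comm[OF r(1) AB(1,2)] using AB DD by (simp add: D.m_assoc)
  then have BA1: "B \<otimes>\<^bsub>M\<^esub> A = A \<otimes>\<^bsub>M\<^esub> (B \<otimes>\<^bsub>M\<^esub> D)" using AB by (simp add: D.m_assoc)
  \<comment> \<open>Every exchange of \<open>B\<close> with one \<open>A\<close> costs one central
    \<open>D\<close>.\<close>
  have BA: "B \<otimes>\<^bsub>M\<^esub> A [^]\<^bsub>M\<^esub> (i::nat) = A [^]\<^bsub>M\<^esub> i \<otimes>\<^bsub>M\<^esub> (B \<otimes>\<^bsub>M\<^esub> D [^]\<^bsub>M\<^esub> i)" for i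
  proof (induction i)
    case (Suc i)
    have DiA: "D [^]\<^bsub>M\<^esub> i \<otimes>\<^bsub>M\<^esub> A = A \<otimes>\<^bsub>M\<^esub> D [^]\<^bsub>M\<^esub> i"
      using D.group_commutes_pow[OF DA] AB by simp
    have "B \<otimes>\<^bsub>M\<^esub> A [^]\<^bsub>M\<^esub> Suc i = (B \<otimes>\<^bsub>M\<^esub> A [^]\<^bsub>M\<^esub> i) \<otimes>\<^bsub>M\<^esub> A"
      using AB by (simp add: D.m_assoc)
    also have "\<dots> = A [^]\<^bsub>M\<^esub> i \<otimes>\<^bsub>M\<^esub> (B \<otimes>\<^bsub>M\<^esub> A \<otimes>\<^bsub>M\<^esub> D [^]\<^bsub>M\<^esub> i)"
      unfolding Suc using AB DiA by (simp add: D.m_assoc)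
    also have "\<dots> = A [^]\<^bsub>M\<^esub> Suc i \<otimes>\<^bsub>M\<^esub> (B \<otimes>\<^bsub>M\<^esub> D [^]\<^bsub>M\<^esub> Suc i)"
      unfolding BA1 D.nat_pow_Suc2[OF AB(3)] using AB by (simp add: D.m_assoc)
    finally show ?case .
  qed (use AB in simp)
  have nf: "\<exists>(i::nat) (j::nat) (l::nat). x = A [^]\<^bsub>M\<^esub> i \<otimes>\<^bsub>M\<^esub> (B [^]\<^bsub>M\<^esub> j \<otimes>\<^bsub>M\<^esub> D [^]\<^bsub>M\<^esub> l)" if "x \<in> carrier M" for x
  proof (rule ind[rule_format, OF _ _ _ that])
    show "\<exists>(i::nat) (j::nat) (l::nat). \<one>\<^bsub>M\<^esub> = A [^]\<^bsub>M\<^esub> i \<otimes>\<^bsub>M\<^esub> (B [^]\<^bsub>M\<^esub> j \<otimes>\<^bsub>M\<^esub> D [^]\<^bsub>M\<^esub> l)"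
      by (intro exI[of _ 0]) simp
    show "\<exists>k>0. g s [^]\<^bsub>M\<^esub> (k::nat) = \<one>\<^bsub>M\<^esub>" if "s \<in> ?S" for s
      using that AM B2 D2 zero_less_power[of "2::nat" "m + 1"]
      unfolding A_def B_def D_def by (metis empty_iff insert_iff zero_less_numeral)
    fix s x assume s: "s \<in> ?S"
      and "\<exists>(i::nat) (j::nat) (l::nat). x = A [^]\<^bsub>M\<^esub> i \<otimes>\<^bsub>M\<^esub> (B [^]\<^bsub>M\<^esub> j \<otimes>\<^bsub>M\<^esub> D [^]\<^bsub>M\<^esub> l)"
    then obtain i j l :: nat where x: "x = A [^]\<^bsub>M\<^esub> i \<otimes>\<^bsub>M\<^esub> (B [^]\<^bsub>M\<^esub> j \<otimes>\<^bsub>M\<^esub> D [^]\<^bsub>M\<^esub> l)" by blast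
    have DiB: "D [^]\<^bsub>M\<^esub> (k::nat) \<otimes>\<^bsub>M\<^esub> B [^]\<^bsub>M\<^esub> j = B [^]\<^bsub>M\<^esub> j \<otimes>\<^bsub>M\<^esub> D [^]\<^bsub>M\<^esub> k" for k
      using D.group_commutes_pow[OF D.group_commutes_pow[OF DB AB(3,2), symmetric], of k j] AB by simp
    have "A \<otimes>\<^bsub>M\<^esub> x = A [^]\<^bsub>M\<^esub> Suc i \<otimes>\<^bsub>M\<^esub> (B [^]\<^bsub>M\<^esub> j \<otimes>\<^bsub>M\<^esub> D [^]\<^bsub>M\<^esub> l)"
      unfolding x D.nat_pow_Suc2[OF AB(1)] using AB by (simp add: D.m_assoc)
    moreover have "D \<otimes>\<^bsub>M\<^esub> x = A [^]\<^bsub>M\<^esub> i \<otimes>\<^bsub>M\<^esub> (B [^]\<^bsub>M\<^esub> j \<otimes>\<^bsub>M\<^esub> D [^]\<^bsub>M\<^esub> Suc l)"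
    proof -
      have "D \<otimes>\<^bsub>M\<^esub> x = (D \<otimes>\<^bsub>M\<^esub> A [^]\<^bsub>M\<^esub> i) \<otimes>\<^bsub>M\<^esub> (B [^]\<^bsub>M\<^esub> j \<otimes>\<^bsub>M\<^esub> D [^]\<^bsub>M\<^esub> l)"
        unfolding x using AB by (simp add: D.m_assoc)
      also have "D \<otimes>\<^bsub>M\<^esub> A [^]\<^bsub>M\<^esub> i = A [^]\<^bsub>M\<^esub> i \<otimes>\<^bsub>M\<^esub> D"
        using D.group_commutes_pow[OF DA[symmetric] AB(1,3)] by simp
      also have "A [^]\<^bsub>M\<^esub> i \<otimes>\<^bsub>M\<^esub> D \<otimes>\<^bsub>M\<^esub> (B [^]\<^bsub>M\<^esub> j \<otimes>\<^bsub>M\<^esub> D [^]\<^bsub>M\<^esub> l)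
          = A [^]\<^bsub>M\<^esub> i \<otimes>\<^bsub>M\<^esub> ((D \<otimes>\<^bsub>M\<^esub> B [^]\<^bsub>M\<^esub> j) \<otimes>\<^bsub>M\<^esub> D [^]\<^bsub>M\<^esub> l)"
        using AB by (simp add: D.m_assoc)
      also have "D \<otimes>\<^bsub>M\<^esub> B [^]\<^bsub>M\<^esub> j = B [^]\<^bsub>M\<^esub> j \<otimes>\<^bsub>M\<^esub> D"
        using DiB[of 1] AB by simp
      finally show ?thesis
        unfolding D.nat_pow_Suc2[OF AB(3)] using AB by (simp add: D.m_assoc)
    qed
    moreover have "B \<otimes>\<^bsub>M\<^esub> x = A [^]\<^bsub>M\<^esub> i \<otimes>\<^bsub>M\<^esub> (B [^]\<^bsub>M\<^esub> Suc j \<otimes>\<^bsub>M\<^esub> D [^]\<^bsub>M\<^esub> (i + l))"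
    proof -
      have "B \<otimes>\<^bsub>M\<^esub> x = (B \<otimes>\<^bsub>M\<^esub> A [^]\<^bsub>M\<^esub> i) \<otimes>\<^bsub>M\<^esub> (B [^]\<^bsub>M\<^esub> j \<otimes>\<^bsub>M\<^esub> D [^]\<^bsub>M\<^esub> l)"
        unfolding x using AB by (simp add: D.m_assoc)
      also have "\<dots> = A [^]\<^bsub>M\<^esub> i \<otimes>\<^bsub>M\<^esub> (B \<otimes>\<^bsub>M\<^esub> (D [^]\<^bsub>M\<^esub> i \<otimes>\<^bsub>M\<^esub> B [^]\<^bsub>M\<^esub> j) \<otimes>\<^bsub>M\<^esub> D [^]\<^bsub>M\<^esub> l)"
        unfolding BA using AB by (simp add: D.m_assoc)
      finally show ?thesis
        unfolding DiB D.nat_pow_Suc2[OF AB(2)] D.nat_pow_mult[OF AB(3), symmetric]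
        using AB by (simp add: D.m_assoc)
    qed
    moreover consider "g s = A" | "g s = B" | "g s = D" using s by (auto simp: A_def B_def D_def)
    ultimately show "\<exists>(i::nat) (j::nat) (l::nat). g s \<otimes>\<^bsub>M\<^esub> x = A [^]\<^bsub>M\<^esub> i \<otimes>\<^bsub>M\<^esub> (B [^]\<^bsub>M\<^esub> j \<otimes>\<^bsub>M\<^esub> D [^]\<^bsub>M\<^esub> l)"
      by metis
  qed
  have h_nf: "h (A [^]\<^bsub>M\<^esub> (i::nat) \<otimes>\<^bsub>M\<^esub> (B [^]\<^bsub>M\<^esub> (j::nat) \<otimes>\<^bsub>M\<^esub> D [^]\<^bsub>M\<^esub> (l::nat)))
      = a [^] i \<otimes> (b [^] j \<otimes> c [^] l)" for i j l
    using AB by (simp add: h.hom_nat_pow hAB)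
  \<comment> \<open>Commuting with \<open>a\<close> forces an even exponent of \<open>b\<close>,
    whose power then disappears; commuting with \<open>b\<close> afterwards forces an even exponent
    of \<open>a\<close>.\<close>
  have key: "\<exists>(k::nat) (l::nat). x = A [^]\<^bsub>M\<^esub> (2 * k) \<otimes>\<^bsub>M\<^esub> D [^]\<^bsub>M\<^esub> l \<and> h x = (a \<otimes> a) [^] k \<otimes> c [^] l"
    if x: "x \<in> carrier M" "h x \<otimes> a = a \<otimes> h x" "h x \<otimes> b = b \<otimes> h x" for x
  proof -
    obtain i j l :: nat where ijl: "x = A [^]\<^bsub>M\<^esub> i \<otimes>\<^bsub>M\<^esub> (B [^]\<^bsub>M\<^esub> j \<otimes>\<^bsub>M\<^esub> D [^]\<^bsub>M\<^esub> l)"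
      using nf[OF x(1)] by blast
    then have hx: "h x = a [^] i \<otimes> (b [^] j \<otimes> c [^] l)" by (simp only: h_nf)
    have Ca: "subgroup (centralizer G {a}) G" and Cb: "subgroup (centralizer G {b}) G"
      using a(1) b(1) by (simp_all add: subgroup_centralizer)
    have "c \<in> centralizer G {a}" "c \<in> centralizer G {b}"
      using a(1) b(1) c_central by (simp_all add: centralizer_def)
    then have c: "c [^] l \<in> centralizer G {a}" "c [^] l \<in> centralizer G {b}"
      by (simp_all add: subgroup_nat_pow[OF Ca] subgroup_nat_pow[OF Cb])
    have "a [^] i \<in> centralizer G {a}"
      by (rule subgroup_nat_pow[OF Ca]) (simp add: centralizer_def a(1))
    moreover have "h x \<in> centralizer G {a}" using x by (simp add: centralizer_def)
    ultimately have "b [^] j \<in> centralizer G {a}"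
      unfolding hx using c(1) a(1) b(1)
      by (simp add: subgroup_mult_left_iff[OF Ca] subgroup_mult_right_iff[OF Ca])
    then have "b [^] j \<otimes> a = a \<otimes> b [^] j" by (simp add: centralizer_def)
    then have "even j"
      using pow_commute_iff_even[OF b(1) a(1) anticommute_sym[OF a(1) b(1) ab]] by blast
    then obtain j' where j: "j = 2 * j'" by blast
    have "b [^] j = (b [^] (2::nat)) [^] j'" using b(1) by (simp add: nat_pow_pow j)
    then have bj: "b [^] j = \<one>" by (simp add: b2)
    have "B [^]\<^bsub>M\<^esub> j = (B [^]\<^bsub>M\<^esub> (2::nat)) [^]\<^bsub>M\<^esub> j'" using AB by (simp add: D.nat_pow_pow j)
    then have Bj: "B [^]\<^bsub>M\<^esub> j = \<one>\<^bsub>M\<^esub>" by (simp add: B2)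
    have hx': "h x = a [^] i \<otimes> c [^] l" using hx by (simp add: bj)
    have "h x \<in> centralizer G {b}" using x by (simp add: centralizer_def)
    then have "a [^] i \<in> centralizer G {b}"
      unfolding hx' using c(2) a(1) by (simp add: subgroup_mult_right_iff[OF Cb])
    then have "a [^] i \<otimes> b = b \<otimes> a [^] i" by (simp add: centralizer_def)
    then have "even i" using pow_commute_iff_even[OF a(1) b(1) ab] by blast
    then obtain k where k: "i = 2 * k" by blast
    have "a [^] i = (a [^] (2::nat)) [^] k" using a(1) by (simp add: nat_pow_pow k)
    also have "a [^] (2::nat) = a \<otimes> a" using a(1) by (simp add: numeral_eq_Suc)
    finally show ?thesis using hx' ijl AB by (auto simp: Bj k)
  qed
  show thesis
  proof (rule that, unfold M_def[symmetric])
    show "h \<in> hom M G" by (rule h)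
    have "x = \<one>\<^bsub>M\<^esub>" if x: "x \<in> carrier M" "h x = \<one>" for x
    proof -
      obtain k l :: nat where k: "x = A [^]\<^bsub>M\<^esub> (2 * k) \<otimes>\<^bsub>M\<^esub> D [^]\<^bsub>M\<^esub> l" "h x = (a \<otimes> a) [^] k \<otimes> c [^] l"
        using key[OF x(1)] x(2) a(1) b(1) by auto
      \<comment> \<open>Solving for the power of \<open>a \<otimes> a\<close> places it in
        \<open>{\<one>, c}\<close>, where \<open>sep\<close> applies. The defining relation of
        \<open>A\<close> then kills its part, and \<open>l\<close> must be even.\<close>
      have "(a \<otimes> a) [^] k = inv (c [^] l)"
        using k(2) x(2) a(1) by (intro inv_equality[symmetric]) simp_all
      moreover have "inv (c [^] l) \<in> {\<one>, c}" by (auto simp: c_pow inv_equality)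
      ultimately have "2 ^ m dvd k" using sep by simp
      then obtain k' where k': "k = 2 ^ m * k'" by blast
      have "A [^]\<^bsub>M\<^esub> (2 * k) = (A [^]\<^bsub>M\<^esub> (2 ^ (m + 1) :: nat)) [^]\<^bsub>M\<^esub> k'"
        using AB by (simp add: D.nat_pow_pow k' mult.assoc)
      then have A1: "A [^]\<^bsub>M\<^esub> (2 * k) = \<one>\<^bsub>M\<^esub>" unfolding AM by simp
      then have xD: "x = D [^]\<^bsub>M\<^esub> l" using k(1) AB by simp
      then have "c [^] l = \<one>" using x(2) AB by (simp add: h.hom_nat_pow hAB)
      then have "even l" by (simp add: c_pow_eq_one_iff)
      then obtain l' where "l = 2 * l'" by blast
      then have "x = (D [^]\<^bsub>M\<^esub> (2::nat)) [^]\<^bsub>M\<^esub> l'" using xD AB by (simp add: D.nat_pow_pow)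
      then show ?thesis by (simp add: D2)
    qed
    then show "inj_on h (carrier M)" using h.inj_on_one_iff by blast
    show "a \<in> h ` carrier M" "b \<in> h ` carrier M" using AB hAB by blast+
    show "\<exists>(k::nat) (l::nat). u = (a \<otimes> a) [^] k \<otimes> c [^] l"
      if u: "u \<in> h ` carrier M" "u \<otimes> a = a \<otimes> u" "u \<otimes> b = b \<otimes> u" for u
    proof -
      obtain x where "x \<in> carrier M" "u = h x" using u(1) by blast
      then show ?thesis using key[of x] u(2,3) by blast
    qed
    fix H assume H: "subgroup H G" "a \<in> H" "b \<in> H" "c \<in> H"
    show "h ` carrier M \<subseteq> H"
    proof
      fix u assume "u \<in> h ` carrier M"
      then obtain x where x: "u = h x" "x \<in> carrier M" by blast
      obtain i j l :: nat where "x = A [^]\<^bsub>M\<^esub> i \<otimes>\<^bsub>M\<^esub> (B [^]\<^bsub>M\<^esub> j \<otimes>\<^bsub>M\<^esub> D [^]\<^bsub>M\<^esub> l)"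
        using nf[OF x(2)] by blast
      then have "u = a [^] i \<otimes> (b [^] j \<otimes> c [^] l)" by (simp only: x(1) h_nf)
      then show "u \<in> H" using H by (simp add: subgroup.m_closed subgroup_nat_pow)
    qed
  qed
qed

text \<open>A power of the generator that maps to the identity has an exponent divisible by
  \<open>ord z\<close>, hence is trivial already by the defining relation.\<close>

lemma Cyc_embedding:
  assumes z: "z \<in> carrier G" and N: "N > 0" "ord z = N"
  obtains h where "h \<in> hom (Cyc N) G" "inj_on h (carrier (Cyc N))" "h ` carrier (Cyc N) = generate G {z}"
proof -
  let ?R = "{(word_pow wa N, [])}"
  have zN: "z [^] N = \<one>" using z N by (simp add: pow_eq_id)
  have f: "(\<lambda>_. z) ` {GenA} \<subseteq> carrier G" using z by simp
  have R: "\<forall>(u, v)\<in>?R. word_val (\<lambda>_. z) u = word_val (\<lambda>_. z) v"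
    using word_val_word_pow[of "\<lambda>_. z" GenA N] z zN by simp
  have RS: "?R \<subseteq> words {GenA} \<times> words {GenA}" by simp
  interpret C: group "Cyc N" by (simp add: Cyc_def)
  obtain h g where h: "h \<in> hom (Cyc N) G" and g: "g ` {GenA} \<subseteq> carrier (Cyc N)"
    and hg: "\<forall>s\<in>{GenA}. h (g s) = z"
    and rel: "\<forall>(u, v)\<in>?R. C.word_val g u = C.word_val g v"
    and ind: "\<forall>Q. Q \<one>\<^bsub>Cyc N\<^esub> \<longrightarrow> (\<forall>s\<in>{GenA}. \<forall>x\<in>carrier (Cyc N). Q x \<longrightarrow> Q (g s \<otimes>\<^bsub>Cyc N\<^esub> x)) \<longrightarrow>
       (\<forall>s\<in>{GenA}. \<exists>k>0. g s [^]\<^bsub>Cyc N\<^esub> (k::nat) = \<one>\<^bsub>Cyc N\<^esub>) \<longrightarrow> (\<forall>x\<in>carrier (Cyc N). Q x)"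
    using presented_group_univ[OF f R RS Cyc_def] by (elim exE conjE) (rule that)
  interpret h: group_hom "Cyc N" G h
    using h by (simp add: group_hom_def group_hom_axioms_def is_group)
  define A where "A = g GenA"
  have A: "A \<in> carrier (Cyc N)" and hA: "h A = z" using g hg by (auto simp: A_def)
  have AN: "A [^]\<^bsub>Cyc N\<^esub> N = \<one>\<^bsub>Cyc N\<^esub>"
    using rel A C.word_val_word_pow[of g GenA N] by (simp add: A_def)
  have nf: "\<exists>i::nat. x = A [^]\<^bsub>Cyc N\<^esub> i" if "x \<in> carrier (Cyc N)" for x
  proof (rule ind[rule_format, OF _ _ _ that])
    show "\<exists>i::nat. \<one>\<^bsub>Cyc N\<^esub> = A [^]\<^bsub>Cyc N\<^esub> i" by (intro exI[of _ 0]) simp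
    show "\<exists>k>0. g s [^]\<^bsub>Cyc N\<^esub> (k::nat) = \<one>\<^bsub>Cyc N\<^esub>" if "s \<in> {GenA}" for s
      using that AN N by (auto simp: A_def)
    fix s x assume "s \<in> {GenA}" and "\<exists>i::nat. x = A [^]\<^bsub>Cyc N\<^esub> i"
    then obtain i :: nat where "g s = A" "x = A [^]\<^bsub>Cyc N\<^esub> i" by (auto simp: A_def)
    then have "g s \<otimes>\<^bsub>Cyc N\<^esub> x = A [^]\<^bsub>Cyc N\<^esub> Suc i" using C.nat_pow_Suc2[OF A, of i] by simp
    then show "\<exists>i::nat. g s \<otimes>\<^bsub>Cyc N\<^esub> x = A [^]\<^bsub>Cyc N\<^esub> i" by blast
  qed
  have pow_h: "h (A [^]\<^bsub>Cyc N\<^esub> (i::nat)) = z [^] i" for i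
    using A by (simp add: h.hom_nat_pow hA)
  show thesis
  proof (rule that[OF h])
    have "x = \<one>\<^bsub>Cyc N\<^esub>" if x: "x \<in> carrier (Cyc N)" "h x = \<one>" for x
    proof -
      obtain i :: nat where i: "x = A [^]\<^bsub>Cyc N\<^esub> i" using nf[OF x(1)] by blast
      then have "N dvd i" using x(2) pow_eq_id[OF z] N by (simp add: pow_h)
      then obtain k where "i = N * k" by blast
      then have "x = (A [^]\<^bsub>Cyc N\<^esub> N) [^]\<^bsub>Cyc N\<^esub> k" using i A by (simp add: C.nat_pow_pow)
      then show ?thesis by (simp add: AN)
    qed
    then show "inj_on h (carrier (Cyc N))" using h.inj_on_one_iff by blast
    have sub: "subgroup (h ` carrier (Cyc N)) G" by (rule h.img_is_subgroup)
    show "h ` carrier (Cyc N) = generate G {z}"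
    proof
      show "h ` carrier (Cyc N) \<subseteq> generate G {z}"
      proof
        fix u assume "u \<in> h ` carrier (Cyc N)"
        then obtain i :: nat where "u = z [^] i" using nf pow_h by blast
        then show "u \<in> generate G {z}"
          using subgroup_nat_pow[OF generate_is_subgroup[of "{z}"], of z i] z
          by (simp add: generate.incl)
      qed
      show "generate G {z} \<subseteq> h ` carrier (Cyc N)"
        using A hA by (intro generate_subgroup_incl[OF _ sub]) blast
    qed
  qed
qed

end

section \<open>Decomposition of the center\<close>

context group
begin

lemma set_mult_left_incl: "subgroup B G \<Longrightarrow> A \<subseteq> carrier G \<Longrightarrow> A \<subseteq> A <#> B"
  unfolding set_mult_def using subgroup.one_closed[of B G] by force

lemma set_mult_right_incl: "subgroup A G \<Longrightarrow> B \<subseteq> carrier G \<Longrightarrow> B \<subseteq> A <#> B"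
  unfolding set_mult_def using subgroup.one_closed[of A G] by force

lemma integer_mod_group_generate:
  assumes x: "x \<in> carrier G" and N: "ord x = N" "N > 0"
  defines "h \<equiv> \<lambda>i::int. x [^] i"
  shows "h \<in> hom (integer_mod_group N) G" "inj_on h (carrier (integer_mod_group N))"
    "h ` carrier (integer_mod_group N) = generate G {x}"
proof -
  \<comment> \<open>The operation of \<open>integer_mod_group N\<close> reduces modulo
    \<open>N\<close>, so powers of \<open>x\<close> must be insensitive to this reduction.\<close>
  have mod: "x [^] (i mod int N) = x [^] i" for i :: int
  proof -
    have "x [^] (int N * (i div int N)) = \<one>"
      using x N int_pow_eq_id[OF x] by simp
    then have "x [^] (int N * (i div int N) + i mod int N) = x [^] (i mod int N)"
      using x by (simp only: int_pow_mult) simp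
    then show ?thesis by simp
  qed
  show "h \<in> hom (integer_mod_group N) G"
    using x by (auto simp: hom_def h_def mod int_pow_mult)
  show "inj_on h (carrier (integer_mod_group N))"
  proof (rule inj_onI)
    fix i j assume ij: "i \<in> carrier (integer_mod_group N)" "j \<in> carrier (integer_mod_group N)" "h i = h j"
    then have "x [^] (i - j) = \<one>" using x by (simp add: h_def int_pow_diff)
    then have "int N dvd i - j" using int_pow_eq_id[OF x] N by simp
    then have "i mod int N = j mod int N" by (simp add: mod_eq_dvd_iff)
    then show "i = j" using ij N by (simp add: carrier_integer_mod_group)
  qed
  show "h ` carrier (integer_mod_group N) = generate G {x}"
  proof (intro equalityI subsetI)
    fix y assume "y \<in> generate G {x}"
    then obtain i :: int where "y = x [^] i" using generate_singleton[OF x] by blast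
    then have "y = h (i mod int N)" by (simp add: h_def mod)
    moreover have "i mod int N \<in> carrier (integer_mod_group N)"
      using N by (simp add: carrier_integer_mod_group)
    ultimately show "y \<in> h ` carrier (integer_mod_group N)" by blast
  qed (auto simp: h_def generate_singleton[OF x])
qed

lemma generate_iso_integer_mod_group:
  assumes "x \<in> carrier G" "ord x = N" "N > 0"
  shows "G\<lparr>carrier := generate G {x}\<rparr> \<cong> integer_mod_group N"
proof -
  have "(\<lambda>i::int. x [^] i) \<in> iso (integer_mod_group N) (G\<lparr>carrier := generate G {x}\<rparr>)"
    using integer_mod_group_generate[OF assms] unfolding iso_def bij_betw_def hom_def by auto
  then have "integer_mod_group N \<cong> G\<lparr>carrier := generate G {x}\<rparr>" by (auto simp: is_iso_def)
  then show ?thesis by (rule group.iso_sym[rotated]) simp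
qed

text \<open>Obtained from \<open>commuting_homs\<close> with cyclic groups of order 2 as factors.
  The last two conclusions characterize \<open>W\<close> as the subgroup generated by the
  involutions, so its construction as an image can be forgotten.\<close>

lemma involutions_iso:
  assumes w: "\<And>i. i < s \<Longrightarrow> w i \<in> carrier G" "\<And>i. i < s \<Longrightarrow> ord (w i) = 2"
    and comm: "\<And>i j. i < s \<Longrightarrow> j < s \<Longrightarrow> w i \<otimes> w j = w j \<otimes> w i"
    and indep: "\<And>i. i < s \<Longrightarrow> generate G {w i} \<inter> generate G (w ` ({..<s} - {i})) \<subseteq> {\<one>}"
  obtains W where "subgroup W G" "G\<lparr>carrier := W\<rparr> \<cong> Z2_power s" "\<And>i. i < s \<Longrightarrow> w i \<in> W"
    "\<And>H. subgroup H G \<Longrightarrow> w ` {..<s} \<subseteq> H \<Longrightarrow> W \<subseteq> H"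
proof -
  let ?h = "\<lambda>i (e::int). w i [^] e"
  note h = integer_mod_group_generate[OF w(1,2)]
  interpret C: commuting_homs G s "\<lambda>_. integer_mod_group 2" ?h
  proof (intro commuting_homs.intro commuting_homs_axioms.intro is_group)
    fix i assume i: "i < s"
    show "?h i \<in> hom (integer_mod_group 2) G" "inj_on (?h i) (carrier (integer_mod_group 2))"
      using h(1,2)[OF i i] by simp_all
  next
    fix i j and x y :: int assume i: "i < s" "j < s"
    have "w j [^] y \<otimes> w i = w i \<otimes> w j [^] y"
      using i w(1) comm[of j i] by (intro commute_int_pow) auto
    then show "w i [^] x \<otimes> w j [^] y = w j [^] y \<otimes> w i [^] x"
      using i w(1) by (intro commute_int_pow) auto
  qed simp_all
  define W where "W = C.prod_map ` carrier C.PF"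
  show thesis
  proof (rule that)
    show "subgroup W G" unfolding W_def by (rule C.subgroup_prod_image)
    show "G\<lparr>carrier := W\<rparr> \<cong> Z2_power s"
      unfolding W_def Z2_power_def
    proof (rule C.product_iso_image)
      fix f i assume f: "f \<in> carrier C.PF" "C.prod_map f = \<one>" and i: "i < s"
      have wH: "w ` ({..<s} - {i}) \<subseteq> carrier G" using w(1) by auto
      \<comment> \<open>Solving a trivial product for its \<open>i\<close>-th factor puts this
        factor into the span of the other involutions, where \<open>indep\<close> applies.\<close>
      have "w i [^] f i \<in> generate G (w ` ({..<s} - {i}))"
      proof (rule ordered_prod_factor_in_subgroup[where u = "\<lambda>i. w i [^] f i" and n = s])
        show "subgroup (generate G (w ` ({..<s} - {i}))) G" by (rule generate_is_subgroup[OF wH])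
        then show "ordered_prod (\<lambda>i. w i [^] f i) s \<in> generate G (w ` ({..<s} - {i}))"
          using f(2) by (simp add: C.prod_map_def generate.one)
        show "w j [^] f j \<in> generate G (w ` ({..<s} - {i}))" if "j < s" "j \<noteq> i" for j
          using that by (intro subgroup_int_pow[OF generate_is_subgroup[OF wH]] generate.incl) auto
      qed (use w(1) i in auto)
      moreover have "w i [^] f i \<in> generate G {w i}"
        using generate_singleton[OF w(1)[OF i]] by blast
      ultimately show "w i [^] f i = \<one>" using indep[OF i] by blast
    qed
    show "w i \<in> W" if "i < s" for i
      using C.factor_in_prod_image[OF that, of 1] w(1)[OF that] by (simp add: W_def)
    show "W \<subseteq> H" if H: "subgroup H G" "w ` {..<s} \<subseteq> H" for H
      unfolding W_def using C.prod_map_in_subgroup[OF H(1)] H(2) subgroup_int_pow[OF H(1)] by blast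
  qed
qed

lemma internal_direct_productD:
  assumes "internal_direct_product G Hs A"
  shows "\<And>i. i < length Hs \<Longrightarrow> subgroup (Hs ! i) G"
    "\<And>i j x y. \<lbrakk>i < length Hs; j < length Hs; i \<noteq> j; x \<in> Hs ! i; y \<in> Hs ! j\<rbrakk> \<Longrightarrow> x \<otimes> y = y \<otimes> x"
    "A = generate G (\<Union>i<length Hs. Hs ! i)"
    "\<And>i. i < length Hs \<Longrightarrow> Hs ! i \<inter> generate G (\<Union>j\<in>{..<length Hs} - {i}. Hs ! j) = {\<one>}"
  using assms unfolding internal_direct_product_def by blast+

text \<open>The list of cyclic factors is condensed into three parts, with \<open>W\<close>
  collecting all generators from \<open>z 3\<close> on. Later arguments only use existence and
  independence of the coordinates in \<open>z 1\<close>, \<open>z 2\<close> and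
  \<open>W\<close>.\<close>

lemma internal_direct_product_cyclic:
  assumes idp: "internal_direct_product G (map (\<lambda>i. generate G {z i}) [1..<r + 1]) A"
    and r: "2 \<le> r" and z: "\<And>i. i \<in> {1..r} \<Longrightarrow> z i \<in> carrier G" "\<And>i. i \<in> {3..r} \<Longrightarrow> ord (z i) = 2"
  obtains W where "subgroup W G" "W \<subseteq> A" "G\<lparr>carrier := W\<rparr> \<cong> Z2_power (r - 2)"
    "\<And>x. x \<in> A \<Longrightarrow> \<exists>(i::int) (j::int). \<exists>w\<in>W. x = z 1 [^] i \<otimes> (z 2 [^] j \<otimes> w)"
    "\<And>(i::int) (j::int) w. w \<in> W \<Longrightarrow> z 1 [^] i \<otimes> (z 2 [^] j \<otimes> w) = \<one> \<Longrightarrow>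
       z 1 [^] i = \<one> \<and> z 2 [^] j = \<one> \<and> w = \<one>"
proof -
  define Hs where "Hs = map (\<lambda>i. generate G {z i}) [1..<r + 1]"
  have len: "length Hs = r" by (simp add: Hs_def)
  have nth: "Hs ! i = generate G {z (Suc i)}" if "i < r" for i
    using that by (simp add: Hs_def del: upt_Suc)
  note D = internal_direct_productD[OF idp[folded Hs_def], unfolded len]
  have zc: "z (Suc i) \<in> carrier G" if "i < r" for i using that z(1) by simp
  have zH: "z (Suc i) \<in> Hs ! i" if "i < r" for i
    using that by (simp add: nth generate.incl)
  have U: "(\<Union>j\<in>J. Hs ! j) \<subseteq> carrier G" if "J \<subseteq> {..<r}" for J
    using that subgroup.subset[OF D(1)] by blast
  \<comment> \<open>List positions start at 0 and the generators at \<open>z 1\<close>, so the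
    involution \<open>z (i + 3)\<close> generates the entry at position
    \<open>i + 2\<close>.\<close>
  define w where "w i = z (i + 3)" for i
  have wH: "w i \<in> Hs ! (i + 2)" if "i < r - 2" for i
    using zH[of "i + 2"] that by (simp add: w_def eval_nat_numeral)
  have gen_w: "generate G {w i} = Hs ! (i + 2)" if "i < r - 2" for i
    using nth[of "i + 2"] that by (simp add: w_def eval_nat_numeral)
  obtain W where W: "subgroup W G" "G\<lparr>carrier := W\<rparr> \<cong> Z2_power (r - 2)" "\<And>i. i < r - 2 \<Longrightarrow> w i \<in> W"
    "\<And>H. subgroup H G \<Longrightarrow> w ` {..<r - 2} \<subseteq> H \<Longrightarrow> W \<subseteq> H"
  proof (rule involutions_iso[of "r - 2" w])
    fix i assume i: "i < r - 2"
    show "w i \<in> carrier G" "ord (w i) = 2" using i z by (simp_all add: w_def)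
    show "w i \<otimes> w j = w j \<otimes> w i" if "j < r - 2" for j
    proof (cases "i = j")
      case False
      then show ?thesis
        using i that by (intro D(2)[OF _ _ _ wH[OF i] wH[OF that]]) auto
    qed simp
    have "w ` ({..<r - 2} - {i}) \<subseteq> (\<Union>j\<in>{..<r} - {i + 2}. Hs ! j)"
    proof
      fix x assume "x \<in> w ` ({..<r - 2} - {i})"
      then obtain j where "j < r - 2" "j \<noteq> i" "x = w j" by blast
      then show "x \<in> (\<Union>j\<in>{..<r} - {i + 2}. Hs ! j)"
        using wH[of j] by (intro UN_I[of "j + 2"]) auto
    qed
    from mono_generate[OF this]
    show "generate G {w i} \<inter> generate G (w ` ({..<r - 2} - {i})) \<subseteq> {\<one>}"
      using D(4)[of "i + 2"] less_diff_conv[THEN iffD1, OF i] unfolding gen_w[OF i] by blast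
  qed blast
  \<comment> \<open>Taking for \<open>J\<close> the complement of position 0 or of position 1 will
    give access to the intersection conditions of the direct product.\<close>
  have W_gen: "W \<subseteq> generate G (\<Union>j\<in>J. Hs ! j)" if "{2..<r} \<subseteq> J" "J \<subseteq> {..<r}" for J
  proof (rule W(4))
    show "subgroup (generate G (\<Union>j\<in>J. Hs ! j)) G" by (rule generate_is_subgroup[OF U[OF that(2)]])
    have "w i \<in> generate G (\<Union>j\<in>J. Hs ! j)" if "i < r - 2" for i
      using that wH[OF that] \<open>{2..<r} \<subseteq> J\<close> by (intro generate.incl UN_I[of "i + 2"]) auto
    then show "w ` {..<r - 2} \<subseteq> generate G (\<Union>j\<in>J. Hs ! j)" by blast
  qed
  have H1: "z 1 [^] i \<in> Hs ! 0" "z 2 [^] i \<in> Hs ! 1" for i :: int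
    using subgroup_int_pow[OF D(1) zH, of 0] subgroup_int_pow[OF D(1) zH, of 1] r
    by (simp_all add: numeral_2_eq_2)
  have W_comm: "x \<otimes> y = y \<otimes> x" if x: "x \<in> W" and y: "y \<in> Hs ! k" "k < 2" for x y k
  proof -
    have "y \<in> carrier G" using U[of "{k}"] y r by auto
    have "w i \<in> centralizer G {y}" if i: "i < r - 2" for i
    proof -
      have "w i \<otimes> y = y \<otimes> w i" using i y(2) by (intro D(2)[OF _ _ _ wH[OF i] y(1)]) auto
      then show ?thesis using i z(1) by (simp add: centralizer_def w_def)
    qed
    then have "W \<subseteq> centralizer G {y}"
      using \<open>y \<in> carrier G\<close> by (intro W(4) subgroup_centralizer) auto
    then show ?thesis using x by (auto simp: centralizer_def)
  qed
  have sub: "subgroup (Hs ! 0) G" "subgroup (Hs ! 1) G" using D(1) r by auto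
  have sub1: "subgroup (Hs ! 1 <#> W) G"
    using W_comm[of _ _ 1] by (intro subgroup_commuting_product[OF sub(2) W(1)]) simp
  have sub0: "subgroup (Hs ! 0 <#> (Hs ! 1 <#> W)) G"
  proof (rule subgroup_commuting_product[OF sub(1) sub1])
    fix a b assume a: "a \<in> Hs ! 0" and "b \<in> Hs ! 1 <#> W"
    then obtain y x where b: "b = y \<otimes> x" "y \<in> Hs ! 1" "x \<in> W" unfolding set_mult_def by blast
    show "a \<otimes> b = b \<otimes> a"
      unfolding b(1)
    proof (rule commute_mult[symmetric])
      show "y \<in> carrier G" "x \<in> carrier G" "a \<in> carrier G"
        by (rule subgroup.mem_carrier[OF sub(2) b(2)], rule subgroup.mem_carrier[OF W(1) b(3)],
            rule subgroup.mem_carrier[OF sub(1) a])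
      show "y \<otimes> a = a \<otimes> y" using r by (intro D(2)[OF _ _ _ b(2) a]) auto
      show "x \<otimes> a = a \<otimes> x" by (rule W_comm[OF b(3) a]) simp
    qed
  qed
  have incl: "Hs ! 0 \<subseteq> Hs ! 0 <#> (Hs ! 1 <#> W)" "Hs ! 1 \<subseteq> Hs ! 0 <#> (Hs ! 1 <#> W)"
    "W \<subseteq> Hs ! 0 <#> (Hs ! 1 <#> W)"
    using set_mult_left_incl[OF sub1 subgroup.subset[OF sub(1)]]
      set_mult_right_incl[OF sub(1) subgroup.subset[OF sub1]]
      set_mult_left_incl[OF W(1) subgroup.subset[OF sub(2)]]
      set_mult_right_incl[OF sub(2) subgroup.subset[OF W(1)]] by blast+
  have "A \<subseteq> Hs ! 0 <#> (Hs ! 1 <#> W)"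
    unfolding D(3)
  proof (rule generate_subgroup_incl[OF _ sub0])
    have "Hs ! i \<subseteq> Hs ! 0 <#> (Hs ! 1 <#> W)" if i: "i < r" for i
    proof (cases "i < 2")
      case True
      then have "i = 0 \<or> i = 1" by auto
      then show ?thesis using incl by auto
    next
      case False
      then obtain j where j: "i = j + 2" "j < r - 2" using i by (intro that[of "i - 2"]) auto
      have "generate G {w j} \<subseteq> W"
        using W(3)[OF j(2)] by (intro generate_subgroup_incl[OF _ W(1)]) simp
      then show ?thesis using incl(3) gen_w[OF j(2)] j(1) by simp
    qed
    then show "(\<Union>i<r. Hs ! i) \<subseteq> Hs ! 0 <#> (Hs ! 1 <#> W)" by blast
  qed
  note A_sub = this
  show thesis
  proof (rule that[OF W(1) _ W(2)])
    show "W \<subseteq> A" unfolding D(3) by (rule W_gen) auto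
    show "\<exists>(i::int) (j::int). \<exists>w\<in>W. x = z 1 [^] i \<otimes> (z 2 [^] j \<otimes> w)" if "x \<in> A" for x
    proof -
      have "x \<in> Hs ! 0 <#> (Hs ! 1 <#> W)" using that A_sub by blast
      then obtain a b w where abw: "x = a \<otimes> (b \<otimes> w)" "a \<in> Hs ! 0" "b \<in> Hs ! 1" "w \<in> W"
        unfolding set_mult_def by blast
      have "Hs ! 0 = range (\<lambda>i::int. z 1 [^] i)" "Hs ! 1 = range (\<lambda>i::int. z 2 [^] i)"
        using nth[of 0] nth[of 1] r generate_singleton[OF z(1)[of 1]] generate_singleton[OF z(1)[of 2]]
        by (simp_all add: numeral_2_eq_2)
      then obtain i j :: int where "a = z 1 [^] i" "b = z 2 [^] j" using abw(2,3) by auto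
      then show ?thesis using abw(1,4) by blast
    qed
    fix i j :: int and w assume w: "w \<in> W" "z 1 [^] i \<otimes> (z 2 [^] j \<otimes> w) = \<one>"
    have car: "z 1 \<in> carrier G" "z 2 \<in> carrier G" "w \<in> carrier G"
      using z(1) r w subgroup.mem_carrier[OF W(1)] by auto
    \<comment> \<open>In a trivial product, all but one factor lie in the span \<open>?K\<close> of
      the other positions, hence so does the remaining one, and the intersection condition makes it
      trivial. This removes \<open>z 1\<close> and then \<open>z 2\<close>.\<close>
    let ?K = "\<lambda>k. generate G (\<Union>j\<in>{..<r} - {k}. Hs ! j)"
    have K: "subgroup (?K k) G" for k by (rule generate_is_subgroup[OF U]) blast
    have "z 2 [^] j \<in> ?K 0"
      using H1(2)[of j] r by (intro generate.incl UN_I[of 1]) auto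
    moreover have "W \<subseteq> ?K 0" by (rule W_gen) auto
    ultimately have "z 2 [^] j \<otimes> w \<in> ?K 0"
      using w(1) by (blast intro: subgroup.m_closed[OF K])
    then have "z 1 [^] i \<in> ?K 0"
      using subgroup_mult_right_iff[OF K, of "z 2 [^] j \<otimes> w" 0 "z 1 [^] i"] car w(2)
        subgroup.one_closed[OF K, of 0] by simp
    then have one: "z 1 [^] i = \<one>" using D(4)[of 0] H1(1)[of i] r by auto
    then have w': "z 2 [^] j \<otimes> w = \<one>" using w(2) car by simp
    have "W \<subseteq> ?K 1" by (rule W_gen) auto
    then have "z 2 [^] j \<in> ?K 1"
      using w(1) subgroup_mult_right_iff[OF K, of w 1 "z 2 [^] j"] car w' subgroup.one_closed[OF K, of 1] by auto
    then have "z 2 [^] j = \<one>" using D(4)[of 1] H1(2)[of j] r by auto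
    then show "z 1 [^] i = \<one> \<and> z 2 [^] j = \<one> \<and> w = \<one>" using one w' car by simp
  qed
qed

lemma internal_direct_product_two:
  assumes "internal_direct_product G [A, B] N" "x \<in> N"
  obtains a b where "a \<in> A" "b \<in> B" "x = a \<otimes> b"
proof -
  note D = internal_direct_productD[OF assms(1)]
  have AB: "subgroup A G" "subgroup B G" using D(1)[of 0] D(1)[of 1] by simp_all
  have sub: "subgroup (A <#> B) G"
    using D(2)[of 0 1] by (intro subgroup_commuting_product[OF AB]) simp
  have "(\<Union>i<length [A, B]. [A, B] ! i) = A \<union> B" by (auto simp: less_Suc_eq)
  then have "N \<subseteq> A <#> B"
    unfolding D(3) using set_mult_left_incl[OF AB(2) subgroup.subset[OF AB(1)]]
      set_mult_right_incl[OF AB(1) subgroup.subset[OF AB(2)]]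
    by (intro generate_subgroup_incl[OF _ sub]) simp
  then show thesis using assms(2) that unfolding set_mult_def by blast
qed

end

section \<open>Hyperbolic systems\<close>

context central_involution
begin

text \<open>Each of the two exchanges contributes a \<open>c\<close>, and these cancel: additivity
  of the commutator form in the case 1 + 1 = 0.\<close>

lemma anticommute_mult:
  assumes "u \<in> carrier G" "v \<in> carrier G" "g \<in> carrier G"
    and "u \<otimes> g = c \<otimes> (g \<otimes> u)" "v \<otimes> g = c \<otimes> (g \<otimes> v)"
  shows "(u \<otimes> v) \<otimes> g = g \<otimes> (u \<otimes> v)"
proof -
  have "(u \<otimes> v) \<otimes> g = u \<otimes> (v \<otimes> g)" using assms(1-3) by (simp add: m_assoc)
  also have "\<dots> = c \<otimes> ((u \<otimes> g) \<otimes> v)"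
    unfolding assms(5) using assms(1-3) by (simp add: m_assoc c_left_commute)
  also have "\<dots> = g \<otimes> (u \<otimes> v)"
    unfolding assms(4) using assms(1-3) by (simp add: m_assoc c_cancel)
  finally show ?thesis .
qed

lemma c_mult_c_mult:
  assumes "u \<in> carrier G" "v \<in> carrier G"
  shows "(c \<otimes> u) \<otimes> (c \<otimes> v) = u \<otimes> v"
proof -
  have "(c \<otimes> u) \<otimes> (c \<otimes> v) = c \<otimes> (u \<otimes> (c \<otimes> v))" using assms by (simp add: m_assoc)
  also have "\<dots> = u \<otimes> v" using assms c_left_commute[of u v] by (simp add: c_cancel)
  finally show ?thesis .
qed

lemma anticommute_not_commute:
  assumes "u \<in> carrier G" "v \<in> carrier G" "u \<otimes> v = c \<otimes> (v \<otimes> u)"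
  shows "u \<otimes> v \<noteq> v \<otimes> u"
  using assms c_neq_one by auto

text \<open>These are representatives in \<open>G\<close> of mutually orthogonal hyperbolic pairs of
  the symplectic space; \<open>x i\<close> and \<open>y i\<close> having commutator \<open>c\<close>
  means that the form has value 1.\<close>

definition hyperbolic :: "nat \<Rightarrow> (nat \<Rightarrow> 'a) \<Rightarrow> (nat \<Rightarrow> 'a) \<Rightarrow> bool" where
  "hyperbolic k x y \<longleftrightarrow>
     (\<forall>i<k. x i \<in> carrier G \<and> y i \<in> carrier G \<and> x i \<otimes> y i = c \<otimes> (y i \<otimes> x i)) \<and>
     (\<forall>i<k. \<forall>j<k. i \<noteq> j \<longrightarrow> (\<forall>u\<in>{x i, y i}. \<forall>v\<in>{x j, y j}. u \<otimes> v = v \<otimes> u))"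

definition pairs :: "nat \<Rightarrow> (nat \<Rightarrow> 'a) \<Rightarrow> (nat \<Rightarrow> 'a) \<Rightarrow> 'a set" where
  "pairs k x y = x ` {..<k} \<union> y ` {..<k}"

lemma hyperbolicD:
  assumes "hyperbolic k x y" "i < k"
  shows "x i \<in> carrier G" "y i \<in> carrier G" "x i \<otimes> y i = c \<otimes> (y i \<otimes> x i)"
    "y i \<otimes> x i = c \<otimes> (x i \<otimes> y i)"
  using assms anticommute_sym unfolding hyperbolic_def by blast+

lemma hyperbolic_commute:
  assumes "hyperbolic k x y" "i < k" "j < k" "i \<noteq> j" "u \<in> {x i, y i}" "v \<in> {x j, y j}"
  shows "u \<otimes> v = v \<otimes> u"
  using assms unfolding hyperbolic_def by blast

lemma pairs_closed: "hyperbolic k x y \<Longrightarrow> pairs k x y \<subseteq> carrier G"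
  using hyperbolicD by (auto simp: pairs_def)

text \<open>The new pair takes index 0 and the old ones are shifted. An exceptional pair added last
  thus comes first, where the list of factors has \<open>M2\<close>.\<close>

lemma hyperbolic_extend:
  assumes h: "hyperbolic k x y" and ab: "a \<in> centralizer G (pairs k x y)" "b \<in> centralizer G (pairs k x y)"
    and anti: "a \<otimes> b = c \<otimes> (b \<otimes> a)"
  shows "hyperbolic (Suc k) (case_nat a x) (case_nat b y)"
proof -
  have car: "a \<in> carrier G" "b \<in> carrier G" using ab by (auto simp: centralizer_def)
  have comm: "u \<otimes> v = v \<otimes> u" if "u \<in> {a, b}" "i < k" "v \<in> {x i, y i}" for u v i
    using that ab by (auto simp: centralizer_def pairs_def)
  show ?thesis
    unfolding hyperbolic_def
  proof (intro conjI allI impI ballI)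
    fix i j u v assume ij: "i < Suc k" "j < Suc k" "i \<noteq> j"
      "u \<in> {case_nat a x i, case_nat b y i}" "v \<in> {case_nat a x j, case_nat b y j}"
    consider j' where "i = 0" "j = Suc j'" "j' < k" | i' where "j = 0" "i = Suc i'" "i' < k"
      | i' j' where "i = Suc i'" "j = Suc j'" "i' < k" "j' < k"
      using ij(1-3) by (cases i; cases j) auto
    then show "u \<otimes> v = v \<otimes> u"
    proof cases
      case (1 j')
      then show ?thesis using ij(4,5) by (intro comm[of u j' v]) auto
    next
      case (2 i')
      then show ?thesis using ij(4,5) by (intro comm[of v i' u, symmetric]) auto
    next
      case (3 i' j')
      then show ?thesis using ij(3-5) by (intro hyperbolic_commute[OF h 3(3,4)]) auto
    qed
  qed (use hyperbolicD[OF h] car anti in \<open>auto simp: less_Suc_eq_0_disj\<close>)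
qed

lemma pairs_extend: "pairs (Suc k) (case_nat a x) (case_nat b y) = pairs k x y \<union> {a, b}"
  by (auto simp: pairs_def lessThan_Suc_eq_insert_0 image_image)

text \<open>The \<open>x i\<close> are distinct: \<open>x j\<close> commutes with \<open>y i\<close>
  for \<open>j\<close> different from \<open>i\<close>, but \<open>x i\<close> does not. The bound
  is what allows choosing a system of maximal length.\<close>

lemma hyperbolic_bound:
  assumes "finite (carrier G)" "hyperbolic k x y"
  shows "k \<le> card (carrier G)"
proof -
  have "inj_on x {..<k}"
  proof (rule inj_onI, rule ccontr)
    fix i j assume ij: "i \<in> {..<k}" "j \<in> {..<k}" "x i = x j" "i \<noteq> j"
    then have "x j \<otimes> y i = y i \<otimes> x j"
      using hyperbolic_commute[OF assms(2), of j i "x j" "y i"] by auto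
    then show False
      using anticommute_not_commute[OF hyperbolicD(1-3)[OF assms(2), of i]] ij by simp
  qed
  then have "card (x ` {..<k}) = k" by (simp add: card_image)
  moreover have "x ` {..<k} \<subseteq> carrier G" using hyperbolicD(1)[OF assms(2)] by auto
  ultimately show ?thesis using card_mono[OF assms(1)] by metis
qed

end

section \<open>Orthogonal projection and complements\<close>

locale two_step = central_involution +
  assumes commutator: "\<lbrakk>u \<in> carrier G; v \<in> carrier G\<rbrakk> \<Longrightarrow> u \<otimes> v = v \<otimes> u \<or> u \<otimes> v = c \<otimes> (v \<otimes> u)"
begin

text \<open>Multiplication by \<open>p\<close> is the orthogonal projection onto the complement of a hyperbolic system.\<close>

lemma hyperbolic_project:
  assumes h: "hyperbolic k x y" and H: "subgroup H G" "pairs k x y \<subseteq> H" and g: "g \<in> carrier G"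
  shows "\<exists>p\<in>H. p \<otimes> g \<in> centralizer G (pairs k x y)"
proof -
  have "\<exists>p\<in>H. \<forall>i<j. \<forall>v\<in>{x i, y i}. (p \<otimes> g) \<otimes> v = v \<otimes> (p \<otimes> g)" if "j \<le> k" for j
    using that
  proof (induction j)
    case 0
    then show ?case using subgroup.one_closed[OF H(1)] by auto
  next
    case (Suc j)
    then obtain p where p: "p \<in> H" "\<forall>i<j. \<forall>v\<in>{x i, y i}. (p \<otimes> g) \<otimes> v = v \<otimes> (p \<otimes> g)" by auto
    have j: "j < k" using Suc.prems by simp
    note xy = hyperbolicD[OF h j]
    have pc: "p \<in> carrier G" using p(1) subgroup.mem_carrier[OF H(1)] by blast
    define q where "q = p \<otimes> g"
    have q: "q \<in> carrier G" using pc g by (simp add: q_def)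
    \<comment> \<open>If \<open>q\<close> fails to commute with \<open>x j\<close>, the factor
      \<open>y j\<close> repairs this; afterwards \<open>x j\<close> repairs a failure with
      \<open>y j\<close> and does not disturb commutation with \<open>x j\<close> itself. Earlier
      pairs are orthogonal to both corrections.\<close>
    define e where "e = (if q \<otimes> x j = x j \<otimes> q then \<one> else y j)"
    define q1 where "q1 = e \<otimes> q"
    define f where "f = (if q1 \<otimes> y j = y j \<otimes> q1 then \<one> else x j)"
    have e: "e \<in> carrier G" "e \<otimes> y j = y j \<otimes> e" "e \<in> H" "e \<in> {\<one>, y j}"
      using xy(1,2) H(2) j subgroup.one_closed[OF H(1)] by (auto simp: e_def pairs_def)
    have f: "f \<in> carrier G" "f \<otimes> x j = x j \<otimes> f" "f \<in> H" "f \<in> {\<one>, x j}"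
      using xy(1,2) H(2) j subgroup.one_closed[OF H(1)] by (auto simp: f_def pairs_def)
    have q1: "q1 \<in> carrier G" using q e by (simp add: q1_def)
    have q1x: "q1 \<otimes> x j = x j \<otimes> q1"
    proof (cases "q \<otimes> x j = x j \<otimes> q")
      case True
      then show ?thesis using q by (simp add: q1_def e_def)
    next
      case False
      then have "q \<otimes> x j = c \<otimes> (x j \<otimes> q)" using commutator[OF q xy(1)] by blast
      then have "(y j \<otimes> q) \<otimes> x j = x j \<otimes> (y j \<otimes> q)"
        by (rule anticommute_mult[OF xy(2) q xy(1) xy(4)])
      then show ?thesis using False by (simp add: q1_def e_def)
    qed
    have "(f \<otimes> q1) \<otimes> x j = x j \<otimes> (f \<otimes> q1)"
      by (rule commute_mult[OF f(1) q1 xy(1) f(2) q1x])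
    moreover have "(f \<otimes> q1) \<otimes> y j = y j \<otimes> (f \<otimes> q1)"
    proof (cases "q1 \<otimes> y j = y j \<otimes> q1")
      case True
      then show ?thesis using q1 by (simp add: f_def)
    next
      case False
      then have "q1 \<otimes> y j = c \<otimes> (y j \<otimes> q1)" using commutator[OF q1 xy(2)] by blast
      then have "(x j \<otimes> q1) \<otimes> y j = y j \<otimes> (x j \<otimes> q1)"
        by (rule anticommute_mult[OF xy(1) q1 xy(2) xy(3)])
      then show ?thesis using False by (simp add: f_def)
    qed
    moreover have "(f \<otimes> q1) \<otimes> v = v \<otimes> (f \<otimes> q1)" if v: "i < j" "v \<in> {x i, y i}" for i v
    proof -
      have vc: "v \<in> carrier G" using v j hyperbolicD[OF h, of i] by auto
      have "e \<otimes> v = v \<otimes> e" "f \<otimes> v = v \<otimes> f"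
        using e(4) f(4) vc hyperbolic_commute[OF h j, of i _ v] v j by auto
      moreover have "q \<otimes> v = v \<otimes> q" using p(2) v unfolding q_def by blast
      ultimately show ?thesis
        unfolding q1_def by (blast intro: commute_mult m_closed e(1) f(1) q vc)
    qed
    ultimately have "(f \<otimes> q1) \<otimes> v = v \<otimes> (f \<otimes> q1)" if "i < Suc j" "v \<in> {x i, y i}" for i v
      using that less_Suc_eq[of i j] by blast
    moreover have "f \<otimes> q1 = (f \<otimes> (e \<otimes> p)) \<otimes> g"
      using e f pc g by (simp add: q1_def q_def m_assoc)
    moreover have "f \<otimes> (e \<otimes> p) \<in> H"
      using e f p(1) subgroup.m_closed[OF H(1)] by simp
    ultimately show ?case
      by metis
  qed
  from this[of k] obtain p where p: "p \<in> H" "\<forall>i<k. \<forall>v\<in>{x i, y i}. (p \<otimes> g) \<otimes> v = v \<otimes> (p \<otimes> g)" by blast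
  then have "p \<otimes> g \<in> centralizer G (pairs k x y)"
    using subgroup.mem_carrier[OF H(1)] g by (auto simp: centralizer_def pairs_def)
  then show ?thesis using p(1) by blast
qed

text \<open>By projection, each \<open>g\<close> becomes an element of the centralizer after
  multiplication by some \<open>p\<close> in \<open>H\<close>; both lie in \<open>H\<close>, so
  \<open>g\<close> does. This is the decomposition of the space into the span of the pairs and its
  orthogonal complement.\<close>

lemma hyperbolic_span:
  assumes "hyperbolic k x y" "subgroup H G" "pairs k x y \<subseteq> H" "centralizer G (pairs k x y) \<subseteq> H"
  shows "H = carrier G"
proof
  show "carrier G \<subseteq> H"
  proof
    fix g assume g: "g \<in> carrier G"
    obtain p where "p \<in> H" "p \<otimes> g \<in> H" using hyperbolic_project[OF assms(1-3) g] assms(4) by blast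
    then show "g \<in> H" using subgroup_mult_left_iff[OF assms(2) _ g] by blast
  qed
qed (rule subgroup.subset[OF assms(2)])

text \<open>The centralizer of \<open>g\<close> contains the pairs as well as, by \<open>C\<close>,
  everything orthogonal to them, so \<open>hyperbolic_span\<close> makes it the whole group.\<close>

lemma centralizer_pairs_central:
  assumes h: "hyperbolic k x y" and g: "g \<in> centralizer G (pairs k x y)"
    and C: "\<And>u. u \<in> centralizer G (pairs k x y) \<Longrightarrow> g \<otimes> u = u \<otimes> g"
  shows "g \<in> center G"
proof -
  have gc: "g \<in> carrier G" using g by (simp add: centralizer_def)
  have "centralizer G {g} = carrier G"
  proof (rule hyperbolic_span[OF h])
    show "subgroup (centralizer G {g}) G" using gc by (simp add: subgroup_centralizer)
    show "pairs k x y \<subseteq> centralizer G {g}"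
      using g pairs_closed[OF h] by (auto simp: centralizer_def)
    show "centralizer G (pairs k x y) \<subseteq> centralizer G {g}"
      using C by (auto simp: centralizer_def)
  qed
  have "g \<otimes> v = v \<otimes> g" if "v \<in> carrier G" for v
  proof -
    have "v \<in> centralizer G {g}" using that \<open>centralizer G {g} = carrier G\<close> by simp
    then show ?thesis by (simp add: centralizer_def)
  qed
  then show ?thesis using gc unfolding center_def by blast
qed

end

text \<open>In the application \<open>t\<close> is \<open>z 2\<close> and \<open>s\<close> is a
  square root of \<open>c\<close> among the powers of \<open>z 1\<close>. The assumption
  \<open>squares\<close> expresses that every coset of the center has a representative with square
  \<open>\<one>\<close> or \<open>t\<close>.\<close>

locale two_step_squares = two_step +
  fixes t s
  assumes finite_carrier: "finite (carrier G)"
    and t_center: "t \<in> center G" and s_center: "s \<in> center G" and s_square: "s \<otimes> s = c"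
    and squares: "g \<in> carrier G \<Longrightarrow> \<exists>u\<in>center G. (g \<otimes> u) \<otimes> (g \<otimes> u) \<in> {\<one>, t}"
begin

text \<open>In the symplectic space \<open>G\<close> modulo its center, the good elements are the kernel of the functional
  induced by squaring.\<close>

definition good :: "'a \<Rightarrow> bool" where
  "good g \<longleftrightarrow> (\<exists>u\<in>center G. (g \<otimes> u) \<otimes> (g \<otimes> u) = \<one>)"

lemma subgroup_center: "subgroup (center G) G"
  unfolding center_eq_centralizer by (simp add: subgroup_centralizer)

lemma centerD: "u \<in> center G \<Longrightarrow> u \<in> carrier G" "u \<in> center G \<Longrightarrow> g \<in> carrier G \<Longrightarrow> u \<otimes> g = g \<otimes> u"
  by (auto simp: center_def)

lemma good_center:
  assumes "u \<in> center G"
  shows "good u"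
  unfolding good_def
  using assms subgroup.m_inv_closed[OF subgroup_center assms] centerD(1)
  by (intro bexI[of _ "inv u"]) auto

lemma centralizer_mult_center:
  assumes "A \<subseteq> carrier G" "g \<in> centralizer G A" "u \<in> center G"
  shows "g \<otimes> u \<in> centralizer G A"
proof -
  have "u \<in> centralizer G A" using assms(1,3) by (auto simp: center_def centralizer_def)
  then show ?thesis using assms(2) subgroup.m_closed[OF subgroup_centralizer[OF assms(1)]] by blast
qed

text \<open>Commutation depends only on cosets of the center, so representatives may be replaced
  freely by ones with a prescribed square.\<close>

lemma commute_mult_center_iff:
  assumes "g \<in> carrier G" "h \<in> carrier G" "u \<in> center G"
  shows "(g \<otimes> u) \<otimes> h = h \<otimes> (g \<otimes> u) \<longleftrightarrow> g \<otimes> h = h \<otimes> g"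
proof -
  have "u \<in> centralizer G {h}" using assms(2,3) by (auto simp: center_def centralizer_def)
  moreover have "subgroup (centralizer G {h}) G" using assms(2) by (simp add: subgroup_centralizer)
  ultimately have "g \<otimes> u \<in> centralizer G {h} \<longleftrightarrow> g \<in> centralizer G {h}"
    using assms(1) subgroup_mult_right_iff by blast
  then show ?thesis using assms(1) centerD(1)[OF assms(3)] by (simp add: centralizer_def)
qed

text \<open>If neither factor is good, both may be assumed to square to \<open>t\<close>, and then \<open>(a g)\<^sup>2\<close> is \<open>t\<^sup>2\<close> up to
  a factor in \<open>{\<one>, c}\<close>; since \<open>c = s\<^sup>2\<close>, this is the square of a central element.\<close>

lemma good_mult:
  assumes a: "a \<in> carrier G" "\<not> good a" and g: "g \<in> carrier G" "\<not> good g"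
  shows "good (a \<otimes> g)"
proof -
  obtain u v where u: "u \<in> center G" "(a \<otimes> u) \<otimes> (a \<otimes> u) = t" and v: "v \<in> center G" "(g \<otimes> v) \<otimes> (g \<otimes> v) = t"
    using squares[OF a(1)] squares[OF g(1)] a(2) g(2) unfolding good_def by blast
  define a' g' where "a' = a \<otimes> u" and "g' = g \<otimes> v"
  have car: "a' \<in> carrier G" "g' \<in> carrier G" "u \<in> carrier G" "v \<in> carrier G" "t \<in> carrier G" "s \<in> carrier G"
    using a g u v t_center s_center centerD(1) by (auto simp: a'_def g'_def)
  have "\<exists>w\<in>center G. (a' \<otimes> g' \<otimes> w) \<otimes> (a' \<otimes> g' \<otimes> w) = \<one>"
  proof -
    let ?d = "a' \<otimes> g'"
    have sq: "(?d \<otimes> w) \<otimes> (?d \<otimes> w) = (?d \<otimes> ?d) \<otimes> (w \<otimes> w)" if "w \<in> center G" for w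
      using that car centerD[of w] by (intro square_mult_commute) auto
    have it: "inv t \<in> center G" by (rule subgroup.m_inv_closed[OF subgroup_center t_center])
    have tt: "(a' \<otimes> a') \<otimes> (g' \<otimes> g') = t \<otimes> t" using u(2) v(2) by (simp add: a'_def g'_def)
    have tt': "(t \<otimes> t) \<otimes> (inv t \<otimes> inv t) = \<one>"
      using square_mult_commute[of t "inv t"] car by simp
    consider "a' \<otimes> g' = g' \<otimes> a'" | "a' \<otimes> g' = c \<otimes> (g' \<otimes> a')" using commutator[OF car(1,2)] by blast
    then show ?thesis
    proof cases
      case 1
      then have "?d \<otimes> ?d = t \<otimes> t" using square_mult_commute[OF car(1,2)] tt by simp
      then have "(?d \<otimes> inv t) \<otimes> (?d \<otimes> inv t) = \<one>"
        using sq[OF it] tt' by simp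
      then show ?thesis using it by blast
    next
      case 2
      have "?d \<otimes> ?d = a' \<otimes> (g' \<otimes> a') \<otimes> g'" using car by (simp add: m_assoc)
      also have "g' \<otimes> a' = c \<otimes> (a' \<otimes> g')" by (rule anticommute_sym[OF car(1,2) 2])
      also have "a' \<otimes> (c \<otimes> (a' \<otimes> g')) \<otimes> g' = c \<otimes> ((a' \<otimes> a') \<otimes> (g' \<otimes> g'))"
        using car by (simp add: m_assoc c_left_commute)
      finally have dd: "?d \<otimes> ?d = c \<otimes> (t \<otimes> t)" using tt by simp
      have w: "s \<otimes> inv t \<in> center G" by (rule subgroup.m_closed[OF subgroup_center s_center it])
      have "(s \<otimes> inv t) \<otimes> (s \<otimes> inv t) = c \<otimes> (inv t \<otimes> inv t)"
        using square_mult_commute[of s "inv t"] centerD(2)[OF s_center, of "inv t"] car s_square by simp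
      then have "(?d \<otimes> (s \<otimes> inv t)) \<otimes> (?d \<otimes> (s \<otimes> inv t)) = (c \<otimes> (t \<otimes> t)) \<otimes> (c \<otimes> (inv t \<otimes> inv t))"
        unfolding sq[OF w] dd by simp
      also have "\<dots> = (t \<otimes> t) \<otimes> (inv t \<otimes> inv t)" using car by (intro c_mult_c_mult) auto
      also have "\<dots> = \<one>" by (rule tt')
      finally show ?thesis using w by blast
    qed
  qed
  then obtain w where w: "w \<in> center G" "(a' \<otimes> g' \<otimes> w) \<otimes> (a' \<otimes> g' \<otimes> w) = \<one>" by blast
  have "a' \<otimes> g' \<otimes> w = (a \<otimes> g) \<otimes> ((u \<otimes> v) \<otimes> w)"
  proof -
    have "a' \<otimes> g' = a \<otimes> (u \<otimes> g) \<otimes> v" using a g car by (simp add: a'_def g'_def m_assoc)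
    also have "\<dots> = (a \<otimes> g) \<otimes> (u \<otimes> v)"
      unfolding centerD(2)[OF u(1) g(1)] using a g car by (simp add: m_assoc)
    finally show ?thesis using a g car centerD(1)[OF w(1)] by (simp add: m_assoc)
  qed
  moreover have "(u \<otimes> v) \<otimes> w \<in> center G"
    using u v w subgroup.m_closed[OF subgroup_center] by blast
  ultimately show ?thesis unfolding good_def using w(2) by metis
qed

text \<open>A maximal system of involutions leaves a complement \<open>C\<close> in which good
  elements commute pairwise. So the kernel of the functional on \<open>C\<close> is totally
  isotropic. If it is all of \<open>C\<close>, then \<open>C\<close> is central; otherwise it is a
  hyperplane, and together with nondegeneracy this leaves room for one more hyperbolic pair only,
  consisting of a bad \<open>a\<close> and a good \<open>b\<close>.\<close>

lemma hyperbolic_structure: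
  obtains k x y where "hyperbolic k x y" "\<And>i. i < k \<Longrightarrow> x i \<otimes> x i = \<one> \<and> y i \<otimes> y i = \<one>"
      "centralizer G (pairs k x y) \<subseteq> center G"
  | k x y where "hyperbolic (Suc k) x y"
      "\<And>i. 0 < i \<Longrightarrow> i < Suc k \<Longrightarrow> x i \<otimes> x i = \<one> \<and> y i \<otimes> y i = \<one>"
      "x 0 \<otimes> x 0 = t" "y 0 \<otimes> y 0 = \<one>" "centralizer G (pairs (Suc k) x y) \<subseteq> center G"
proof -
  define Q where "Q k \<longleftrightarrow> (\<exists>x y. hyperbolic k x y \<and> (\<forall>i<k. x i \<otimes> x i = \<one> \<and> y i \<otimes> y i = \<one>))" for k
  have "Q 0" by (simp add: Q_def hyperbolic_def)
  moreover have "\<forall>k. Q k \<longrightarrow> k < Suc (card (carrier G))"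
    using hyperbolic_bound[OF finite_carrier] by (auto simp: Q_def less_Suc_eq_le)
  ultimately have "\<exists>k. Q k \<and> (\<forall>l. Q l \<longrightarrow> l \<le> k)" by (rule ex_has_greatest_nat)
  then obtain k where "Q k" and max: "\<And>l. Q l \<Longrightarrow> l \<le> k" by blast
  then obtain x y where h: "hyperbolic k x y" and inv: "\<And>i. i < k \<Longrightarrow> x i \<otimes> x i = \<one> \<and> y i \<otimes> y i = \<one>"
    unfolding Q_def by blast
  define C where "C = centralizer G (pairs k x y)"
  have PC: "pairs k x y \<subseteq> carrier G" by (rule pairs_closed[OF h])
  have CG: "u \<in> carrier G" if "u \<in> C" for u using that by (simp add: C_def centralizer_def)
  have Csub: "subgroup C G" unfolding C_def by (rule subgroup_centralizer[OF PC])
  \<comment> \<open>Two good elements that do not commute could be corrected by central elements to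
    involutions and would extend the system, against maximality.\<close>
  have good_commute: "g \<otimes> g' = g' \<otimes> g" if g: "g \<in> C" "good g" "g' \<in> C" "good g'" for g g'
  proof (rule ccontr)
    assume nc: "g \<otimes> g' \<noteq> g' \<otimes> g"
    obtain u v where u: "u \<in> center G" "(g \<otimes> u) \<otimes> (g \<otimes> u) = \<one>" and v: "v \<in> center G" "(g' \<otimes> v) \<otimes> (g' \<otimes> v) = \<one>"
      using g(2,4) unfolding good_def by blast
    have C: "g \<otimes> u \<in> C" "g' \<otimes> v \<in> C"
      unfolding C_def using g(1,3) u(1) v(1) centralizer_mult_center[OF PC] by (auto simp: C_def)
    have "(g \<otimes> u) \<otimes> (g' \<otimes> v) \<noteq> (g' \<otimes> v) \<otimes> (g \<otimes> u)"
      using nc commute_mult_center_iff[OF CG[OF g(1)] CG[OF C(2)] u(1)]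
        commute_mult_center_iff[OF CG[OF g(3)] CG[OF g(1)] v(1)] by metis
    then have anti: "(g \<otimes> u) \<otimes> (g' \<otimes> v) = c \<otimes> ((g' \<otimes> v) \<otimes> (g \<otimes> u))"
      using commutator[OF CG[OF C(1)] CG[OF C(2)]] by blast
    have "Q (Suc k)"
      unfolding Q_def using hyperbolic_extend[OF h C[unfolded C_def] anti] inv u(2) v(2)
      by (intro exI[of _ "case_nat (g \<otimes> u) x"] exI[of _ "case_nat (g' \<otimes> v) y"])
        (auto simp: less_Suc_eq_0_disj)
    then show False using max by force
  qed
  show thesis
  proof (cases "\<forall>g\<in>C. good g")
    case True
    then have "C \<subseteq> center G"
      using centralizer_pairs_central[OF h] good_commute unfolding C_def by blast
    then show thesis using that(1)[OF h inv] by (simp add: C_def)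
  next
    case False
    then obtain a0 where a0: "a0 \<in> C" "\<not> good a0" by blast
    obtain u where u: "u \<in> center G" "(a0 \<otimes> u) \<otimes> (a0 \<otimes> u) = t"
      using squares[OF CG[OF a0(1)]] a0(2) unfolding good_def by blast
    define a where "a = a0 \<otimes> u"
    have aC: "a \<in> C" using centralizer_mult_center[OF PC _ u(1)] a0(1) by (simp add: a_def C_def)
    have a_bad: "\<not> good a"
    proof
      assume "good a"
      then obtain v where v: "v \<in> center G" "(a \<otimes> v) \<otimes> (a \<otimes> v) = \<one>" unfolding good_def by blast
      have "a \<otimes> v = a0 \<otimes> (u \<otimes> v)"
        using CG[OF a0(1)] centerD(1)[OF u(1)] centerD(1)[OF v(1)] by (simp add: a_def m_assoc)
      then show False
        using a0(2) v(2) subgroup.m_closed[OF subgroup_center u(1) v(1)] unfolding good_def by metis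
    qed
    have aa: "a \<otimes> a = t" using u(2) by (simp add: a_def)
    note acar = CG[OF aC]
    have dich: "good (a \<otimes> g)" "a \<otimes> g \<in> C" if "g \<in> C" "\<not> good g" for g
      using good_mult[OF acar a_bad CG[OF that(1)] that(2)] subgroup.m_closed[OF Csub aC that(1)] by blast+
    have cancel: "v \<otimes> w = w \<otimes> v"
      if "v \<in> carrier G" "w \<in> carrier G" "(a \<otimes> v) \<otimes> w = w \<otimes> (a \<otimes> v)" "a \<otimes> w = w \<otimes> a" for v w
    proof -
      have "subgroup (centralizer G {w}) G" using that(2) by (simp add: subgroup_centralizer)
      then show ?thesis
        using subgroup_mult_left_iff[of "centralizer G {w}" a v] that acar by (simp add: centralizer_def)
    qed
    \<comment> \<open>Otherwise \<open>a\<close> commutes with the good elements of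
      \<open>C\<close>, and also with each bad \<open>g\<close> because \<open>a \<otimes> g\<close>
      is good. Then \<open>a\<close> is central, hence good, a contradiction.\<close>
    have "\<exists>b\<in>C. good b \<and> a \<otimes> b \<noteq> b \<otimes> a"
    proof (rule ccontr)
      assume "\<not> (\<exists>b\<in>C. good b \<and> a \<otimes> b \<noteq> b \<otimes> a)"
      then have ab: "a \<otimes> b = b \<otimes> a" if "b \<in> C" "good b" for b using that by blast
      have "a \<otimes> g = g \<otimes> a" if g: "g \<in> C" for g
      proof (cases "good g")
        case False
        have "(a \<otimes> g) \<otimes> a = a \<otimes> (a \<otimes> g)" using ab[OF dich(2,1)[OF g False]] by simp
        then show ?thesis using cancel[OF CG[OF g] acar] by simp
      qed (use ab g in simp)
      then have "a \<in> center G"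
        using centralizer_pairs_central[OF h] aC unfolding C_def by blast
      then show False using good_center a_bad by blast
    qed
    then obtain b0 where b0: "b0 \<in> C" "good b0" "a \<otimes> b0 \<noteq> b0 \<otimes> a" by blast
    obtain v where v: "v \<in> center G" "(b0 \<otimes> v) \<otimes> (b0 \<otimes> v) = \<one>" using b0(2) unfolding good_def by blast
    define b where "b = b0 \<otimes> v"
    have bC: "b \<in> C" using centralizer_mult_center[OF PC _ v(1)] b0(1) by (simp add: b_def C_def)
    have bb: "b \<otimes> b = \<one>" using v(2) by (simp add: b_def)
    note bcar = CG[OF bC]
    have b_good: "good b"
      unfolding good_def using bb bcar subgroup.one_closed[OF subgroup_center]
      by (intro bexI[of _ \<one>]) auto
    have nab: "a \<otimes> b \<noteq> b \<otimes> a"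
      using b0(3) commute_mult_center_iff[OF CG[OF b0(1)] acar v(1)] unfolding b_def by metis
    then have anti: "a \<otimes> b = c \<otimes> (b \<otimes> a)" using commutator[OF acar bcar] by blast
    let ?x = "case_nat a x" and ?y = "case_nat b y"
    have h': "hyperbolic (Suc k) ?x ?y"
      using hyperbolic_extend[OF h _ _ anti] aC bC by (simp add: C_def)
    have "g \<in> center G" if "g \<in> centralizer G (pairs (Suc k) ?x ?y)" for g
    proof -
      have g: "g \<in> C" "g \<otimes> a = a \<otimes> g" "g \<otimes> b = b \<otimes> g"
        using that unfolding pairs_extend by (auto simp: C_def centralizer_def)
      note gcar = CG[OF g(1)]
      \<comment> \<open>If \<open>g\<close> were bad, \<open>a \<otimes> g\<close> would be good and
        commute with the good \<open>b\<close>. As \<open>g\<close> commutes with \<open>b\<close>,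
        so would \<open>a\<close>.\<close>
      have g_good: "good g"
      proof (rule ccontr)
        assume bad: "\<not> good g"
        have "(a \<otimes> g) \<otimes> b = b \<otimes> (a \<otimes> g)"
          using good_commute[OF dich(2,1)[OF g(1) bad] bC b_good] .
        moreover have "g \<in> centralizer G {b}" using g gcar by (simp add: centralizer_def)
        moreover have "subgroup (centralizer G {b}) G" using bcar by (simp add: subgroup_centralizer)
        ultimately have "a \<in> centralizer G {b}"
          using subgroup_mult_right_iff[of "centralizer G {b}" g a] acar gcar by (simp add: centralizer_def)
        then show False using nab by (simp add: centralizer_def)
      qed
      \<comment> \<open>A bad \<open>w\<close> becomes good after multiplication by
        \<open>a\<close>, which commutes with \<open>g\<close> and can therefore be
        cancelled.\<close>
      have "g \<otimes> w = w \<otimes> g" if w: "w \<in> C" for w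
      proof (cases "good w")
        case True
        then show ?thesis using good_commute g(1) g_good w by blast
      next
        case False
        have "(a \<otimes> w) \<otimes> g = g \<otimes> (a \<otimes> w)"
          by (rule good_commute[OF dich(2,1)[OF w False] g(1) g_good])
        then show ?thesis using cancel[OF CG[OF w] gcar _ g(2)[symmetric]] by simp
      qed
      then show ?thesis
        using centralizer_pairs_central[OF h] g(1) unfolding C_def by blast
    qed
    then have central: "centralizer G (pairs (Suc k) ?x ?y) \<subseteq> center G" by blast
    have inv': "?x i \<otimes> ?x i = \<one> \<and> ?y i \<otimes> ?y i = \<one>" if "0 < i" "i < Suc k" for i
      using that inv by (cases i) auto
    show thesis
      by (rule that(2)[OF h' inv' _ _ central]) (simp_all add: aa bb)
  qed
qed

end

section \<open>Central products from hyperbolic systems\<close>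

context central_involution
begin

text \<open>Index \<open>n\<close> is the cyclic factor. The factors strictly between 0 and
  \<open>n\<close> have center inside \<open>{\<one>, c}\<close>, while factor 0 is allowed a larger
  center inside \<open>T\<close>, as long as it meets the cyclic factor in
  \<open>{\<one>, c}\<close>; this leaves room for \<open>M2\<close>. The bound by \<open>T\<close>
  on central elements of \<open>P\<close> is what later shows that \<open>W\<close> meets
  \<open>P\<close> trivially.\<close>

lemma central_product_core:
  assumes ch: "commuting_homs G (Suc n) F h"
    and Fs: "length Fs = Suc n" "\<And>i. i < Suc n \<Longrightarrow> Fs ! i = (F i, {x \<in> carrier (F i). h i x \<in> {\<one>, c}})"
    and c: "c \<in> h n ` carrier (F n)"
    and T: "subgroup T G" "h n ` carrier (F n) \<subseteq> T"
    and C: "\<And>i u. \<lbrakk>0 < i; i < n; u \<in> h i ` carrier (F i); \<And>v. v \<in> h i ` carrier (F i) \<Longrightarrow> u \<otimes> v = v \<otimes> u\<rbrakk>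
      \<Longrightarrow> u \<in> {\<one>, c}"
    and C0: "\<And>u. \<lbrakk>0 < n; u \<in> h 0 ` carrier (F 0); \<And>v. v \<in> h 0 ` carrier (F 0) \<Longrightarrow> u \<otimes> v = v \<otimes> u\<rbrakk>
      \<Longrightarrow> u \<in> T \<and> (u \<in> h n ` carrier (F n) \<longrightarrow> u \<in> {\<one>, c})"
  obtains P where "subgroup P G" "G\<lparr>carrier := P\<rparr> \<cong> central_product Fs"
    "\<And>i. i < Suc n \<Longrightarrow> h i ` carrier (F i) \<subseteq> P" "P \<inter> center G \<subseteq> T"
proof -
  interpret commuting_homs G "Suc n" F h by (rule ch)
  let ?Z = "h n ` carrier (F n)"
  have Z: "subgroup ?Z G" by (rule group_hom.img_is_subgroup[OF group_hom_h]) simp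
  have one_c: "subgroup {\<one>, c} G" by (rule subgroup_involution) simp_all
  have cZ: "{\<one>, c} \<subseteq> ?Z" using c subgroup.one_closed[OF Z] by blast
  have central: "h i (f i) \<in> h i ` carrier (F i)" "\<And>v. v \<in> h i ` carrier (F i) \<Longrightarrow> h i (f i) \<otimes> v = v \<otimes> h i (f i)"
    if "f \<in> carrier PF" "prod_map f \<in> center G" "i < Suc n" for f i
  proof -
    show "h i (f i) \<in> h i ` carrier (F i)" using that(1,3) by (auto simp: PiE_iff)
    fix v assume "v \<in> h i ` carrier (F i)"
    then obtain x where x: "v = h i x" "x \<in> carrier (F i)" by blast
    have "prod_map f \<otimes> h i x = h i x \<otimes> prod_map f"
      using that(2) h_closed[OF that(3) x(2)] by (simp add: center_def)
    then show "h i (f i) \<otimes> v = v \<otimes> h i (f i)"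
      unfolding x(1) by (rule factor_central[OF that(1,3) x(2)])
  qed
  have closed: "h i (f i) \<in> carrier G" if "f \<in> carrier PF" "i < Suc n" for f i
    using that by (intro h_closed) (auto simp: PiE_iff)
  have one_center: "\<one> \<in> center G" by (simp add: center_def)
  \<comment> \<open>The components are settled in the order middle, first, last. The middle ones lie
    in \<open>{\<one>, c}\<close> by \<open>C\<close>; solving for component 0 puts it into the
    cyclic factor, so that \<open>C0\<close> applies; solving for the last one then puts it into
    \<open>{\<one>, c}\<close> too.\<close>
  have indep: "h i (f i) \<in> {\<one>, c}" if f: "f \<in> carrier PF" "prod_map f = \<one>" and i: "i < Suc n" for f i
  proof -
    have pc: "prod_map f \<in> center G" using f(2) one_center by simp
    have mid: "h j (f j) \<in> {\<one>, c}" if "0 < j" "j < n" for j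
      using C[OF that central(1)[OF f(1) pc] central(2)[OF f(1) pc]] that by simp
    have less_n: "h j (f j) \<in> {\<one>, c}" if j: "j < n" for j
    proof (cases "j = 0")
      case True
      have "h 0 (f 0) \<in> ?Z"
      proof (rule ordered_prod_factor_in_subgroup[OF Z, where u = "\<lambda>i. h i (f i)" and n = "Suc n"])
        show "h l (f l) \<in> ?Z" if "l < Suc n" "l \<noteq> 0" for l
        proof (cases "l = n")
          case False
          then show ?thesis using mid[of l] that cZ by auto
        qed (use central(1)[OF f(1) pc] that in simp)
        show "ordered_prod (\<lambda>i. h i (f i)) (Suc n) \<in> ?Z"
          using f(2) subgroup.one_closed[OF Z] unfolding prod_map_def by (simp only:)
      qed (use closed[OF f(1)] in auto)
      then show ?thesis
        using C0[OF _ central(1)[OF f(1) pc] central(2)[OF f(1) pc]] True j by simp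
    next
      case False
      then show ?thesis using mid j by simp
    qed
    show ?thesis
    proof (cases "i = n")
      case True
      have "h n (f n) \<in> {\<one>, c}"
      proof (rule ordered_prod_factor_in_subgroup[OF one_c, where u = "\<lambda>i. h i (f i)" and n = "Suc n"])
        show "h l (f l) \<in> {\<one>, c}" if "l < Suc n" "l \<noteq> n" for l
          using less_n[of l] that by simp
        show "ordered_prod (\<lambda>i. h i (f i)) (Suc n) \<in> {\<one>, c}"
          using f(2) unfolding prod_map_def by simp
      qed (use closed[OF f(1)] in auto)
      then show ?thesis using True by simp
    next
      case False
      then show ?thesis using less_n i by simp
    qed
  qed
  let ?P = "prod_map ` carrier PF"
  show thesis
  proof (rule that)
    show "subgroup ?P G" by (rule subgroup_prod_image)
    show "G\<lparr>carrier := ?P\<rparr> \<cong> central_product Fs"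
    proof (rule central_product_iso_image[OF c_closed c_square c_neq_one Fs(1)])
      show "Fs ! i = (F i, {x \<in> carrier (F i). h i x \<in> {\<one>, c}})" if "i < Suc n" for i
        by (rule Fs(2)[OF that])
      show "h i (f i) \<in> {\<one>, c}" if "f \<in> carrier PF" "prod_map f = \<one>" "i < Suc n" for f i
        by (rule indep[OF that])
    qed
    show "h i ` carrier (F i) \<subseteq> ?P" if "i < Suc n" for i
      using factor_in_prod_image[OF that] by blast
    show "?P \<inter> center G \<subseteq> T"
    proof
      fix p assume "p \<in> ?P \<inter> center G"
      then obtain f where f: "p = prod_map f" "f \<in> carrier PF" "prod_map f \<in> center G" by auto
      have "h i (f i) \<in> T" if i: "i < Suc n" for i
      proof -
        consider "i = n" | "i = 0" "0 < n" | "0 < i" "i < n" using i by linarith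
        then show ?thesis
        proof cases
          case 1
          then show ?thesis using central(1)[OF f(2,3) i] T(2) by auto
        next
          case 2
          then show ?thesis using C0[OF _ central(1)[OF f(2,3)] central(2)[OF f(2,3)]] by simp
        next
          case 3
          then have "h i (f i) \<in> {\<one>, c}"
            using C[OF 3 central(1)[OF f(2,3) i] central(2)[OF f(2,3) i]] by simp
          then show ?thesis using cZ T(2) by blast
        qed
      qed
      then show "p \<in> T"
        unfolding f(1) prod_map_def by (rule ordered_prod_in_subgroup[OF T(1)])
    qed
  qed
qed

text \<open>The clause over all \<open>H\<close> bounds the image by the subgroup generated by
  \<open>x\<close>, \<open>y\<close>, \<open>c\<close>. Used with centralizers as \<open>H\<close>,
  it reduces commutation of whole factors to commutation of the pairs; \<open>c\<close> is listed
  because it is the image of the third generator of \<open>M2\<close>.\<close>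

definition embeds_pair :: "'f monoid \<Rightarrow> ('f \<Rightarrow> 'a) \<Rightarrow> 'a \<Rightarrow> 'a \<Rightarrow> bool" where
  "embeds_pair F h x y \<longleftrightarrow> group F \<and> h \<in> hom F G \<and> inj_on h (carrier F) \<and>
     x \<in> h ` carrier F \<and> y \<in> h ` carrier F \<and>
     (\<forall>H. subgroup H G \<longrightarrow> x \<in> H \<longrightarrow> y \<in> H \<longrightarrow> c \<in> H \<longrightarrow> h ` carrier F \<subseteq> H) \<and>
     nonabelian_factor F = (F, {u \<in> carrier F. h u \<in> {\<one>, c}})"

lemma embeds_pairD:
  assumes "embeds_pair F h x y"
  shows "group F" "h \<in> hom F G" "inj_on h (carrier F)" "x \<in> h ` carrier F" "y \<in> h ` carrier F"
    "\<And>H. subgroup H G \<Longrightarrow> x \<in> H \<Longrightarrow> y \<in> H \<Longrightarrow> c \<in> H \<Longrightarrow> h ` carrier F \<subseteq> H"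
    "nonabelian_factor F = (F, {u \<in> carrier F. h u \<in> {\<one>, c}})"
  using assms unfolding embeds_pair_def by blast+

text \<open>Two involutions with commutator \<open>c\<close> are reflections of a dihedral group of
  order 8. Its rotation is \<open>x \<otimes> y\<close>, whose square is \<open>c\<close>.\<close>

lemma D8_embeds_pair:
  assumes x: "x \<in> carrier G" "x \<otimes> x = \<one>" and y: "y \<in> carrier G" "y \<otimes> y = \<one>"
    and xy: "x \<otimes> y = c \<otimes> (y \<otimes> x)" and der: "derived G (carrier G) \<subseteq> {\<one>, c}"
  obtains h where "embeds_pair D8 h x y"
    "\<And>u. \<lbrakk>u \<in> h ` carrier D8; u \<otimes> x = x \<otimes> u; u \<otimes> y = y \<otimes> u\<rbrakk> \<Longrightarrow> u \<in> {\<one>, c}"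
proof -
  let ?p = "x \<otimes> y"
  have p: "?p \<in> carrier G" using x y by simp
  have "?p \<otimes> ?p = x \<otimes> (y \<otimes> x) \<otimes> y" using x(1) y(1) by (simp add: m_assoc)
  also have "\<dots> = c \<otimes> ((x \<otimes> x) \<otimes> (y \<otimes> y))"
    unfolding anticommute_sym[OF x(1) y(1) xy] using x(1) y(1) by (simp add: m_assoc c_left_commute)
  finally have pp: "?p \<otimes> ?p = c" using x y by simp
  have "?p \<otimes> y = x" using x y by (simp add: m_assoc)
  moreover have "y \<otimes> ?p = c \<otimes> (?p \<otimes> y)"
  proof -
    have "y \<otimes> ?p = (y \<otimes> x) \<otimes> y" using x(1) y(1) by (simp add: m_assoc)
    then show ?thesis unfolding anticommute_sym[OF x(1) y(1) xy] using x(1) y(1) by (simp add: m_assoc)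
  qed
  ultimately have py: "?p \<otimes> y = c \<otimes> (y \<otimes> ?p)" using x(1) by (simp add: c_cancel)
  have D8: "group D8" by (simp add: D8_def)
  show thesis
  proof (rule D8_embedding[OF p pp y py])
    fix h
    assume h: "h \<in> hom D8 G" "inj_on h (carrier D8)" "?p \<in> h ` carrier D8" "y \<in> h ` carrier D8"
      and sub: "\<And>H. subgroup H G \<Longrightarrow> ?p \<in> H \<Longrightarrow> y \<in> H \<Longrightarrow> h ` carrier D8 \<subseteq> H"
      and cent: "\<And>u. u \<in> h ` carrier D8 \<Longrightarrow> u \<otimes> ?p = ?p \<otimes> u \<Longrightarrow> u \<otimes> y = y \<otimes> u \<Longrightarrow> u \<in> {\<one>, c}"
    interpret h: group_hom D8 G h
      using D8 h(1) by (simp add: group_hom_def group_hom_axioms_def is_group)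
    have img: "subgroup (h ` carrier D8) G" by (rule h.img_is_subgroup)
    have x_img: "x \<in> h ` carrier D8"
      using subgroup.m_closed[OF img h(3,4)] \<open>?p \<otimes> y = x\<close> by simp
    have "nonabelian_factor D8 = (D8, {u \<in> carrier D8. h u \<in> {\<one>, c}})"
    proof -
      obtain u v where uv: "u \<in> carrier D8" "v \<in> carrier D8" "h u = ?p" "h v = y" using h(3,4) by fastforce
      have "h u \<otimes> h v \<noteq> h v \<otimes> h u"
        unfolding uv by (rule anticommute_not_commute[OF p y(1) py])
      then show ?thesis by (rule nonabelian_factor_eq[OF D8 h(1,2) der uv(1,2)])
    qed
    moreover have "\<forall>H. subgroup H G \<longrightarrow> x \<in> H \<longrightarrow> y \<in> H \<longrightarrow> c \<in> H \<longrightarrow> h ` carrier D8 \<subseteq> H"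
      using sub subgroup.m_closed by metis
    ultimately have emb: "embeds_pair D8 h x y"
      unfolding embeds_pair_def using D8 h(1,2,4) x_img by (intro conjI)
    have "u \<in> {\<one>, c}" if u: "u \<in> h ` carrier D8" "u \<otimes> x = x \<otimes> u" "u \<otimes> y = y \<otimes> u" for u
    proof (rule cent[OF u(1) _ u(3)])
      have uc: "u \<in> carrier G" using u(1) by (rule subgroup.mem_carrier[OF img])
      show "u \<otimes> ?p = ?p \<otimes> u"
        by (rule commute_mult[OF x(1) y(1) uc u(2)[symmetric] u(3)[symmetric], symmetric])
    qed
    then show thesis by (rule that[OF emb])
  qed
qed

text \<open>Here \<open>sep\<close> amounts to \<open>c\<close> lying outside the powers of
  \<open>a \<otimes> a\<close>; together with the order of \<open>a \<otimes> a\<close> it yields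
  the divisibility form used by \<open>M2_embedding\<close>.\<close>

lemma M2_embeds_pair:
  assumes a: "a \<in> carrier G" "ord (a \<otimes> a) = 2 ^ m" and b: "b \<in> carrier G" "b \<otimes> b = \<one>"
    and ab: "a \<otimes> b = c \<otimes> (b \<otimes> a)" and der: "derived G (carrier G) \<subseteq> {\<one>, c}"
    and sep: "\<And>k::nat. (a \<otimes> a) [^] k \<in> {\<one>, c} \<Longrightarrow> (a \<otimes> a) [^] k = \<one>"
  obtains h where "embeds_pair (M2 (m + 1)) h a b"
    "\<And>u. \<lbrakk>u \<in> h ` carrier (M2 (m + 1)); u \<otimes> a = a \<otimes> u; u \<otimes> b = b \<otimes> u\<rbrakk>
      \<Longrightarrow> \<exists>(k::nat) (l::nat). u = (a \<otimes> a) [^] k \<otimes> c [^] l"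
proof -
  have aa: "a \<otimes> a \<in> carrier G" using a by simp
  have "a [^] (2 ^ (m + 1) :: nat) = (a [^] (2::nat)) [^] (2 ^ m :: nat)"
    using a by (simp add: nat_pow_pow)
  also have "a [^] (2::nat) = a \<otimes> a" using a by (simp add: numeral_eq_Suc)
  also have "(a \<otimes> a) [^] (2 ^ m :: nat) = \<one>" using pow_eq_id[OF aa] a(2) by simp
  finally have a_pow: "a [^] (2 ^ (m + 1) :: nat) = \<one>" .
  have sep': "2 ^ m dvd k" if "(a \<otimes> a) [^] k \<in> {\<one>, c}" for k :: nat
    using sep[OF that] pow_eq_id[OF aa] a(2) by simp
  let ?M = "M2 (m + 1)"
  have M: "group ?M" by (simp add: M2_def)
  show thesis
  proof (rule M2_embedding[OF a(1) a_pow b ab])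
    show "2 ^ m dvd k" if "(a \<otimes> a) [^] k \<in> {\<one>, c}" for k :: nat by (rule sep'[OF that])
    fix h
    assume h: "h \<in> hom ?M G" "inj_on h (carrier ?M)" "a \<in> h ` carrier ?M" "b \<in> h ` carrier ?M"
      and sub: "\<And>H. subgroup H G \<Longrightarrow> a \<in> H \<Longrightarrow> b \<in> H \<Longrightarrow> c \<in> H \<Longrightarrow> h ` carrier ?M \<subseteq> H"
      and cent: "\<And>u. u \<in> h ` carrier ?M \<Longrightarrow> u \<otimes> a = a \<otimes> u \<Longrightarrow> u \<otimes> b = b \<otimes> u \<Longrightarrow>
         \<exists>(k::nat) (l::nat). u = (a \<otimes> a) [^] k \<otimes> c [^] l"
    have "nonabelian_factor ?M = (?M, {u \<in> carrier ?M. h u \<in> {\<one>, c}})"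
    proof -
      obtain u v where uv: "u \<in> carrier ?M" "v \<in> carrier ?M" "h u = a" "h v = b" using h(3,4) by fastforce
      have "h u \<otimes> h v \<noteq> h v \<otimes> h u"
        unfolding uv by (rule anticommute_not_commute[OF a(1) b(1) ab])
      then show ?thesis by (rule nonabelian_factor_eq[OF M h(1,2) der uv(1,2)])
    qed
    moreover have "\<forall>H. subgroup H G \<longrightarrow> a \<in> H \<longrightarrow> b \<in> H \<longrightarrow> c \<in> H \<longrightarrow> h ` carrier ?M \<subseteq> H"
      using sub by blast
    ultimately have "embeds_pair ?M h a b"
      unfolding embeds_pair_def using M h by (intro conjI)
    then show thesis by (rule that) (rule cent)
  qed
qed

text \<open>\<open>T\<close> is kept as a parameter because it differs in the two cases: the powers
  of \<open>z\<close> if every pair gives \<open>D8\<close>, and the products of powers of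
  \<open>z\<close> and \<open>t\<close> if the first pair gives \<open>M2\<close>.\<close>

lemma hyperbolic_central_product:
  assumes h: "hyperbolic k x y" and emb: "\<And>i. i < k \<Longrightarrow> embeds_pair (F i) (e i) (x i) (y i)"
    and z: "z \<in> center G" "ord z = N" "N > 0" "c \<in> generate G {z}"
    and uniq: "\<And>u. u \<in> generate G {z} \<Longrightarrow> u \<otimes> u = \<one> \<Longrightarrow> u \<in> {\<one>, c}"
    and T: "subgroup T G" "generate G {z} \<subseteq> T"
    and C: "\<And>i u. \<lbrakk>0 < i; i < k; u \<in> e i ` carrier (F i); u \<otimes> x i = x i \<otimes> u; u \<otimes> y i = y i \<otimes> u\<rbrakk>
      \<Longrightarrow> u \<in> {\<one>, c}"
    and C0: "\<And>u. \<lbrakk>0 < k; u \<in> e 0 ` carrier (F 0); u \<otimes> x 0 = x 0 \<otimes> u; u \<otimes> y 0 = y 0 \<otimes> u\<rbrakk>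
      \<Longrightarrow> u \<in> T \<and> (u \<in> generate G {z} \<longrightarrow> u \<in> {\<one>, c})"
  obtains P where "subgroup P G"
    "G\<lparr>carrier := P\<rparr> \<cong> central_product (map (\<lambda>i. nonabelian_factor (F i)) [0..<k] @ [cyclic_factor (Cyc N)])"
    "pairs k x y \<subseteq> P" "z \<in> P" "P \<inter> center G \<subseteq> T"
proof -
  have zc: "z \<in> carrier G" using z(1) by (simp add: center_def)
  obtain hc where hc: "hc \<in> hom (Cyc N) G" "inj_on hc (carrier (Cyc N))" "hc ` carrier (Cyc N) = generate G {z}"
    by (rule Cyc_embedding[OF zc z(3,2)])
  have Cyc: "group (Cyc N)" by (simp add: Cyc_def)
  have gen_center: "generate G {z} \<subseteq> center G"
    unfolding center_eq_centralizer
    by (rule generate_subgroup_incl[OF _ subgroup_centralizer])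
       (use z(1) in \<open>simp_all add: center_eq_centralizer\<close>)
  \<comment> \<open>The cyclic factor is appended at index \<open>k\<close>, behind the factors of
    the pairs.\<close>
  define F' where "F' i = (if i < k then F i else Cyc N)" for i
  define e' where "e' i = (if i < k then e i else hc)" for i
  have lt: "F' i = F i" "e' i = e i" if "i < k" for i using that by (simp_all add: F'_def e'_def)
  have eq: "F' k = Cyc N" "e' k = hc" by (simp_all add: F'_def e'_def)
  have c_img: "c \<in> generate G {z}" by (rule z(4))
  \<comment> \<open>Two passages through \<open>embeds_pairD(6)\<close>: the centralizers of
    \<open>x j\<close> and of \<open>y j\<close> contain the image of factor \<open>i\<close>, so
    the centralizer of any \<open>u\<close> in that image contains \<open>x j\<close> and
    \<open>y j\<close>, hence the image of factor \<open>j\<close>.\<close>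
  have commute_img: "u \<otimes> v = v \<otimes> u"
    if ij: "i < k" "j < k" "i \<noteq> j" and u: "u \<in> e i ` carrier (F i)" and v: "v \<in> e j ` carrier (F j)" for i j u v
  proof -
    note hi = hyperbolicD[OF h ij(1)] and hj = hyperbolicD[OF h ij(2)]
    have img: "e i ` carrier (F i) \<subseteq> centralizer G {g}"
      if "g \<in> carrier G" "x i \<otimes> g = g \<otimes> x i" "y i \<otimes> g = g \<otimes> y i" "i < k" for g i
    proof (rule embeds_pairD(6)[OF emb[OF that(4)]])
      show "subgroup (centralizer G {g}) G" using that(1) by (simp add: subgroup_centralizer)
      show "c \<in> centralizer G {g}" using that(1) c_central[of g] by (simp add: centralizer_def)
    qed (use that hyperbolicD(1,2)[OF h that(4)] in \<open>simp_all add: centralizer_def\<close>)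
    have "u \<otimes> x j = x j \<otimes> u"
      using img[OF hj(1) _ _ ij(1)] u hyperbolic_commute[OF h ij, of "x i" "x j"]
        hyperbolic_commute[OF h ij, of "y i" "x j"] by (auto simp: centralizer_def)
    moreover have "u \<otimes> y j = y j \<otimes> u"
      using img[OF hj(2) _ _ ij(1)] u hyperbolic_commute[OF h ij, of "x i" "y j"]
        hyperbolic_commute[OF h ij, of "y i" "y j"] by (auto simp: centralizer_def)
    moreover have "u \<in> carrier G"
      using u embeds_pairD(2)[OF emb[OF ij(1)]] by (auto simp: hom_def)
    ultimately have "v \<in> centralizer G {u}"
      using img[of u j] ij(2) v by auto
    then show ?thesis by (simp add: centralizer_def)
  qed
  have ch: "commuting_homs G (Suc k) F' e'"
  proof (intro commuting_homs.intro commuting_homs_axioms.intro is_group)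
    fix i assume "i < Suc k"
    then have "i < k \<or> i = k" by auto
    then show "group (F' i)" "e' i \<in> hom (F' i) G" "inj_on (e' i) (carrier (F' i))"
      using lt[of i] eq embeds_pairD(1-3)[OF emb, of i] hc Cyc by auto
  next
    fix i j u v assume ij: "i < Suc k" "j < Suc k" "i \<noteq> j" and u: "u \<in> carrier (F' i)" and v: "v \<in> carrier (F' j)"
    have closed: "e' l w \<in> carrier G" if "l < Suc k" "w \<in> carrier (F' l)" for l w
    proof (cases "l < k")
      case True
      then show ?thesis using that lt[OF True] embeds_pairD(2)[OF emb[OF True]] by (auto simp: hom_def)
    next
      case False
      then have "l = k" using that by simp
      then show ?thesis using that eq hc(1) by (auto simp: hom_def)
    qed
    have central: "e' k w \<in> center G" if "w \<in> carrier (F' k)" for w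
      using that eq hc(3) gen_center by auto
    consider "i < k" "j < k" | "i = k" | "j = k" using ij by linarith
    then show "e' i u \<otimes> e' j v = e' j v \<otimes> e' i u"
    proof cases
      case 1
      then show ?thesis
        using u v lt ij(3) by (intro commute_img[of i j]) auto
    next
      case 2
      then show ?thesis using central[of u] closed[OF ij(2) v] u by (simp add: center_def)
    next
      case 3
      then show ?thesis using central[of v] closed[OF ij(1) u] v by (simp add: center_def)
    qed
  qed
  let ?Fs = "map (\<lambda>i. nonabelian_factor (F i)) [0..<k] @ [cyclic_factor (Cyc N)]"
  have Fs: "?Fs ! i = (F' i, {u \<in> carrier (F' i). e' i u \<in> {\<one>, c}})" if "i < Suc k" for i
  proof (cases "i < k")
    case True
    then have "?Fs ! i = nonabelian_factor (F i)" by (simp add: nth_append)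
    then show ?thesis using embeds_pairD(7)[OF emb[OF True]] lt[OF True] by simp
  next
    case False
    then have i: "i = k" using that by simp
    have "?Fs ! i = cyclic_factor (Cyc N)" by (simp add: i nth_append)
    moreover have "cyclic_factor (Cyc N) = (Cyc N, {u \<in> carrier (Cyc N). hc u \<in> {\<one>, c}})"
      using hc c_img uniq by (intro cyclic_factor_eq[OF Cyc]) auto
    ultimately show ?thesis by (simp add: i eq)
  qed
  have Z: "e' k ` carrier (F' k) = generate G {z}" by (simp add: eq hc)
  obtain P where P: "subgroup P G" "G\<lparr>carrier := P\<rparr> \<cong> central_product ?Fs"
    "\<And>i. i < Suc k \<Longrightarrow> e' i ` carrier (F' i) \<subseteq> P" "P \<inter> center G \<subseteq> T"
  proof (rule central_product_core[OF ch _ Fs _ T(1)])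
    show "length ?Fs = Suc k" by simp
    show "c \<in> e' k ` carrier (F' k)" "e' k ` carrier (F' k) \<subseteq> T" using Z c_img T(2) by simp_all
    fix i u
    assume i: "0 < i" "i < k" and u: "u \<in> e' i ` carrier (F' i)"
      and comm: "\<And>v. v \<in> e' i ` carrier (F' i) \<Longrightarrow> u \<otimes> v = v \<otimes> u"
    show "u \<in> {\<one>, c}"
      using u comm embeds_pairD(4,5)[OF emb[OF i(2)]] lt[OF i(2)] by (intro C[OF i]) auto
  next
    fix u
    assume i: "0 < k" and u: "u \<in> e' 0 ` carrier (F' 0)"
      and comm: "\<And>v. v \<in> e' 0 ` carrier (F' 0) \<Longrightarrow> u \<otimes> v = v \<otimes> u"
    show "u \<in> T \<and> (u \<in> e' k ` carrier (F' k) \<longrightarrow> u \<in> {\<one>, c})"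
      unfolding Z using u comm embeds_pairD(4,5)[OF emb[OF i]] lt[OF i] by (intro C0[OF i]) auto
  next
    fix P
    assume "subgroup P G" "G\<lparr>carrier := P\<rparr> \<cong> central_product ?Fs"
      "\<And>i. i < Suc k \<Longrightarrow> e' i ` carrier (F' i) \<subseteq> P" "P \<inter> center G \<subseteq> T"
    then show thesis by (rule that)
  qed
  show thesis
  proof (rule that[OF P(1,2) _ _ P(4)])
    show "pairs k x y \<subseteq> P"
    proof
      fix u assume "u \<in> pairs k x y"
      then obtain i where i: "i < k" "u \<in> {x i, y i}" by (auto simp: pairs_def)
      then have "u \<in> e' i ` carrier (F' i)"
        using embeds_pairD(4,5)[OF emb[OF i(1)]] lt[OF i(1)] by auto
      then show "u \<in> P" using P(3)[of i] i(1) by auto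
    qed
    show "z \<in> P" using P(3)[of k] Z generate.incl[of z "{z}" G] by auto
  qed
qed

end

section \<open>The two types of groups\<close>

text \<open>In the application \<open>z\<close> and \<open>t\<close> are \<open>z 1\<close> and
  \<open>z 2\<close>, and \<open>r\<close> is the number of remaining factors of order 2, that is,
  the theorem's \<open>r - 2\<close>.\<close>

locale two_step_center = two_step_squares +
  fixes z W and n m r :: nat
  assumes z_center: "z \<in> center G" and ord_z: "ord z = 2 ^ (n + 1)" and ord_t: "ord t = 2 ^ m"
    and c_gen: "c \<in> generate G {z}"
    and W_subgroup: "subgroup W G" and W_center: "W \<subseteq> center G"
    and W_iso: "G\<lparr>carrier := W\<rparr> \<cong> Z2_power r"
    and center_span: "u \<in> center G \<Longrightarrow> \<exists>(i::int) (j::int). \<exists>w\<in>W. u = z [^] i \<otimes> (t [^] j \<otimes> w)"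
    and center_indep: "\<lbrakk>w \<in> W; z [^] (i::int) \<otimes> (t [^] (j::int) \<otimes> w) = \<one>\<rbrakk> \<Longrightarrow>
       z [^] i = \<one> \<and> t [^] j = \<one> \<and> w = \<one>"
    and derived_c: "derived G (carrier G) \<subseteq> {\<one>, c}" and non_abelian: "\<not> comm_group G"
begin

lemma z_closed: "z \<in> carrier G" and t_closed: "t \<in> carrier G"
  using z_center t_center centerD(1) by auto

lemma generate_center: "u \<in> center G \<Longrightarrow> generate G {u} \<subseteq> center G"
  by (rule generate_subgroup_incl[OF _ subgroup_center]) simp

text \<open>A power of \<open>z\<close> with trivial square has an exponent divisible by
  \<open>2 ^ n\<close>, and only the parity of the quotient matters. Since \<open>c\<close> is
  nontrivial, it represents the odd class.\<close>

lemma generate_z_involution: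
  assumes u: "u \<in> generate G {z}" "u \<otimes> u = \<one>"
  shows "u \<in> {\<one>, c}"
proof -
  have half: "int (2 ^ n) dvd i" if "z [^] i \<otimes> z [^] i = \<one>" for i
  proof -
    have "z [^] (2 * i) = \<one>" using that z_closed int_pow_mult[of z i i] by simp
    then have "int (2 ^ (n + 1)) dvd 2 * i" using int_pow_eq_id[OF z_closed] ord_z by simp
    then show ?thesis by simp
  qed
  have even_one: "z [^] (int (2 ^ n) * q) = \<one>" if "even q" for q
  proof -
    have "int (2 ^ (n + 1)) dvd int (2 ^ n) * q" using that by auto
    then show ?thesis using int_pow_eq_id[OF z_closed] ord_z by simp
  qed
  obtain i j where i: "u = z [^] (i::int)" and j: "c = z [^] (j::int)"
    using u(1) c_gen generate_singleton[OF z_closed] by auto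
  obtain p where p: "i = int (2 ^ n) * p" using half[of i] u(2) i by auto
  obtain q where q: "j = int (2 ^ n) * q" using half[of j] c_square j by auto
  have "odd q" using even_one[of q] c_neq_one j q by auto
  show ?thesis
  proof (cases "even p")
    case True
    then show ?thesis using even_one i p by simp
  next
    case False
    then have "z [^] (i - j) = \<one>"
      using even_one[of "p - q"] \<open>odd q\<close> by (simp add: p q right_diff_distrib)
    then have "z [^] i = z [^] j"
      using z_closed by (simp add: int_pow_diff inv_solve_right')
    then show ?thesis using i j by simp
  qed
qed

lemma t_pow_generate_z:
  assumes "t [^] (j::int) \<in> generate G {z}"
  shows "t [^] j = \<one>"
proof -
  obtain i :: int where i: "t [^] j = z [^] i" using assms generate_singleton[OF z_closed] by auto
  have "z [^] (- i) \<otimes> (t [^] j \<otimes> \<one>) = \<one>"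
    using z_closed by (simp add: i int_pow_neg)
  then show ?thesis using center_indep[OF subgroup.one_closed[OF W_subgroup]] by blast
qed

lemma zt_in_W:
  assumes "w \<in> W" "w = z [^] (i::int) \<otimes> t [^] (j::int)"
  shows "w = \<one>"
proof -
  have wc: "w \<in> carrier G" using subgroup.mem_carrier[OF W_subgroup assms(1)] .
  have "z [^] i \<otimes> (t [^] j \<otimes> inv w) = (z [^] i \<otimes> t [^] j) \<otimes> inv w"
    using z_closed t_closed wc by (simp add: m_assoc)
  also have "\<dots> = \<one>" using assms(2)[symmetric] wc by simp
  finally have "inv w = \<one>"
    using center_indep[OF subgroup.m_inv_closed[OF W_subgroup assms(1)]] by blast
  then show ?thesis using wc inv_inv[of w] by simp
qed

text \<open>The common last step of both cases. \<open>Q <#> W\<close> contains the pairs and,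
  through \<open>center_span\<close>, the whole center, hence the centralizer of the pairs, so
  \<open>hyperbolic_span\<close> makes it all of \<open>G\<close>. As \<open>W\<close> is central
  and meets \<open>Q\<close> trivially, the product is direct.\<close>

lemma product_with_W:
  assumes Q: "subgroup Q G" "z \<in> Q" "t \<in> Q" and int: "Q \<inter> W \<subseteq> {\<one>}"
    and h: "hyperbolic k x y" "pairs k x y \<subseteq> Q" "centralizer G (pairs k x y) \<subseteq> center G"
    and H: "G\<lparr>carrier := Q\<rparr> \<cong> H"
  shows "G \<cong> H \<times>\<times> Z2_power r"
proof -
  have comm: "a \<otimes> b = b \<otimes> a" if "a \<in> Q" "b \<in> W" for a b
    using centerD(2)[of b a] W_center subgroup.mem_carrier[OF Q(1)] that by auto
  have QW: "subgroup (Q <#> W) G" by (rule subgroup_commuting_product[OF Q(1) W_subgroup comm])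
  have "Q <#> W = carrier G"
  proof (rule hyperbolic_span[OF h(1) QW])
    show "pairs k x y \<subseteq> Q <#> W"
      using h(2) set_mult_left_incl[OF W_subgroup subgroup.subset[OF Q(1)]] by blast
    show "centralizer G (pairs k x y) \<subseteq> Q <#> W"
    proof
      fix u assume "u \<in> centralizer G (pairs k x y)"
      then obtain i j :: int and w where u: "u = z [^] i \<otimes> (t [^] j \<otimes> w)" "w \<in> W"
        using center_span h(3) by blast
      have "u = (z [^] i \<otimes> t [^] j) \<otimes> w"
        using u z_closed t_closed subgroup.mem_carrier[OF W_subgroup] by (simp add: m_assoc)
      moreover have "z [^] i \<otimes> t [^] j \<in> Q"
        using Q by (intro subgroup.m_closed[OF Q(1)] subgroup_int_pow[OF Q(1)])
      ultimately show "u \<in> Q <#> W" using u(2) unfolding set_mult_def by blast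
    qed
  qed
  moreover have "Q \<inter> W = {\<one>}"
    using int subgroup.one_closed[OF Q(1)] subgroup.one_closed[OF W_subgroup] by blast
  ultimately have "G \<cong> G\<lparr>carrier := Q\<rparr> \<times>\<times> G\<lparr>carrier := W\<rparr>"
    using commuting_product_iso_DirProd[OF Q(1) W_subgroup comm] by simp
  also have "G\<lparr>carrier := Q\<rparr> \<times>\<times> G\<lparr>carrier := W\<rparr> \<cong> H \<times>\<times> Z2_power r"
    by (rule group.DirProd_iso_trans[OF subgroup.subgroup_is_group[OF Q(1) is_group] H W_iso])
  finally show ?thesis .
qed

text \<open>All nonabelian factors are \<open>D8\<close>, with center inside
  \<open>{\<one>, c}\<close>, so the central elements of the central product \<open>P\<close> are
  powers of \<open>z\<close>. Independence in the center then splits off first the powers of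
  \<open>t\<close> and afterwards \<open>W\<close>.\<close>

lemma classification_split:
  assumes h: "hyperbolic k x y" and sq: "\<And>i. i < k \<Longrightarrow> x i \<otimes> x i = \<one> \<and> y i \<otimes> y i = \<one>"
    and cent: "centralizer G (pairs k x y) \<subseteq> center G"
  shows "1 \<le> k" and "G \<cong> (central_product (replicate k (nonabelian_factor D8) @
      [cyclic_factor (Cyc (2 ^ (n + 1)))]) \<times>\<times> integer_mod_group (2 ^ m)) \<times>\<times> Z2_power r"
proof -
  show "1 \<le> k"
  proof (rule ccontr)
    assume "\<not> 1 \<le> k"
    then have "k = 0" by simp
    \<comment> \<open>Without pairs the centralizer condition is vacuous, so the whole group would
      be central.\<close>
    then have "centralizer G (pairs k x y) = carrier G" by (simp add: pairs_def centralizer_def)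
    then have "u \<otimes> v = v \<otimes> u" if "u \<in> carrier G" "v \<in> carrier G" for u v
      using cent centerD(2) that by blast
    then show False using non_abelian group_comm_groupI by blast
  qed
  have "\<exists>e. embeds_pair D8 e (x i) (y i) \<and>
      (\<forall>u\<in>e ` carrier D8. u \<otimes> x i = x i \<otimes> u \<longrightarrow> u \<otimes> y i = y i \<otimes> u \<longrightarrow> u \<in> {\<one>, c})" if "i < k" for i
  proof -
    note hi = hyperbolicD[OF h that] sq[OF that]
    show ?thesis
    proof (rule D8_embeds_pair[OF hi(1) _ hi(2) _ hi(3) derived_c])
      show "x i \<otimes> x i = \<one>" "y i \<otimes> y i = \<one>" using hi(5) by simp_all
    qed blast
  qed
  then obtain e where e: "\<And>i. i < k \<Longrightarrow> embeds_pair D8 (e i) (x i) (y i)"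
    "\<And>i u. \<lbrakk>i < k; u \<in> e i ` carrier D8; u \<otimes> x i = x i \<otimes> u; u \<otimes> y i = y i \<otimes> u\<rbrakk> \<Longrightarrow> u \<in> {\<one>, c}"
    by metis
  have gz: "subgroup (generate G {z}) G" using z_closed by (intro generate_is_subgroup) simp
  have gt: "subgroup (generate G {t}) G" using t_closed by (intro generate_is_subgroup) simp
  have c_in: "{\<one>, c} \<subseteq> generate G {z}" using c_gen generate.one by simp
  let ?CP = "central_product (replicate k (nonabelian_factor D8) @ [cyclic_factor (Cyc (2 ^ (n + 1)))])"
  obtain P where P: "subgroup P G" "G\<lparr>carrier := P\<rparr> \<cong> ?CP" "pairs k x y \<subseteq> P" "z \<in> P"
    "P \<inter> center G \<subseteq> generate G {z}"
  proof (rule hyperbolic_central_product[OF h e(1) z_center ord_z _ c_gen generate_z_involution gz])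
    fix P
    assume "subgroup P G" "G\<lparr>carrier := P\<rparr> \<cong> central_product (map (\<lambda>i. nonabelian_factor D8) [0..<k] @
        [cyclic_factor (Cyc (2 ^ (n + 1)))])" "pairs k x y \<subseteq> P" "z \<in> P" "P \<inter> center G \<subseteq> generate G {z}"
    then show thesis using that by (simp add: map_replicate_const)
  next
    show "u \<in> {\<one>, c}"
      if "0 < i" "i < k" "u \<in> e i ` carrier D8" "u \<otimes> x i = x i \<otimes> u" "u \<otimes> y i = y i \<otimes> u" for i u
      by (rule e(2)[OF that(2-5)])
    show "u \<in> generate G {z} \<and> (u \<in> generate G {z} \<longrightarrow> u \<in> {\<one>, c})"
      if "0 < k" "u \<in> e 0 ` carrier D8" "u \<otimes> x 0 = x 0 \<otimes> u" "u \<otimes> y 0 = y 0 \<otimes> u" for u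
      using e(2)[OF that] c_in by blast
  qed simp_all
  have t_comm: "a \<otimes> b = b \<otimes> a" if "a \<in> P" "b \<in> generate G {t}" for a b
    using centerD(2)[of b a] generate_center[OF t_center] subgroup.mem_carrier[OF P(1)] that by auto
  let ?Q = "P <#> generate G {t}"
  have Q: "subgroup ?Q G" by (rule subgroup_commuting_product[OF P(1) gt t_comm])
  have "P \<inter> generate G {t} = {\<one>}"
  proof
    show "P \<inter> generate G {t} \<subseteq> {\<one>}"
    proof
      fix p assume p: "p \<in> P \<inter> generate G {t}"
      then obtain j :: int where j: "p = t [^] j" using generate_singleton[OF t_closed] by auto
      have "p \<in> generate G {z}" using p generate_center[OF t_center] P(5) by blast
      then show "p \<in> {\<one>}" using t_pow_generate_z j by simp
    qed
  qed (use subgroup.one_closed[OF P(1)] subgroup.one_closed[OF gt] in blast)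
  then have "G\<lparr>carrier := ?Q\<rparr> \<cong> G\<lparr>carrier := P\<rparr> \<times>\<times> G\<lparr>carrier := generate G {t}\<rparr>"
    by (intro commuting_product_iso_DirProd[OF P(1) gt t_comm])
  also have "G\<lparr>carrier := P\<rparr> \<times>\<times> G\<lparr>carrier := generate G {t}\<rparr> \<cong> ?CP \<times>\<times> integer_mod_group (2 ^ m)"
    by (rule group.DirProd_iso_trans[OF subgroup.subgroup_is_group[OF P(1) is_group] P(2)
          generate_iso_integer_mod_group[OF t_closed ord_t]]) simp
  finally have Q_iso: "G\<lparr>carrier := ?Q\<rparr> \<cong> ?CP \<times>\<times> integer_mod_group (2 ^ m)" .
  have PQ: "P \<subseteq> ?Q" by (rule set_mult_left_incl[OF gt subgroup.subset[OF P(1)]])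
  have "t \<in> ?Q"
    using set_mult_right_incl[OF P(1) subgroup.subset[OF gt]] generate.incl[of t "{t}" G] by blast
  moreover have "?Q \<inter> W \<subseteq> {\<one>}"
  proof
    fix w assume w: "w \<in> ?Q \<inter> W"
    then obtain p j where p: "w = p \<otimes> t [^] (j::int)" "p \<in> P"
      using generate_singleton[OF t_closed] unfolding set_mult_def by auto
    \<comment> \<open>Since \<open>w\<close> and the power of \<open>t\<close> are central, so is
      \<open>p\<close>, which is then a power of \<open>z\<close>. Thus \<open>w\<close> has no
      component in \<open>W\<close> and must be trivial.\<close>
    have "t [^] j \<in> center G" by (rule subgroup_int_pow[OF subgroup_center t_center])
    then have "p \<in> center G"
      using w p W_center subgroup_mult_right_iff[OF subgroup_center, of "t [^] j" p]
        subgroup.mem_carrier[OF P(1)] by auto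
    then obtain i :: int where "p = z [^] i"
      using P(5) p(2) generate_singleton[OF z_closed] by blast
    then show "w \<in> {\<one>}" using zt_in_W w p(1) by simp
  qed
  ultimately show "G \<cong> (?CP \<times>\<times> integer_mod_group (2 ^ m)) \<times>\<times> Z2_power r"
    using P(3,4) PQ by (intro product_with_W[OF Q _ _ _ h _ cent Q_iso]) auto
qed

text \<open>The exceptional pair at index 0 gives \<open>M2\<close>, and
  \<open>x 0 \<otimes> x 0 = t\<close> puts \<open>t\<close> into that factor. The central product
  therefore contains both \<open>z\<close> and \<open>t\<close>, and only \<open>W\<close> is left
  to split off.\<close>

lemma classification_M2:
  assumes h: "hyperbolic (Suc k) x y"
    and sq: "\<And>i. 0 < i \<Longrightarrow> i < Suc k \<Longrightarrow> x i \<otimes> x i = \<one> \<and> y i \<otimes> y i = \<one>"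
    and sq0: "x 0 \<otimes> x 0 = t" "y 0 \<otimes> y 0 = \<one>"
    and cent: "centralizer G (pairs (Suc k) x y) \<subseteq> center G"
  shows "G \<cong> central_product ([nonabelian_factor (M2 (m + 1))] @ replicate k (nonabelian_factor D8) @
      [cyclic_factor (Cyc (2 ^ (n + 1)))]) \<times>\<times> Z2_power r"
proof -
  have gz: "subgroup (generate G {z}) G" using z_closed by (intro generate_is_subgroup) simp
  have gt: "subgroup (generate G {t}) G" using t_closed by (intro generate_is_subgroup) simp
  have c_in: "{\<one>, c} \<subseteq> generate G {z}" using c_gen generate.one by simp
  \<comment> \<open>Elements of the \<open>M2\<close> factor commuting with its pair are products of
    powers of \<open>t\<close> and \<open>c\<close>, so the bound for central elements must include
    the powers of \<open>t\<close>.\<close>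
  let ?T = "generate G {z} <#> generate G {t}"
  have zt_comm: "a \<otimes> b = b \<otimes> a" if "a \<in> generate G {z}" "b \<in> generate G {t}" for a b
    using centerD(2)[of b a] generate_center[OF t_center] subgroup.mem_carrier[OF gz] that by auto
  have T: "subgroup ?T G" by (rule subgroup_commuting_product[OF gz gt zt_comm])
  have zT: "generate G {z} \<subseteq> ?T" by (rule set_mult_left_incl[OF gt subgroup.subset[OF gz]])
  have tT: "generate G {t} \<subseteq> ?T" by (rule set_mult_right_incl[OF gz subgroup.subset[OF gt]])
  have t_nat: "t [^] (l::nat) = \<one>" if "t [^] l \<in> generate G {z}" for l
    using t_pow_generate_z[of "int l"] that by (simp add: int_pow_int)
  define F where "F = case_nat (M2 (m + 1)) (\<lambda>_. D8)"
  have "\<exists>e. embeds_pair (F i) e (x i) (y i) \<and>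
      (\<forall>u\<in>e ` carrier (F i). u \<otimes> x i = x i \<otimes> u \<longrightarrow> u \<otimes> y i = y i \<otimes> u \<longrightarrow>
         (if i = 0 then u \<in> ?T \<and> (u \<in> generate G {z} \<longrightarrow> u \<in> {\<one>, c}) else u \<in> {\<one>, c}))"
    if i: "i < Suc k" for i
  proof (cases "i = 0")
    case True
    note h0 = hyperbolicD[OF h zero_less_Suc]
    have ord0: "ord (x 0 \<otimes> x 0) = 2 ^ m" by (simp add: sq0 ord_t)
    show ?thesis
    proof (rule M2_embeds_pair[OF h0(1) ord0 h0(2) sq0(2) h0(3) derived_c])
      show "(x 0 \<otimes> x 0) [^] l = \<one>" if "(x 0 \<otimes> x 0) [^] l \<in> {\<one>, c}" for l :: nat
        using t_nat[of l] that c_in by (auto simp: sq0)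
      fix e assume e: "embeds_pair (M2 (m + 1)) e (x 0) (y 0)"
        and pow: "\<And>u. \<lbrakk>u \<in> e ` carrier (M2 (m + 1)); u \<otimes> x 0 = x 0 \<otimes> u; u \<otimes> y 0 = y 0 \<otimes> u\<rbrakk>
          \<Longrightarrow> \<exists>(k::nat) (l::nat). u = (x 0 \<otimes> x 0) [^] k \<otimes> c [^] l"
      have "u \<in> ?T \<and> (u \<in> generate G {z} \<longrightarrow> u \<in> {\<one>, c})"
        if u: "u \<in> e ` carrier (M2 (m + 1))" "u \<otimes> x 0 = x 0 \<otimes> u" "u \<otimes> y 0 = y 0 \<otimes> u" for u
      proof -
        obtain l l' :: nat where u': "u = t [^] l \<otimes> c [^] l'" using pow[OF u] by (auto simp: sq0)
        have c': "c [^] l' \<in> generate G {z}" by (rule subgroup_nat_pow[OF gz c_gen])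
        have t': "t [^] l \<in> ?T" using subgroup_nat_pow[OF gt generate.incl, of t l] tT by auto
        have "u \<in> ?T" unfolding u' using c' t' zT by (intro subgroup.m_closed[OF T]) auto
        \<comment> \<open>Cancelling the power of \<open>c\<close> leaves a power of
          \<open>t\<close> among the powers of \<open>z\<close>; independence makes it
          trivial.\<close>
        moreover have "u \<in> {\<one>, c}" if "u \<in> generate G {z}"
        proof -
          have "t [^] l \<in> generate G {z}"
            using that subgroup_mult_right_iff[OF gz c', of "t [^] l"] t_closed unfolding u' by simp
          from t_nat[OF this] have "u = c [^] l'" by (simp add: u')
          then show ?thesis by (simp add: c_pow)
        qed
        ultimately show ?thesis by blast
      qed
      then show ?thesis using e True by (intro exI[of _ e]) (simp add: F_def)
    qed
  next
    case False
    note hi = hyperbolicD[OF h i]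
    have F: "F i = D8" using False by (cases i) (simp_all add: F_def)
    show ?thesis
    proof (rule D8_embeds_pair[OF hi(1) _ hi(2) _ hi(3) derived_c])
      show "x i \<otimes> x i = \<one>" "y i \<otimes> y i = \<one>" using sq[OF _ i] False by simp_all
      fix e assume "embeds_pair D8 e (x i) (y i)"
        and "\<And>u. \<lbrakk>u \<in> e ` carrier D8; u \<otimes> x i = x i \<otimes> u; u \<otimes> y i = y i \<otimes> u\<rbrakk> \<Longrightarrow> u \<in> {\<one>, c}"
      then show ?thesis unfolding F using False by (intro exI[of _ e]) simp
    qed
  qed
  then obtain e where e: "\<And>i. i < Suc k \<Longrightarrow> embeds_pair (F i) (e i) (x i) (y i)"
    "\<And>i u. \<lbrakk>i < Suc k; u \<in> e i ` carrier (F i); u \<otimes> x i = x i \<otimes> u; u \<otimes> y i = y i \<otimes> u\<rbrakk> \<Longrightarrow>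
       (if i = 0 then u \<in> ?T \<and> (u \<in> generate G {z} \<longrightarrow> u \<in> {\<one>, c}) else u \<in> {\<one>, c})"
    by metis
  let ?CP = "central_product ([nonabelian_factor (M2 (m + 1))] @ replicate k (nonabelian_factor D8) @
      [cyclic_factor (Cyc (2 ^ (n + 1)))])"
  have factors: "map (\<lambda>i. nonabelian_factor (F i)) [0..<Suc k] =
      nonabelian_factor (M2 (m + 1)) # replicate k (nonabelian_factor D8)"
    by (rule nth_equalityI) (auto simp: F_def nth_Cons' simp del: upt_Suc split: nat.split)
  obtain P where P: "subgroup P G" "G\<lparr>carrier := P\<rparr> \<cong> ?CP" "pairs (Suc k) x y \<subseteq> P" "z \<in> P"
    "P \<inter> center G \<subseteq> ?T"
  proof (rule hyperbolic_central_product[OF h e(1) z_center ord_z _ c_gen generate_z_involution T zT])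
    fix P
    assume "subgroup P G" "G\<lparr>carrier := P\<rparr> \<cong> central_product (map (\<lambda>i. nonabelian_factor (F i)) [0..<Suc k] @
        [cyclic_factor (Cyc (2 ^ (n + 1)))])" "pairs (Suc k) x y \<subseteq> P" "z \<in> P" "P \<inter> center G \<subseteq> ?T"
    then show thesis using that unfolding factors by simp
  next
    show "u \<in> {\<one>, c}"
      if "0 < i" "i < Suc k" "u \<in> e i ` carrier (F i)" "u \<otimes> x i = x i \<otimes> u" "u \<otimes> y i = y i \<otimes> u" for i u
      using e(2)[OF that(2-5)] that(1) by simp
    show "u \<in> ?T \<and> (u \<in> generate G {z} \<longrightarrow> u \<in> {\<one>, c})"
      if "0 < Suc k" "u \<in> e 0 ` carrier (F 0)" "u \<otimes> x 0 = x 0 \<otimes> u" "u \<otimes> y 0 = y 0 \<otimes> u" for u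
      using e(2)[OF that] by simp
  qed simp_all
  have "x 0 \<in> P" using P(3) by (auto simp: pairs_def)
  then have "t \<in> P" using subgroup.m_closed[OF P(1), of "x 0" "x 0"] sq0 by simp
  moreover have "P \<inter> W \<subseteq> {\<one>}"
  proof
    fix w assume w: "w \<in> P \<inter> W"
    then have "w \<in> ?T" using W_center P(5) by blast
    then obtain i j :: int where "w = z [^] i \<otimes> t [^] j"
      using generate_singleton[OF t_closed] generate_singleton[OF z_closed] unfolding set_mult_def by auto
    then show "w \<in> {\<one>}" using zt_in_W w by simp
  qed
  ultimately show ?thesis
    by (intro product_with_W[OF P(1,4) _ _ h P(3) cent P(2)])
qed

end

section \<open>From the hypotheses on \<open>G\<close> to the two structural cases\<close>

theorem theorem3p10:
  fixes G :: "('a, 'b) monoid_scheme" (structure)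
    and N :: "'a set" and c :: 'a and z :: "nat \<Rightarrow> 'a" and n m r :: nat
  assumes "1 \<le> m" and "m \<le> n"
    and "group G" and "finite (carrier G)" and "\<exists>s. order G = 2 ^ s" and "\<not> comm_group G"
    and "subgroup N G" and "N \<subseteq> center G"
    and "G\<lparr>carrier := N\<rparr> \<cong> integer_mod_group (2 ^ n) \<times>\<times> integer_mod_group (2 ^ m)"
    and "elementary_abelian_2 (G Mod N)"
    and "c \<in> carrier G" and "group.ord G c = 2" and "derived G (carrier G) = generate G {c}"
    and "2 \<le> r"
    and "\<forall>i\<in>{1..r}. z i \<in> carrier G"
    and "internal_direct_product G (map (\<lambda>i. generate G {z i}) [1..<r + 1]) (center G)"
    and "group.ord G (z 1) = 2 ^ (n + 1)" and "group.ord G (z 2) = 2 ^ m"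
    and "\<forall>i\<in>{3..r}. group.ord G (z i) = 2"
    and "internal_direct_product G [generate G {z 1 [^] (2::nat)}, generate G {z 2}] N"
    and "c \<in> generate G {z 1}"
  shows
    "(\<exists>k\<ge>1. G \<cong>
        central_product
          ([nonabelian_factor (M2 (m + 1))] @ replicate (k - 1) (nonabelian_factor D8)
            @ [cyclic_factor (Cyc (2 ^ (n + 1)))])
        \<times>\<times> Z2_power (r - 2))
   \<or> (\<exists>k\<ge>2. G \<cong>
        central_product
          ([nonabelian_factor (M2 (m + 1)), nonabelian_factor Q8]
            @ replicate (k - 2) (nonabelian_factor D8) @ [cyclic_factor (Cyc (2 ^ (n + 1)))])
        \<times>\<times> Z2_power (r - 2))
   \<or> (\<exists>k\<ge>1. G \<cong>
        (central_product
          (replicate k (nonabelian_factor D8) @ [cyclic_factor (Cyc (2 ^ (n + 1)))])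
        \<times>\<times> integer_mod_group (2 ^ m)) \<times>\<times> Z2_power (r - 2))
   \<or> (\<exists>k\<ge>1. G \<cong>
        (central_product
          ([nonabelian_factor Q8] @ replicate (k - 1) (nonabelian_factor D8)
            @ [cyclic_factor (Cyc (2 ^ (n + 1)))])
        \<times>\<times> integer_mod_group (2 ^ m)) \<times>\<times> Z2_power (r - 2))"
proof -
  interpret group G by fact
  have z: "z i \<in> carrier G" if "i \<in> {1..r}" for i using assms(15) that by blast
  have z1: "z 1 \<in> carrier G" and z2: "z 2 \<in> carrier G" using z assms(14) by auto
  have zord: "ord (z i) = 2" if "i \<in> {3..r}" for i using assms(19) that by blast
  obtain W where W: "subgroup W G" "W \<subseteq> center G" "G\<lparr>carrier := W\<rparr> \<cong> Z2_power (r - 2)"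
    and span: "\<And>x. x \<in> center G \<Longrightarrow> \<exists>(i::int) (j::int). \<exists>w\<in>W. x = z 1 [^] i \<otimes> (z 2 [^] j \<otimes> w)"
    and indep: "\<And>(i::int) (j::int) w. w \<in> W \<Longrightarrow> z 1 [^] i \<otimes> (z 2 [^] j \<otimes> w) = \<one> \<Longrightarrow>
       z 1 [^] i = \<one> \<and> z 2 [^] j = \<one> \<and> w = \<one>"
  proof (rule internal_direct_product_cyclic[OF assms(16,14)])
    show "z i \<in> carrier G" if "i \<in> {1..r}" for i by (rule z[OF that])
    show "ord (z i) = 2" if "i \<in> {3..r}" for i by (rule zord[OF that])
    fix W
    assume "subgroup W G" "W \<subseteq> center G" "G\<lparr>carrier := W\<rparr> \<cong> Z2_power (r - 2)"
      "\<And>x. x \<in> center G \<Longrightarrow> \<exists>(i::int) (j::int). \<exists>w\<in>W. x = z 1 [^] i \<otimes> (z 2 [^] j \<otimes> w)"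
      "\<And>(i::int) (j::int) w. w \<in> W \<Longrightarrow> z 1 [^] i \<otimes> (z 2 [^] j \<otimes> w) = \<one> \<Longrightarrow>
         z 1 [^] i = \<one> \<and> z 2 [^] j = \<one> \<and> w = \<one>"
    then show thesis by (rule that)
  qed
  have Hs: "map (\<lambda>i. generate G {z i}) [1..<r + 1] ! i = generate G {z (Suc i)}" if "i < r" for i
    using that by (simp del: upt_Suc)
  have z_center: "z (Suc i) \<in> center G" if "i < r" for i
  proof -
    have "z (Suc i) \<in> map (\<lambda>i. generate G {z i}) [1..<r + 1] ! i"
      unfolding Hs[OF that] by (simp add: generate.incl)
    then show ?thesis
      unfolding internal_direct_productD(3)[OF assms(16)] using that by (intro generate.incl UN_I[of i]) auto
  qed
  have z1c: "z 1 \<in> center G" and z2c: "z 2 \<in> center G"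
    using z_center[of 0] z_center[of 1] assms(14) by (simp_all add: numeral_2_eq_2)
  have center_sub: "subgroup (center G) G"
    unfolding center_eq_centralizer by (simp add: subgroup_centralizer)
  obtain i0 :: int where i0: "c = z 1 [^] i0" using assms(21) generate_singleton[OF z1] by auto
  have cc: "c \<in> center G" unfolding i0 by (rule subgroup_int_pow[OF center_sub z1c])
  have c2: "c \<otimes> c = \<one>"
    using pow_eq_id[OF assms(11), of 2] assms(11,12) by (simp add: numeral_eq_Suc)
  have c1: "c \<noteq> \<one>" using ord_eq_1[OF assms(11)] assms(12) by auto
  have der: "derived G (carrier G) \<subseteq> {\<one>, c}"
    unfolding assms(13) by (rule generate_subgroup_incl[OF _ subgroup_involution[OF assms(11) c2]]) simp
  have commutator: "u \<otimes> v = v \<otimes> u \<or> u \<otimes> v = c \<otimes> (v \<otimes> u)" if uv: "u \<in> carrier G" "v \<in> carrier G" for u v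
  proof -
    have "u \<otimes> v \<otimes> inv u \<otimes> inv v \<in> derived G (carrier G)"
      unfolding derived_def using uv by (intro generate.incl) blast
    then have "u \<otimes> v \<otimes> inv u \<otimes> inv v \<in> {\<one>, c}" using der by blast
    moreover have "(u \<otimes> v \<otimes> inv u \<otimes> inv v) \<otimes> (v \<otimes> u) = u \<otimes> v \<otimes> (inv u \<otimes> ((inv v \<otimes> v) \<otimes> u))"
      using uv by (simp only: m_assoc m_closed inv_closed)
    then have "u \<otimes> v = (u \<otimes> v \<otimes> inv u \<otimes> inv v) \<otimes> (v \<otimes> u)" using uv by simp
    ultimately show ?thesis using uv by (elim insertE emptyE) simp_all
  qed
  \<comment> \<open>The exponent of \<open>c\<close> is thus a multiple of \<open>2 ^ n\<close> with
    \<open>n\<close> at least 1, hence even; half of it gives the square root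
    \<open>s\<close>.\<close>
  have "int (2 ^ (n + 1)) dvd 2 * i0"
  proof -
    have "z 1 [^] (2 * i0) = \<one>" using c2 z1 int_pow_mult[of "z 1" i0 i0] by (simp add: i0)
    then show ?thesis using int_pow_eq_id[OF z1] assms(17) by simp
  qed
  then have "even i0" using assms(1,2) by (simp add: dvd_trans[of 2 "2 ^ n"])
  then obtain l where l: "i0 = l + l" by (metis evenE mult_2)
  define s where "s = z 1 [^] l"
  have s: "s \<in> center G" "s \<otimes> s = c"
    unfolding s_def by (rule subgroup_int_pow[OF center_sub z1c]) (unfold i0 l, rule int_pow_mult[OF z1, symmetric])
  have square_in_N: "g \<otimes> g \<in> N" if g: "g \<in> carrier G" for g
  proof -
    have "N \<lhd> G"
    proof (rule normalI[OF assms(7)], intro ballI)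
      fix x assume x: "x \<in> carrier G"
      have "h \<otimes> x = x \<otimes> h" if "h \<in> N" for h
        using that assms(8) x by (auto simp: center_def)
      then show "N #> x = x <# N" by (auto simp: r_coset_def l_coset_def)
    qed
    then interpret N: normal N G .
    interpret Q: group "G Mod N" by (rule N.factorgroup_is_group)
    have gN: "N #> g \<in> carrier (G Mod N)" using g by (auto simp: FactGroup_def RCOSETS_def)
    have "(N #> g) [^]\<^bsub>G Mod N\<^esub> (2::nat) = \<one>\<^bsub>G Mod N\<^esub>"
      using assms(10) gN by (simp add: elementary_abelian_2_def)
    then have "(N #> g) \<otimes>\<^bsub>G Mod N\<^esub> (N #> g) = \<one>\<^bsub>G Mod N\<^esub>"
      by (simp only: numeral_2_eq_2 Q.nat_pow_Suc Q.nat_pow_0 Q.l_one[OF gN])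
    then have "N #> (g \<otimes> g) = N" using g by (simp add: FactGroup_def N.rcos_sum)
    then show ?thesis using rcos_self[OF m_closed[OF g g] assms(7)] by (simp only:)
  qed
  \<comment> \<open>The square of \<open>g\<close> lies in \<open>N\<close>, so it is
    \<open>z 1\<close> to an even power \<open>2 * i\<close> times \<open>z 2\<close> to some power
    \<open>j\<close>. The central \<open>u = z 1 [^] i \<otimes> z 2 [^] (j div 2)\<close> absorbs
    everything except \<open>z 2 [^] (j mod 2)\<close>, and its inverse is the correcting
    element.\<close>
  have squares: "\<exists>u\<in>center G. (g \<otimes> u) \<otimes> (g \<otimes> u) \<in> {\<one>, z 2}" if g: "g \<in> carrier G" for g
  proof -
    obtain a b where ab: "a \<in> generate G {z 1 [^] (2::nat)}" "b \<in> generate G {z 2}" "g \<otimes> g = a \<otimes> b"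
      by (rule internal_direct_product_two[OF assms(20) square_in_N[OF g]])
    obtain i :: int where "a = (z 1 [^] (2::nat)) [^] i"
      using ab(1) generate_singleton[of "z 1 [^] (2::nat)"] z1 by auto
    also have "\<dots> = z 1 [^] (2 * i)"
      using int_pow_pow[OF z1, of 2 i] int_pow_int[of G "z 1" 2] by simp
    finally have a: "a = z 1 [^] i \<otimes> z 1 [^] i" using int_pow_mult[OF z1, of i i] by simp
    obtain j :: int where j: "b = z 2 [^] j" using ab(2) generate_singleton[OF z2] by auto
    define q where "q = j div 2"
    have "j = q + q + j mod 2" unfolding q_def by presburger
    then have b: "b = z 2 [^] q \<otimes> z 2 [^] q \<otimes> z 2 [^] (j mod 2)"
      unfolding j using z2 by (metis int_pow_mult)
    define u where "u = z 1 [^] i \<otimes> z 2 [^] q"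
    have u: "u \<in> center G"
      unfolding u_def by (intro subgroup.m_closed[OF center_sub] subgroup_int_pow[OF center_sub] z1c z2c)
    have car: "u \<in> carrier G" "inv u \<in> center G" using u subgroup.m_inv_closed[OF center_sub u] by (auto simp: center_def)
    have "u \<otimes> u = (z 1 [^] i \<otimes> z 1 [^] i) \<otimes> (z 2 [^] q \<otimes> z 2 [^] q)"
      unfolding u_def using z1 z2 subgroup_int_pow[OF center_sub z1c, of i]
      by (intro square_mult_commute) (auto simp: center_def)
    then have gg: "g \<otimes> g = (u \<otimes> u) \<otimes> z 2 [^] (j mod 2)"
      unfolding ab(3) a b using z1 z2 by (simp add: m_assoc)
    have "(g \<otimes> inv u) \<otimes> (g \<otimes> inv u) = (g \<otimes> g) \<otimes> (inv u \<otimes> inv u)"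
      using g car by (intro square_mult_commute) (auto simp: center_def)
    also have "\<dots> = (inv u \<otimes> inv u) \<otimes> (g \<otimes> g)"
      using subgroup.m_closed[OF center_sub car(2) car(2)] g by (simp add: center_def)
    also have "\<dots> = (inv u \<otimes> ((inv u \<otimes> u) \<otimes> u)) \<otimes> z 2 [^] (j mod 2)"
      unfolding gg using car(1) z2 by (simp only: m_assoc m_closed inv_closed int_pow_closed)
    also have "\<dots> = z 2 [^] (j mod 2)" using car(1) z2 by simp
    finally have sq: "(g \<otimes> inv u) \<otimes> (g \<otimes> inv u) = z 2 [^] (j mod 2)" .
    have "j mod 2 = 0 \<or> j mod 2 = 1" by presburger
    then have "z 2 [^] (j mod 2) \<in> {\<one>, z 2}" using z2 by auto
    then show ?thesis using sq car(2) by auto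
  qed
  have "g \<otimes> c = c \<otimes> g" if "g \<in> carrier G" for g using cc that by (simp add: center_def)
  then interpret central_involution G c
    by (intro central_involution.intro central_involution_axioms.intro is_group assms(11) c1 c2)
  interpret two_step G c
    by unfold_locales (rule commutator)
  interpret two_step_squares G c "z 2" s
    by unfold_locales (fact assms(4) z2c s squares)+
  interpret two_step_center G c "z 2" s "z 1" W n m "r - 2"
    by (rule two_step_center.intro[OF two_step_squares_axioms], rule two_step_center_axioms.intro)
      (fact z1c assms(6,17,18,21) W span indep der)+
  show ?thesis
  proof (rule hyperbolic_structure)
    fix k x y
    assume "hyperbolic k x y" "\<And>i. i < k \<Longrightarrow> x i \<otimes> x i = \<one> \<and> y i \<otimes> y i = \<one>"
      "centralizer G (pairs k x y) \<subseteq> center G"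
    from classification_split[OF this] show ?thesis by blast
  next
    fix k x y
    assume "hyperbolic (Suc k) x y"
      "\<And>i. 0 < i \<Longrightarrow> i < Suc k \<Longrightarrow> x i \<otimes> x i = \<one> \<and> y i \<otimes> y i = \<one>"
      "x 0 \<otimes> x 0 = z 2" "y 0 \<otimes> y 0 = \<one>" "centralizer G (pairs (Suc k) x y) \<subseteq> center G"
    \<comment> \<open>The theorem's \<open>k\<close> counts the \<open>M2\<close> factor as well, so
      it exceeds the number of copies of \<open>D8\<close> by one.\<close>
    from classification_M2[OF this] show ?thesis
      by (intro disjI1 exI[of _ "Suc k"]) simp
  qed
qed

end
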